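(* Let $M$ be a manifold, $\nabla$ an affine connection on $TM$ with torsion $T$, and $H:T^*M\to\mathbb{R}$ a smooth Hamiltonian function which is parallel with respect to $\nabla$. Let $\hat\nabla$ be the adjoint connection of $\nabla$, $\hat R$ its curvature, and $\hat h$ the horizontal lift to $T^*M$ with respect to $\hat\nabla$. (a) Let $\gamma(t)$ be a curve in $M$ and let $p(t),\lambda_1(t),\lambda_2(t)$ be $\nabla$-parallel forms along $\gamma(t)$. Then $$\frac{d}{dt}\lambda_1(t)(H'_{p(t)})=0,\qquad\frac{d}{dt}\langle\lambda_1(t),\lambda_2(t)\rangle_{H''_{p(t)}}=0.$$ (b) For arbitrary $X\in\Gamma(TM)$ and $\beta\in\Gamma(T^*M)$, at every $p\in T^*M$, $$[\vec H,\hat hX]|_p=\hat h_p\hat\nabla_{H'_p}X+\hat h_p\,\sharp^{H''_p}T^*_{X_{\pi(p)}}p-\mathrm{vl}_p\,\hat R(H'_p,X_{\pi(p)})p,$$ $$[\vec H,\mathrm{vl}\,\beta]|_p=-\hat h_p\,\sharp^{H''_p}\beta+\mathrm{vl}_p\,\hat\nabla_{H'_p}\beta.$$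
   Context: $\pi:T^*M\to M$ is the projection. For $p,\alpha\in T^*_xM$, $\mathrm{vl}_p\alpha=\frac{d}{dt}(p+t\alpha)|_{t=0}$; for a one-form $\beta$, $\mathrm{vl}\,\beta|_p=\mathrm{vl}_p\beta_{\pi(p)}$. For a connection on $TM$ (with induced connection on $T^*M$), the horizontal lift $h_pv\in T_pT^*M$ of $v\in T_{\pi(p)}M$ is the unique vector with $\pi_*h_pv=v$ that is tangent to a curve of covectors parallel along its projection; $hX|_p=h_pX_{\pi(p)}$. Torsion $T(X,Y)=\nabla_XY-\nabla_YX-[X,Y]$; adjoint connection $\hat\nabla_XY=\nabla_XY-T(X,Y)$ (and the induced connection on $T^*M$); curvature $\hat R(X,Y)=[\hat\nabla_X,\hat\nabla_Y]-\hat\nabla_{[X,Y]}$, here acting on $T^*M$. $T^*_vp=p(T(v,\cdot))\in T^*_xM$. $H'\in\Gamma(\pi^*TM)$ is defined by $\alpha(H'_p)=dH(\mathrm{vl}_p\alpha)$. $H$ is parallel with respect to $\nabla$ if $dH(h_pv)=0$ for all $p,v$, $h$ being the horizontal lift of $\nabla$. $\langle\lambda_1,\lambda_2\rangle_{H''_p}=\frac{\partial^2}{\partial s_1\partial s_2}H(p+s_1\lambda_1+s_2\lambda_2)|_{s_1=s_2=0}$ for $\lambda_1,\lambda_2\in T^*_{\pi(p)}M$, and $\sharp^{H''_p}:T^*_{\pi(p)}M\to T_{\pi(p)}M$ is defined by $\langle\lambda_1,\lambda_2\rangle_{H''_p}=\lambda_1(\sharp^{H''_p}\lambda_2)$. $\vec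 H$ is the Hamiltonian vector field for the canonical symplectic structure; in canonical coordinates $(x^i,p_i)$, $\vec H=\sum_i\frac{\partial H}{\partial p_i}\partial_{x^i}-\frac{\partial H}{\partial x^i}\partial_{p_i}$. *)

theory Defs
  imports "HOL-Analysis.Analysis" "HOL-Library.Function_Algebras"
begin

text \<open>Smooth manifolds given by an atlas, tangent and cotangent spaces, affine connections, and the
  cotangent bundle as a manifold in its own right. The manifold is the union of the chart domains;
  all objects take the atlas as first argument.\<close>

section \<open>Function spaces as real vector spaces\<close>

instantiation "fun" :: (type, real_vector) real_vector
begin

definition scaleR_fun :: "real \<Rightarrow> ('a \<Rightarrow> 'b) \<Rightarrow> 'a \<Rightarrow> 'b"
  where "scaleR_fun r f = (\<lambda>x. r *\<^sub>R f x)"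

instance
  by standard (simp_all add: scaleR_fun_def plus_fun_def fun_eq_iff scaleR_add_right scaleR_add_left)

end


section \<open>Smooth maps between open subsets of normed spaces\<close>

text \<open>For open \<open>S\<close> in a finite-dimensional space: all iterated directional derivatives up to
  order \<open>k\<close> exist and are continuous.\<close>

primrec Ck_on :: "nat \<Rightarrow> 'a::real_normed_vector set \<Rightarrow> ('a \<Rightarrow> 'b::real_normed_vector) \<Rightarrow> bool"
  where
    "Ck_on 0 S f = continuous_on S f"
  | "Ck_on (Suc k) S f =
      ((\<forall>x\<in>S. f differentiable (at x)) \<and> (\<forall>v. Ck_on k S (\<lambda>x. frechet_derivative f (at x) v)))"

definition smooth_on :: "'a::real_normed_vector set \<Rightarrow> ('a \<Rightarrow> 'b::real_normed_vector) \<Rightarrow> bool"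
  where "smooth_on S f \<longleftrightarrow> (\<forall>k. Ck_on k S f)"


section \<open>Charts and smooth manifolds\<close>

text \<open>A chart is a pair \<open>(U, \<phi>)\<close>; the values of \<open>\<phi>\<close> outside \<open>U\<close> are irrelevant.\<close>

type_synonym ('m, 'e) chart = "'m set \<times> ('m \<Rightarrow> 'e)"

abbreviation chart_dom :: "('m, 'e) chart \<Rightarrow> 'm set"
  where "chart_dom c \<equiv> fst c"

abbreviation chart_map :: "('m, 'e) chart \<Rightarrow> 'm \<Rightarrow> 'e"
  where "chart_map c \<equiv> snd c"

definition chart_inv :: "('m, 'e) chart \<Rightarrow> 'e \<Rightarrow> 'm"
  where "chart_inv c = inv_into (chart_dom c) (chart_map c)"

definition chart_image :: "('m, 'e) chart \<Rightarrow> 'e set"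
  where "chart_image c = chart_map c ` chart_dom c"

definition points :: "('m, 'e) chart set \<Rightarrow> 'm set"
  where "points A = (\<Union>c\<in>A. chart_dom c)"

definition charts_at :: "('m, 'e) chart set \<Rightarrow> 'm \<Rightarrow> ('m, 'e) chart set"
  where "charts_at A x = {c \<in> A. x \<in> chart_dom c}"

definition smooth_atlas :: "('m, 'e::euclidean_space) chart set \<Rightarrow> bool"
  where "smooth_atlas A \<longleftrightarrow>
    (\<forall>c\<in>A. inj_on (chart_map c) (chart_dom c) \<and> open (chart_image c)) \<and>
    (\<forall>c\<in>A. \<forall>d\<in>A. open (chart_map c ` (chart_dom c \<inter> chart_dom d)) \<and>
      smooth_on (chart_map c ` (chart_dom c \<inter> chart_dom d)) (chart_map d \<circ> chart_inv c))"

definition atlas_open :: "('m, 'e::euclidean_space) chart set \<Rightarrow> 'm set \<Rightarrow> bool"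
  where "atlas_open A W \<longleftrightarrow>
    W \<subseteq> points A \<and> (\<forall>c\<in>A. open (chart_map c ` (chart_dom c \<inter> W)))"

definition atlas_topology :: "('m, 'e::euclidean_space) chart set \<Rightarrow> 'm topology"
  where "atlas_topology A = topology (atlas_open A)"

lemma openin_atlas_topology:
  assumes "smooth_atlas A"
  shows "openin (atlas_topology A) W \<longleftrightarrow> atlas_open A W"
proof -
  have "istopology (atlas_open A)"
    unfolding istopology_def
  proof (intro conjI allI impI)
    fix S T assume S: "atlas_open A S" and T: "atlas_open A T"
    have "open (chart_map c ` (chart_dom c \<inter> (S \<inter> T)))" if c: "c \<in> A" for c
    proof -
      have "inj_on (chart_map c) (chart_dom c)"
        using assms c by (auto simp: smooth_atlas_def)
      then have "chart_map c ` (chart_dom c \<inter> (S \<inter> T)) =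
          chart_map c ` (chart_dom c \<inter> S) \<inter> chart_map c ` (chart_dom c \<inter> T)"
        by (auto simp: inj_on_def)
      with S T c show ?thesis
        by (simp add: atlas_open_def open_Int)
    qed
    with S show "atlas_open A (S \<inter> T)"
      by (auto simp: atlas_open_def)
  next
    fix \<K> assume K: "\<forall>K\<in>\<K>. atlas_open A K"
    have "open (chart_map c ` (chart_dom c \<inter> \<Union>\<K>))" if "c \<in> A" for c
    proof -
      have "chart_map c ` (chart_dom c \<inter> \<Union>\<K>) = (\<Union>K\<in>\<K>. chart_map c ` (chart_dom c \<inter> K))"
        by blast
      moreover have "open \<dots>"
        using K that by (intro open_UN) (simp add: atlas_open_def)
      ultimately show ?thesis
        by simp
    qed
    moreover have "\<Union>\<K> \<subseteq> points A"
      using K by (auto simp: atlas_open_def)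
    ultimately show "atlas_open A (\<Union>\<K>)"
      by (simp add: atlas_open_def)
  qed
  then show ?thesis
    by (simp add: atlas_topology_def)
qed

definition smooth_manifold :: "('m, 'e::euclidean_space) chart set \<Rightarrow> bool"
  where "smooth_manifold A \<longleftrightarrow> smooth_atlas A \<and>
    Hausdorff_space (atlas_topology A) \<and> second_countable (atlas_topology A)"

definition smooth_fun :: "('m, 'e::euclidean_space) chart set \<Rightarrow> ('m \<Rightarrow> real) \<Rightarrow> bool"
  where "smooth_fun A f \<longleftrightarrow> (\<forall>c\<in>A. smooth_on (chart_image c) (f \<circ> chart_inv c))"

text \<open>The parameter domain \<open>I\<close> is an open subset of the reals. Openness of the preimages of chart
  domains is continuity of the curve.\<close>

definition smooth_curve ::
    "('m, 'e::euclidean_space) chart set \<Rightarrow> real set \<Rightarrow> (real \<Rightarrow> 'm) \<Rightarrow> bool"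
  where "smooth_curve A I \<gamma> \<longleftrightarrow> \<gamma> ` I \<subseteq> points A \<and>
    (\<forall>c\<in>A. open {t \<in> I. \<gamma> t \<in> chart_dom c} \<and>
      smooth_on {t \<in> I. \<gamma> t \<in> chart_dom c} (chart_map c \<circ> \<gamma>))"


section \<open>Tangent and cotangent spaces\<close>

text \<open>A tangent vector at \<open>x\<close> is the family of its coordinate vectors in the charts around \<open>x\<close>,
  transforming by the Jacobians of the chart transitions. The family is zero on every other argument,
  so that the vector operations are pointwise and equality in the tangent space is equality of
  functions. For \<open>x\<close> outside the manifold only the zero family remains; a section of the tangent
  bundle is thereby zero outside the manifold.\<close>

type_synonym ('m, 'e) tvec = "('m, 'e) chart \<Rightarrow> 'e"

definition tangent_space ::
    "('m, 'e::euclidean_space) chart set \<Rightarrow> 'm \<Rightarrow> ('m, 'e) tvec set"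
  where "tangent_space A x = {v.
    (\<forall>c. c \<notin> charts_at A x \<longrightarrow> v c = 0) \<and>
    (\<forall>c\<in>charts_at A x. \<forall>d\<in>charts_at A x.
      v d = frechet_derivative (chart_map d \<circ> chart_inv c) (at (chart_map c x)) (v c))}"

text \<open>The tangent vector at \<open>x\<close> with coordinates \<open>e\<close> in the chart \<open>c\<close>.\<close>

definition coord_vec ::
    "('m, 'e::euclidean_space) chart set \<Rightarrow> ('m, 'e) chart \<Rightarrow> 'm \<Rightarrow> 'e \<Rightarrow> ('m, 'e) tvec"
  where "coord_vec A c x e = (\<lambda>d. if d \<in> charts_at A x
    then frechet_derivative (chart_map d \<circ> chart_inv c) (at (chart_map c x)) e else 0)"

text \<open>Covectors are linear functionals on the tangent space, zero outside of it.\<close>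

type_synonym ('m, 'e) covec = "('m, 'e) tvec \<Rightarrow> real"

definition cotangent_space ::
    "('m, 'e::euclidean_space) chart set \<Rightarrow> 'm \<Rightarrow> ('m, 'e) covec set"
  where "cotangent_space A x = {p.
    (\<forall>v\<in>tangent_space A x. \<forall>w\<in>tangent_space A x. p (v + w) = p v + p w) \<and>
    (\<forall>r. \<forall>v\<in>tangent_space A x. p (r *\<^sub>R v) = r * p v) \<and>
    (\<forall>v. v \<notin> tangent_space A x \<longrightarrow> p v = 0)}"

definition velocity ::
    "('m, 'e::euclidean_space) chart set \<Rightarrow> (real \<Rightarrow> 'm) \<Rightarrow> real \<Rightarrow> ('m, 'e) tvec"
  where "velocity A \<gamma> t = (\<lambda>c. if c \<in> charts_at A (\<gamma> t)
    then vector_derivative (chart_map c \<circ> \<gamma>) (at t) else 0)"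

text \<open>\<open>differential A f x v\<close> is \<open>df\<^sub>x(v)\<close> for a tangent vector \<open>v\<close> at \<open>x\<close>, and
  \<open>pushforward A B F x v\<close> is the image of \<open>v\<close> under the derivative at \<open>x\<close> of a map \<open>F\<close> from the
  manifold \<open>A\<close> to the manifold \<open>B\<close>. Both are independent of the chart chosen around \<open>x\<close>.\<close>

definition differential ::
    "('m, 'e::euclidean_space) chart set \<Rightarrow> ('m \<Rightarrow> real) \<Rightarrow> 'm \<Rightarrow> ('m, 'e) tvec \<Rightarrow> real"
  where "differential A f x v = (let c = SOME c. c \<in> charts_at A x in
    frechet_derivative (f \<circ> chart_inv c) (at (chart_map c x)) (v c))"

definition pushforward ::
    "('m, 'e::euclidean_space) chart set \<Rightarrow> ('n, 'f::euclidean_space) chart set \<Rightarrow>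
      ('m \<Rightarrow> 'n) \<Rightarrow> 'm \<Rightarrow> ('m, 'e) tvec \<Rightarrow> ('n, 'f) tvec"
  where "pushforward A B F x v = (let c = SOME c. c \<in> charts_at A x in
    (\<lambda>d. if d \<in> charts_at B (F x)
      then frechet_derivative (chart_map d \<circ> F \<circ> chart_inv c) (at (chart_map c x)) (v c) else 0))"


section \<open>Vector fields and one-forms\<close>

definition vector_fields ::
    "('m, 'e::euclidean_space) chart set \<Rightarrow> ('m \<Rightarrow> ('m, 'e) tvec) set"
  where "vector_fields A = {X. (\<forall>x. X x \<in> tangent_space A x) \<and>
    (\<forall>c\<in>A. smooth_on (chart_image c) (\<lambda>y. X (chart_inv c y) c))}"

text \<open>Components \<open>p\<^sub>i = p(\<partial>\<^sub>i)\<close> of a covector at \<open>x\<close> in the chart \<open>c\<close>.\<close>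

definition covec_coords ::
    "('m, 'e::euclidean_space) chart set \<Rightarrow> ('m, 'e) chart \<Rightarrow> 'm \<Rightarrow> ('m, 'e) covec \<Rightarrow> 'e"
  where "covec_coords A c x p = (\<Sum>b\<in>Basis. p (coord_vec A c x b) *\<^sub>R b)"

definition one_forms ::
    "('m, 'e::euclidean_space) chart set \<Rightarrow> ('m \<Rightarrow> ('m, 'e) covec) set"
  where "one_forms A = {\<beta>. (\<forall>x. \<beta> x \<in> cotangent_space A x) \<and>
    (\<forall>c\<in>A. smooth_on (chart_image c) (\<lambda>y. covec_coords A c (chart_inv c y) (\<beta> (chart_inv c y))))}"

text \<open>In every chart \<open>[X, Y]\<^sup>i = X\<^sup>j \<partial>\<^sub>j Y\<^sup>i - Y\<^sup>j \<partial>\<^sub>j X\<^sup>i\<close>.\<close>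

definition lie_bracket ::
    "('m, 'e::euclidean_space) chart set \<Rightarrow> ('m \<Rightarrow> ('m, 'e) tvec) \<Rightarrow> ('m \<Rightarrow> ('m, 'e) tvec) \<Rightarrow>
      'm \<Rightarrow> ('m, 'e) tvec"
  where "lie_bracket A X Y x = (\<lambda>c. if c \<in> charts_at A x then
      frechet_derivative (\<lambda>y. Y (chart_inv c y) c) (at (chart_map c x)) (X x c) -
      frechet_derivative (\<lambda>y. X (chart_inv c y) c) (at (chart_map c x)) (Y x c)
    else 0)"


section \<open>Affine connections\<close>

text \<open>\<open>nab x v Y\<close> is \<open>\<nabla>\<^sub>v Y\<close> for a tangent vector \<open>v\<close> at \<open>x\<close> and a global vector field \<open>Y\<close>; the
  vector field \<open>\<nabla>\<^sub>X Y\<close> is \<open>\<lambda>x. nab x (X x) Y\<close>. Linearity over smooth functions in \<open>X\<close> is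
  expressed by pointwise linearity in \<open>v\<close>.\<close>

type_synonym ('m, 'e) conn =
  "'m \<Rightarrow> ('m, 'e) tvec \<Rightarrow> ('m \<Rightarrow> ('m, 'e) tvec) \<Rightarrow> ('m, 'e) tvec"

definition affine_connection ::
    "('m, 'e::euclidean_space) chart set \<Rightarrow> ('m, 'e) conn \<Rightarrow> bool"
  where "affine_connection A nab \<longleftrightarrow>
    (\<forall>X\<in>vector_fields A. \<forall>Y\<in>vector_fields A. (\<lambda>x. nab x (X x) Y) \<in> vector_fields A) \<and>
    (\<forall>x\<in>points A. \<forall>Y\<in>vector_fields A.
      (\<forall>v\<in>tangent_space A x. \<forall>w\<in>tangent_space A x. nab x (v + w) Y = nab x v Y + nab x w Y) \<and>
      (\<forall>r. \<forall>v\<in>tangent_space A x. nab x (r *\<^sub>R v) Y = r *\<^sub>R nab x v Y)) \<and>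
    (\<forall>x\<in>points A. \<forall>v\<in>tangent_space A x. \<forall>Y\<in>vector_fields A.
      (\<forall>Z\<in>vector_fields A. nab x v (Y + Z) = nab x v Y + nab x v Z) \<and>
      (\<forall>f. smooth_fun A f \<longrightarrow>
        nab x v (\<lambda>y. f y *\<^sub>R Y y) = differential A f x v *\<^sub>R Y x + f x *\<^sub>R nab x v Y))"

text \<open>Torsion and, below, curvature are tensorial: their value on vectors at \<open>x\<close> is the common
  value, at \<open>x\<close>, of the defining expression for all global sections extending these vectors.\<close>

definition torsion ::
    "('m, 'e::euclidean_space) chart set \<Rightarrow> ('m, 'e) conn \<Rightarrow>
      'm \<Rightarrow> ('m, 'e) tvec \<Rightarrow> ('m, 'e) tvec \<Rightarrow> ('m, 'e) tvec"
  where "torsion A nab x v w = (THE u.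
    \<forall>X\<in>vector_fields A. \<forall>Y\<in>vector_fields A. X x = v \<longrightarrow> Y x = w \<longrightarrow>
      u = nab x (X x) Y - nab x (Y x) X - lie_bracket A X Y x)"

definition adjoint_connection ::
    "('m, 'e::euclidean_space) chart set \<Rightarrow> ('m, 'e) conn \<Rightarrow> ('m, 'e) conn"
  where "adjoint_connection A nab = (\<lambda>x v Y. nab x v Y - torsion A nab x v (Y x))"

text \<open>\<open>torsion_form A nab x v p\<close> is \<open>T\<^sup>*\<^sub>v p = p(T(v, \<cdot>))\<close>.\<close>

definition torsion_form ::
    "('m, 'e::euclidean_space) chart set \<Rightarrow> ('m, 'e) conn \<Rightarrow>
      'm \<Rightarrow> ('m, 'e) tvec \<Rightarrow> ('m, 'e) covec \<Rightarrow> ('m, 'e) covec"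
  where "torsion_form A nab x v p =
    (\<lambda>w. if w \<in> tangent_space A x then p (torsion A nab x v w) else 0)"

text \<open>The induced connection on one-forms, characterised by the product rule
  \<open>(\<nabla>\<^sub>v \<beta>)(Y) = v(\<beta>(Y)) - \<beta>(\<nabla>\<^sub>v Y)\<close>.\<close>

definition dual_connection ::
    "('m, 'e::euclidean_space) chart set \<Rightarrow> ('m, 'e) conn \<Rightarrow>
      'm \<Rightarrow> ('m, 'e) tvec \<Rightarrow> ('m \<Rightarrow> ('m, 'e) covec) \<Rightarrow> ('m, 'e) covec"
  where "dual_connection A nab x v \<beta> = (THE q. q \<in> cotangent_space A x \<and>
    (\<forall>Y\<in>vector_fields A.
      q (Y x) = differential A (\<lambda>y. \<beta> y (Y y)) x v - \<beta> x (nab x v Y)))"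

text \<open>Curvature of the induced connection on one-forms.\<close>

definition dual_curvature ::
    "('m, 'e::euclidean_space) chart set \<Rightarrow> ('m, 'e) conn \<Rightarrow>
      'm \<Rightarrow> ('m, 'e) tvec \<Rightarrow> ('m, 'e) tvec \<Rightarrow> ('m, 'e) covec \<Rightarrow> ('m, 'e) covec"
  where "dual_curvature A nab x v w p = (THE q.
    \<forall>X\<in>vector_fields A. \<forall>Y\<in>vector_fields A. \<forall>\<beta>\<in>one_forms A.
      X x = v \<longrightarrow> Y x = w \<longrightarrow> \<beta> x = p \<longrightarrow>
      q = dual_connection A nab x (X x) (\<lambda>y. dual_connection A nab y (Y y) \<beta>)
        - dual_connection A nab x (Y x) (\<lambda>y. dual_connection A nab y (X y) \<beta>)
        - dual_connection A nab x (lie_bracket A X Y x) \<beta>)"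


section \<open>The cotangent bundle\<close>

text \<open>Points of the cotangent bundle are pairs \<open>(x, p)\<close> with \<open>p\<close> a covector at \<open>x\<close>; a chart \<open>c\<close> of
  the base induces the canonical coordinates \<open>(x\<^sup>i, p\<^sub>i)\<close>. The notions above apply to this atlas.\<close>

definition cotangent_chart ::
    "('m, 'e::euclidean_space) chart set \<Rightarrow> ('m, 'e) chart \<Rightarrow>
      ('m \<times> ('m, 'e) covec, 'e \<times> 'e) chart"
  where "cotangent_chart A c =
    ({(x, p). x \<in> chart_dom c \<and> p \<in> cotangent_space A x},
     (\<lambda>(x, p). (chart_map c x, covec_coords A c x p)))"

definition cotangent_atlas ::
    "('m, 'e::euclidean_space) chart set \<Rightarrow> ('m \<times> ('m, 'e) covec, 'e \<times> 'e) chart set"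
  where "cotangent_atlas A = cotangent_chart A ` A"

type_synonym ('m, 'e) cotangent_tvec = "('m \<times> ('m, 'e) covec, 'e \<times> 'e) tvec"

definition vertical_lift ::
    "('m, 'e::euclidean_space) chart set \<Rightarrow> 'm \<Rightarrow> ('m, 'e) covec \<Rightarrow> ('m, 'e) covec \<Rightarrow>
      ('m, 'e) cotangent_tvec"
  where "vertical_lift A x p \<alpha> = velocity (cotangent_atlas A) (\<lambda>t. (x, p + t *\<^sub>R \<alpha>)) 0"

text \<open>\<open>q\<close> is a smooth field of covectors along \<open>\<gamma>\<close> whose covariant derivative \<open>D\<^sub>t q\<close> along \<open>\<gamma>\<close>
  vanishes, where \<open>(D\<^sub>t q)(Y) = d/dt q(Y) - q(\<nabla>\<^sub>\<gamma>\<^sub>' Y)\<close> for vector fields \<open>Y\<close>.\<close>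

definition parallel_along ::
    "('m, 'e::euclidean_space) chart set \<Rightarrow> ('m, 'e) conn \<Rightarrow> real set \<Rightarrow> (real \<Rightarrow> 'm) \<Rightarrow>
      (real \<Rightarrow> ('m, 'e) covec) \<Rightarrow> bool"
  where "parallel_along A nab I \<gamma> q \<longleftrightarrow>
    smooth_curve A I \<gamma> \<and>
    (\<forall>t\<in>I. q t \<in> cotangent_space A (\<gamma> t)) \<and>
    smooth_curve (cotangent_atlas A) I (\<lambda>t. (\<gamma> t, q t)) \<and>
    (\<forall>t\<in>I. \<forall>Y\<in>vector_fields A.
      ((\<lambda>s. q s (Y (\<gamma> s))) has_real_derivative q t (nab (\<gamma> t) (velocity A \<gamma> t) Y)) (at t))"

definition horizontal_lift ::
    "('m, 'e::euclidean_space) chart set \<Rightarrow> ('m, 'e) conn \<Rightarrow> 'm \<Rightarrow> ('m, 'e) covec \<Rightarrow>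
      ('m, 'e) tvec \<Rightarrow> ('m, 'e) cotangent_tvec"
  where "horizontal_lift A nab x p v = (THE w.
    w \<in> tangent_space (cotangent_atlas A) (x, p) \<and>
    pushforward (cotangent_atlas A) A fst (x, p) w = v \<and>
    (\<exists>I \<gamma> q. open I \<and> is_interval I \<and> 0 \<in> I \<and> parallel_along A nab I \<gamma> q \<and>
      \<gamma> 0 = x \<and> q 0 = p \<and> velocity (cotangent_atlas A) (\<lambda>t. (\<gamma> t, q t)) 0 = w))"


section \<open>Hamiltonians\<close>

definition fibre_deriv ::
    "('m, 'e::euclidean_space) chart set \<Rightarrow> ('m \<times> ('m, 'e) covec \<Rightarrow> real) \<Rightarrow>
      'm \<Rightarrow> ('m, 'e) covec \<Rightarrow> ('m, 'e) tvec"
  where "fibre_deriv A H x p = (THE v. v \<in> tangent_space A x \<and>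
    (\<forall>\<alpha>\<in>cotangent_space A x.
      \<alpha> v = differential (cotangent_atlas A) H (x, p) (vertical_lift A x p \<alpha>)))"

definition fibre_hessian ::
    "('m \<times> ('m, 'e) covec \<Rightarrow> real) \<Rightarrow>
      'm \<Rightarrow> ('m, 'e) covec \<Rightarrow> ('m, 'e) covec \<Rightarrow> ('m, 'e) covec \<Rightarrow> real"
  where "fibre_hessian H x p l1 l2 =
    deriv (\<lambda>s1. deriv (\<lambda>s2. H (x, p + s1 *\<^sub>R l1 + s2 *\<^sub>R l2)) 0) 0"

definition hessian_sharp ::
    "('m, 'e::euclidean_space) chart set \<Rightarrow> ('m \<times> ('m, 'e) covec \<Rightarrow> real) \<Rightarrow>
      'm \<Rightarrow> ('m, 'e) covec \<Rightarrow> ('m, 'e) covec \<Rightarrow> ('m, 'e) tvec"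
  where "hessian_sharp A H x p l2 = (THE v. v \<in> tangent_space A x \<and>
    (\<forall>l1\<in>cotangent_space A x. fibre_hessian H x p l1 l2 = l1 v))"

definition parallel_hamiltonian ::
    "('m, 'e::euclidean_space) chart set \<Rightarrow> ('m, 'e) conn \<Rightarrow>
      ('m \<times> ('m, 'e) covec \<Rightarrow> real) \<Rightarrow> bool"
  where "parallel_hamiltonian A nab H \<longleftrightarrow>
    (\<forall>x\<in>points A. \<forall>p\<in>cotangent_space A x. \<forall>v\<in>tangent_space A x.
      differential (cotangent_atlas A) H (x, p) (horizontal_lift A nab x p v) = 0)"

text \<open>In canonical coordinates \<open>(\<partial>H/\<partial>p\<^sub>i, - \<partial>H/\<partial>x\<^sup>i)\<close>.\<close>

definition hamiltonian_field ::
    "('m, 'e::euclidean_space) chart set \<Rightarrow> ('m \<times> ('m, 'e) covec \<Rightarrow> real) \<Rightarrow>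
      'm \<times> ('m, 'e) covec \<Rightarrow> ('m, 'e) cotangent_tvec"
  where "hamiltonian_field A H z = (\<lambda>C. if C \<in> charts_at (cotangent_atlas A) z then
      (let dH = frechet_derivative (H \<circ> chart_inv C) (at (chart_map C z)) in
        (\<Sum>b\<in>Basis. dH (0, b) *\<^sub>R b, - (\<Sum>b\<in>Basis. dH (b, 0) *\<^sub>R b)))
    else 0)"

end

theory Submission
  imports Defs
begin

text \<open>In a chart let \<open>\<nabla>\<^sub>v Y = DY v + G(v, Y)\<close>. The adjoint connection has the transposed coefficients
  \<open>G(Y, v)\<close>, so the horizontal lifts of \<open>v\<close> at \<open>p\<close> for the two connections are \<open>(v, p(G(v, \<cdot>)))\<close> and
  \<open>(v, p(G(\<cdot>, v)))\<close>. Parallelity of \<open>H\<close> reads \<open>\<partial>\<^sub>v H = - p(G(v, H'))\<close>, hence the Hamiltonian field is the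
  adjoint horizontal lift of \<open>H'\<close>, and differentiating in fibre directions gives
  \<open>\<partial>\<^sub>v H' = - G(v, H') - H''(p(G(v, \<cdot>)))\<close>. Part (b) is then an expansion of the brackets in canonical
  coordinates. For part (a), \<open>p + s\<^sub>1 \<lambda>\<^sub>1 + s\<^sub>2 \<lambda>\<^sub>2\<close> is parallel for all \<open>s\<^sub>1, s\<^sub>2\<close>, so \<open>H\<close> is constant along
  it, and the two quantities are derivatives of this constant function of \<open>t\<close> with respect to
  \<open>s\<^sub>1\<close> and \<open>s\<^sub>2\<close>.\<close>

section \<open>Smooth maps\<close>

text \<open>The definitions speak of global sections and of unique objects: a connection acts on
  global vector fields, and torsion, curvature, dual connection and horizontal lift are given by
  \<open>THE\<close>. So each coordinate formula needs enough global sections with prescribed values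
  at a point, which bump functions in a Hausdorff atlas provide, and a proof that the outcome does
  not depend on their choice. The horizontal lift moreover asks for an actual parallel curve, which
  is why a linear differential equation is solved. Symmetry of second derivatives is used
  throughout: it removes the second derivatives of transitions from the Lie bracket and those of
  forms from the curvature, makes the fibre Hessian symmetric, and turns the base derivative of
  \<open>H'\<close> into a fibre derivative of \<open>dH\<close>. The torsion in (b) is the
  difference between the lift for \<open>nab\<close>, which annihilates \<open>H\<close>, and the
  lift for \<open>nabh\<close>, which occurs in the bracket. The curvature collects the derivatives
  of \<open>G\<close> and the products of \<open>G\<close> that arise when the two lifts are
  differentiated along each other.\<close>

abbreviation fderiv ("\<DD>")
  where "\<DD> f x \<equiv> frechet_derivative f (at x)"

lemma frechet_derivative_cong_open:
  assumes "open S" "x \<in> S" "\<And>y. y \<in> S \<Longrightarrow> f y = g y"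
  shows "\<DD> f x = \<DD> g x"
proof -
  have "(f has_derivative D) (at x) \<longleftrightarrow> (g has_derivative D) (at x)" for D
    using has_derivative_transform_within_open[of f D x UNIV S g]
      has_derivative_transform_within_open[of g D x UNIV S f] assms by auto
  then show ?thesis
    by (simp add: frechet_derivative_def)
qed

text \<open>An evaluation \<open>L y (g y)\<close> of a varying linear map becomes a finite sum of
  scalars times \<open>L y b\<close> with fixed \<open>b\<close>. Smoothness of linear families is
  reduced in this way to that of their values on \<open>Basis\<close>.\<close>

lemma linear_Basis_sum:
  fixes h :: "'a::euclidean_space \<Rightarrow> 'b::real_vector"
  assumes "linear h"
  shows "h w = (\<Sum>b\<in>Basis. (w \<bullet> b) *\<^sub>R h b)"
proof -
  have "h w = h (\<Sum>b\<in>Basis. (w \<bullet> b) *\<^sub>R b)"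
    by (simp add: euclidean_representation)
  also have "\<dots> = (\<Sum>b\<in>Basis. (w \<bullet> b) *\<^sub>R h b)"
    using assms by (simp add: linear_sum linear_cmul)
  finally show ?thesis .
qed

section \<open>Closure properties of maps of class C^k\<close>

lemma Ck_on_SucD:
  assumes "Ck_on (Suc k) S f"
  shows "x \<in> S \<Longrightarrow> (f has_derivative \<DD> f x) (at x)"
    and "Ck_on k S (\<lambda>x. \<DD> f x v)"
  using assms by (auto simp: frechet_derivative_works)

lemma Ck_on_cong:
  assumes "open S" "\<And>x. x \<in> S \<Longrightarrow> f x = g x" "Ck_on k S f"
  shows "Ck_on k S g"
  using assms(2,3)
proof (induction k arbitrary: f g)
  case 0
  then show ?case by (simp cong: continuous_on_cong)
next
  case (Suc k)
  have D: "\<DD> f x = \<DD> g x" if "x \<in> S" for x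
    using frechet_derivative_cong_open[OF assms(1) that] Suc.prems(1) by blast
  have "g differentiable (at x)" if "x \<in> S" for x
    using has_derivative_transform_within_open[OF Ck_on_SucD(1)[OF Suc.prems(2) that] assms(1) that]
      Suc.prems(1) by (auto simp: differentiable_def)
  moreover have "Ck_on k S (\<lambda>x. \<DD> g x v)" for v
    by (rule Suc.IH[of "\<lambda>x. \<DD> f x v"]) (use Suc.prems(2) D in auto)
  ultimately show ?case by simp
qed

text \<open>\<open>Ck_on\<close> mentions \<open>frechet_derivative\<close>; uniqueness of
  derivatives lets any explicitly known \<open>f'\<close> take its place, which is how the
  inductions on \<open>k\<close> below proceed.\<close>

lemma Ck_on_SucI:
  assumes "open S" "\<And>x. x \<in> S \<Longrightarrow> (f has_derivative f' x) (at x)"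
    "\<And>v. Ck_on k S (\<lambda>x. f' x v)"
  shows "Ck_on (Suc k) S f"
proof -
  have "\<DD> f x = f' x" if "x \<in> S" for x
    using frechet_derivative_at[OF assms(2)[OF that]] by simp
  then have "Ck_on k S (\<lambda>x. \<DD> f x v)" for v
    using Ck_on_cong[OF assms(1) _ assms(3)[of v], of "\<lambda>x. \<DD> f x v"] by simp
  then show ?thesis
    using assms(2) by (auto simp: differentiable_def)
qed

lemma Ck_on_Suc_imp:
  assumes "open S" "Ck_on (Suc k) S f"
  shows "Ck_on k S f"
  using assms(2)
proof (induction k arbitrary: f)
  case 0
  then show ?case
    by (auto simp: continuous_on_eq_continuous_at assms(1) intro: differentiable_imp_continuous_within)
next
  case (Suc k)
  show ?case
    using Suc.IH Suc.prems by (auto simp del: Ck_on.simps(1))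
qed

lemma Ck_on_const: "open S \<Longrightarrow> Ck_on k S (\<lambda>x. c)"
proof (induction k arbitrary: c)
  case (Suc k)
  then show ?case
    by (intro Ck_on_SucI[where f' = "\<lambda>_ _. 0"]) auto
qed simp

lemma Ck_on_bounded_linear:
  assumes "open S" "bounded_linear L"
  shows "Ck_on k S L"
proof (cases k)
  case 0
  then show ?thesis
    using assms by (simp add: linear_continuous_on)
next
  case (Suc m)
  then show ?thesis
    using assms unfolding Suc
    by (intro Ck_on_SucI[where f' = "\<lambda>_. L"] bounded_linear_imp_has_derivative Ck_on_const)
qed

lemma Ck_on_linear_comp:
  assumes "open S" "bounded_linear L" "Ck_on k S f"
  shows "Ck_on k S (\<lambda>x. L (f x))"
  using assms(3)
proof (induction k arbitrary: f)
  case 0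
  then show ?case
    using bounded_linear.continuous_on[OF assms(2)] by auto
next
  case (Suc k)
  show ?case
    by (rule Ck_on_SucI[where f' = "\<lambda>x v. L (\<DD> f x v)"])
      (rule assms bounded_linear.has_derivative[OF assms(2)] Suc.IH Ck_on_SucD[OF Suc.prems] | assumption)+
qed

lemma Ck_on_add:
  assumes "open S" "Ck_on k S f" "Ck_on k S g"
  shows "Ck_on k S (\<lambda>x. f x + g x)"
  using assms(2,3)
proof (induction k arbitrary: f g)
  case 0
  then show ?case by (auto intro: continuous_on_add)
next
  case (Suc k)
  show ?case
    by (rule Ck_on_SucI[where f' = "\<lambda>x v. \<DD> f x v + \<DD> g x v"])
      (rule assms has_derivative_add Suc.IH Ck_on_SucD[OF Suc.prems(1)] Ck_on_SucD[OF Suc.prems(2)] | assumption)+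
qed

lemma Ck_on_bilinear:
  assumes "open S" "bounded_bilinear B" "Ck_on k S f" "Ck_on k S g"
  shows "Ck_on k S (\<lambda>x. B (f x) (g x))"
  using assms(3,4)
proof (induction k arbitrary: f g)
  case 0
  then show ?case
    using bounded_bilinear.continuous_on[OF assms(2)] by auto
next
  case (Suc k)
  \<comment> \<open>The product rule leaves one factor undifferentiated, and the induction
    hypothesis wants that factor at level \<open>k\<close>.\<close>
  note fg = Ck_on_Suc_imp[OF assms(1) Suc.prems(1)] Ck_on_Suc_imp[OF assms(1) Suc.prems(2)]
  show ?case
    by (rule Ck_on_SucI[where f' = "\<lambda>x v. B (f x) (\<DD> g x v) +
          B (\<DD> f x v) (g x)"])
      (rule assms bounded_bilinear.FDERIV[OF assms(2)] Ck_on_add Suc.IH Ck_on_SucD[OF Suc.prems(1)]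
        Ck_on_SucD[OF Suc.prems(2)] fg | assumption)+
qed

lemma Ck_on_sum:
  assumes "open S" "finite I" "\<And>i. i \<in> I \<Longrightarrow> Ck_on k S (f i)"
  shows "Ck_on k S (\<lambda>x. \<Sum>i\<in>I. f i x)"
  using assms(2,3)
  by (induction I rule: finite_induct) (auto intro!: Ck_on_const Ck_on_add assms(1))

text \<open>The chain rule produces the derivative of \<open>g\<close> in a direction that varies
  with \<open>x\<close>. Expanded over \<open>Basis\<close> it is a sum of products of components of
  the derivative of \<open>f\<close> with directional derivatives of \<open>g\<close> along fixed
  \<open>b\<close>, again composed with \<open>f\<close>. To these the induction hypothesis applies;
  this is why the middle space is Euclidean.\<close>

lemma Ck_on_compose:
  fixes f :: "'a::real_normed_vector \<Rightarrow> 'b::euclidean_space" and g :: "'b \<Rightarrow> 'c::real_normed_vector"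
  assumes "open S" "open T" "f ` S \<subseteq> T" "Ck_on k S f" "Ck_on k T g"
  shows "Ck_on k S (\<lambda>x. g (f x))"
  using assms(4,5)
proof (induction k arbitrary: g)
  case 0
  then show ?case
    using assms(3) by (auto intro: continuous_on_compose2)
next
  case (Suc k)
  note f = Ck_on_SucD[OF Suc.prems(1)] Ck_on_Suc_imp[OF assms(1) Suc.prems(1)]
  note g = Ck_on_SucD[OF Suc.prems(2)]
  have lin: "linear (\<DD> g (f x))" if "x \<in> S" for x
    using g(1)[of "f x"] that assms(3) by (auto intro: has_derivative_linear)
  show ?case
  proof (rule Ck_on_SucI[where f' = "\<lambda>x v. \<Sum>b\<in>Basis. (\<DD> f x v \<bullet> b) *\<^sub>R
      \<DD> g (f x) b"])
    fix x assume x: "x \<in> S"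
    have "((\<lambda>x. g (f x)) has_derivative (\<lambda>v. \<DD> g (f x) (\<DD> f x v))) (at x)"
      using has_derivative_compose[OF f(1)[OF x], of g] g(1)[of "f x"] x assms(3) by auto
    then show "((\<lambda>x. g (f x)) has_derivative (\<lambda>v. \<Sum>b\<in>Basis. (\<DD> f x v \<bullet> b) *\<^sub>R
      \<DD> g (f x) b)) (at x)"
      by (rule has_derivative_eq_rhs) (rule ext, rule linear_Basis_sum[OF lin[OF x]])
  next
    fix v
    show "Ck_on k S (\<lambda>x. \<Sum>b\<in>Basis. (\<DD> f x v \<bullet> b) *\<^sub>R
      \<DD> g (f x) b)"
      by (intro Ck_on_sum Ck_on_bilinear[OF _ bounded_bilinear_scaleR] assms(1) finite_Basis
          Ck_on_linear_comp[OF _ bounded_linear_inner_left] f(2) Suc.IH f(3) g(2))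
  qed (rule assms(1))
qed

lemma Ck_on_local:
  assumes "\<And>x. x \<in> S \<Longrightarrow> \<exists>T. open T \<and> x \<in> T \<and> Ck_on k T f"
  shows "Ck_on k S f"
  using assms
proof (induction k arbitrary: f)
  case 0
  show ?case unfolding Ck_on.simps
  proof (rule continuous_at_imp_continuous_on, rule ballI)
    fix x assume "x \<in> S"
    then show "isCont f x"
      using 0[of x] by (auto simp: continuous_on_eq_continuous_at)
  qed
next
  case (Suc k)
  show ?case unfolding Ck_on.simps
  proof (intro conjI ballI allI)
    fix x assume "x \<in> S"
    then show "f differentiable (at x)"
      using Suc.prems by auto
  next
    fix v
    show "Ck_on k S (\<lambda>x. \<DD> f x v)"
      by (rule Suc.IH) (use Suc.prems in \<open>fastforce simp del: Ck_on.simps(1)\<close>)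
  qed
qed

lemma Ck_on_subset: "Ck_on k S f \<Longrightarrow> T \<subseteq> S \<Longrightarrow> Ck_on k T f"
  by (induction k arbitrary: f) (auto intro: continuous_on_subset)

text \<open>The derivative of \<open>inverse\<close> is a product of copies of
  \<open>inverse\<close> and a constant, so the induction feeds on its own statement.\<close>

lemma Ck_on_inverse: "Ck_on k (- {0::real}) inverse"
proof (induction k)
  case 0
  show ?case unfolding Ck_on.simps
    by (rule continuous_on_inverse[OF continuous_on_id, simplified]) simp
next
  case (Suc k)
  have o: "open (- {0::real})" by auto
  show ?case
    by (intro Ck_on_SucI[where f' = "\<lambda>x v. - (inverse x * v * inverse x)"] o
        Ck_on_linear_comp[OF _ bounded_linear_minus[OF bounded_linear_ident]]
        Ck_on_bilinear[OF _ bounded_bilinear_mult] Suc Ck_on_const has_derivative_inverse') auto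
qed

section \<open>Closure properties of smooth maps\<close>

lemma smooth_on_cong: "open S \<Longrightarrow> (\<And>x. x \<in> S \<Longrightarrow> f x = g x) \<Longrightarrow> smooth_on S f \<Longrightarrow> smooth_on S g"
  unfolding smooth_on_def using Ck_on_cong by blast

lemma smooth_on_const: "open S \<Longrightarrow> smooth_on S (\<lambda>x. c)"
  by (simp add: smooth_on_def Ck_on_const)

lemma smooth_on_bounded_linear: "open S \<Longrightarrow> bounded_linear L \<Longrightarrow> smooth_on S L"
  by (simp add: smooth_on_def Ck_on_bounded_linear)

lemma smooth_on_linear_comp:
  "open S \<Longrightarrow> bounded_linear L \<Longrightarrow> smooth_on S f \<Longrightarrow> smooth_on S (\<lambda>x. L (f x))"
  by (simp add: smooth_on_def Ck_on_linear_comp)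

lemma smooth_on_add: "open S \<Longrightarrow> smooth_on S f \<Longrightarrow> smooth_on S g \<Longrightarrow> smooth_on S (\<lambda>x. f x + g x)"
  by (simp add: smooth_on_def Ck_on_add)

lemma smooth_on_minus: "open S \<Longrightarrow> smooth_on S f \<Longrightarrow> smooth_on S (\<lambda>x. - f x)"
  by (rule smooth_on_linear_comp[OF _ bounded_linear_minus[OF bounded_linear_ident]])

lemma smooth_on_diff: "open S \<Longrightarrow> smooth_on S f \<Longrightarrow> smooth_on S g \<Longrightarrow> smooth_on S (\<lambda>x. f x - g x)"
  using smooth_on_add[of S f "\<lambda>x. - g x"] smooth_on_minus by auto

lemma smooth_on_bilinear:
  "open S \<Longrightarrow> bounded_bilinear B \<Longrightarrow> smooth_on S f \<Longrightarrow> smooth_on S g \<Longrightarrow> smooth_on S (\<lambda>x. B (f x) (g x))"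
  by (simp add: smooth_on_def Ck_on_bilinear)

lemmas smooth_on_scaleR = smooth_on_bilinear[OF _ bounded_bilinear_scaleR]
lemmas smooth_on_inner = smooth_on_bilinear[OF _ bounded_bilinear_inner]
lemmas smooth_on_mult = smooth_on_bilinear[OF _ bounded_bilinear_mult]

lemma smooth_on_sum:
  "open S \<Longrightarrow> finite I \<Longrightarrow> (\<And>i. i \<in> I \<Longrightarrow> smooth_on S (f i)) \<Longrightarrow> smooth_on S (\<lambda>x. \<Sum>i\<in>I. f i x)"
  by (simp add: smooth_on_def Ck_on_sum)

lemma smooth_on_compose:
  fixes f :: "'a::real_normed_vector \<Rightarrow> 'b::euclidean_space" and g :: "'b \<Rightarrow> 'c::real_normed_vector"
  assumes "open S" "open T" "f ` S \<subseteq> T" "smooth_on S f" "smooth_on T g"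
  shows "smooth_on S (\<lambda>x. g (f x))"
  using Ck_on_compose[OF assms(1-3)] assms(4,5) by (auto simp: smooth_on_def)

lemma smooth_on_local:
  assumes "\<And>x. x \<in> S \<Longrightarrow> \<exists>T. open T \<and> x \<in> T \<and> smooth_on T f"
  shows "smooth_on S f"
  unfolding smooth_on_def
proof (intro allI Ck_on_local)
  fix k x assume "x \<in> S"
  then show "\<exists>T. open T \<and> x \<in> T \<and> Ck_on k T f"
    using assms[of x] by (auto simp: smooth_on_def)
qed

lemma smooth_on_subset: "smooth_on S f \<Longrightarrow> T \<subseteq> S \<Longrightarrow> smooth_on T f"
  unfolding smooth_on_def by (meson Ck_on_subset)

lemma smooth_on_has_derivative:
  "smooth_on S f \<Longrightarrow> x \<in> S \<Longrightarrow> (f has_derivative \<DD> f x) (at x)"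
  unfolding smooth_on_def using Ck_on_SucD(1)[of 0 S f x] by blast

lemma smooth_on_differentiable: "smooth_on S f \<Longrightarrow> x \<in> S \<Longrightarrow> f differentiable (at x)"
  using smooth_on_has_derivative by (auto simp: differentiable_def)

lemma smooth_on_linear_derivative:
  "smooth_on S f \<Longrightarrow> x \<in> S \<Longrightarrow> linear (\<DD> f x)"
  using smooth_on_has_derivative has_derivative_linear by blast

lemma smooth_on_continuous: "smooth_on S f \<Longrightarrow> continuous_on S f"
  unfolding smooth_on_def using Ck_on.simps(1) by blast

lemma smooth_on_derivative:
  "smooth_on S f \<Longrightarrow> smooth_on S (\<lambda>x. \<DD> f x v)"
  unfolding smooth_on_def using Ck_on_SucD(2) by blast

lemma smooth_on_derivative_field:
  fixes f :: "'a::euclidean_space \<Rightarrow> 'b::real_normed_vector"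
  assumes "open S" "smooth_on S f" "smooth_on S g"
  shows "smooth_on S (\<lambda>x. \<DD> f x (g x))"
proof -
  have "smooth_on S (\<lambda>x. \<Sum>b\<in>Basis. (g x \<bullet> b) *\<^sub>R \<DD> f x b)"
    by (intro smooth_on_sum smooth_on_scaleR smooth_on_inner smooth_on_const assms
        smooth_on_derivative finite_Basis)
  then show ?thesis
    by (rule smooth_on_cong[OF assms(1), rotated])
      (simp add: linear_Basis_sum[OF smooth_on_linear_derivative[OF assms(2)], symmetric])
qed

lemma smooth_on_Pair:
  assumes "open S" "smooth_on S f" "smooth_on S g"
  shows "smooth_on S (\<lambda>x. (f x, g x))"
proof -
  have "smooth_on S (\<lambda>x. (f x, 0) + (0, g x))"
    by (intro smooth_on_add assms smooth_on_linear_comp[OF _ _ assms(2)] smooth_on_linear_comp[OF _ _ assms(3)]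
        bounded_linear_Pair bounded_linear_zero bounded_linear_ident)
  then show ?thesis by simp
qed

lemma smooth_on_fst: "open S \<Longrightarrow> smooth_on S f \<Longrightarrow> smooth_on S (\<lambda>x. fst (f x))"
  and smooth_on_snd: "open S \<Longrightarrow> smooth_on S f \<Longrightarrow> smooth_on S (\<lambda>x. snd (f x))"
  by (auto intro: smooth_on_linear_comp bounded_linear_fst bounded_linear_snd)

lemma smooth_on_ident: "open S \<Longrightarrow> smooth_on S (\<lambda>x. x)"
  by (rule smooth_on_bounded_linear[OF _ bounded_linear_ident])

lemma smooth_on_inverse:
  fixes f :: "'a::real_normed_vector \<Rightarrow> real"
  assumes "open S" "smooth_on S f" "\<And>x. x \<in> S \<Longrightarrow> f x \<noteq> 0"
  shows "smooth_on S (\<lambda>x. inverse (f x))"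
  by (rule smooth_on_compose[OF assms(1), of "- {0}"])
    (use assms in \<open>auto simp: smooth_on_def intro: Ck_on_inverse\<close>)

lemma smooth_on_eq_0:
  assumes "open S" "\<And>x. x \<in> S \<Longrightarrow> f x = 0"
  shows "smooth_on S f"
  by (rule smooth_on_cong[OF assms(1) _ smooth_on_const[OF assms(1), of 0]]) (simp add: assms(2))

section \<open>Smooth bump functions\<close>

definition flat_fun :: "nat \<Rightarrow> real \<Rightarrow> real"
  where "flat_fun n t = (if t \<le> 0 then 0 else inverse t ^ n * exp (- inverse t))"

text \<open>In the variable \<open>x = 1/t\<close> the right-hand limit is that of
  \<open>x ^ n / exp x\<close> at infinity; to the left of 0 the function vanishes.\<close>

lemma flat_fun_tendsto_0: "(flat_fun n \<longlongrightarrow> 0) (at 0)"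
proof -
  have "((\<lambda>t. inverse t ^ n * exp (- inverse t)) \<longlongrightarrow> (0::real)) (at_right 0)"
  proof -
    have "((\<lambda>x. x ^ n / exp x) \<longlongrightarrow> (0::real)) at_top"
      by (rule tendsto_power_div_exp_0)
    from filterlim_compose[OF this filterlim_inverse_at_top_right]
    show ?thesis by (simp add: exp_minus field_simps)
  qed
  then have R: "(flat_fun n \<longlongrightarrow> 0) (at_right 0)"
    by (rule Lim_transform_eventually)
      (auto simp: flat_fun_def eventually_at_filter)
  have L: "(flat_fun n \<longlongrightarrow> 0) (at_left 0)"
    by (rule Lim_transform_eventually[OF tendsto_const])
      (auto simp: flat_fun_def eventually_at_filter)
  show ?thesis
    using L R by (simp add: filterlim_split_at)
qed

text \<open>The family indexed by \<open>n\<close> is closed under differentiation up to linear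
  combinations, so that smoothness of all members follows by one induction on the order.\<close>

lemma flat_fun_has_derivative:
  "(flat_fun n has_real_derivative flat_fun (n+2) t - n * flat_fun (n+1) t) (at t)"
proof -
  consider "t < 0" | "t = 0" | "t > 0" by linarith
  then show ?thesis
  proof cases
    case 1
    have "((\<lambda>_. 0) has_real_derivative 0) (at t)" by simp
    then have "(flat_fun n has_real_derivative 0) (at t)"
      by (rule has_field_derivative_transform_within_open[of _ _ _ "{..<0}"])
        (use 1 in \<open>auto simp: flat_fun_def\<close>)
    then show ?thesis using 1 by (simp add: flat_fun_def)
  next
    case 2
    \<comment> \<open>The difference quotient of \<open>flat_fun n\<close> at 0 is
      \<open>flat_fun (Suc n)\<close>, which tends to 0.\<close>
    have "((\<lambda>h. (flat_fun n (0 + h) - flat_fun n 0) / h) \<longlongrightarrow> 0) (at 0)"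
      by (rule Lim_transform_eventually[OF flat_fun_tendsto_0[of "Suc n"]])
        (auto simp: flat_fun_def eventually_at_filter field_simps)
    then show ?thesis
      using 2 by (simp add: DERIV_def flat_fun_def)
  next
    case 3
    have "((\<lambda>t. inverse t ^ n * exp (- inverse t)) has_real_derivative
        (inverse t ^ (n + 2) * exp (- inverse t) - n * (inverse t ^ (n + 1) * exp (- inverse t)))) (at t)"
      using 3 power_eq_if[of t "n - 1"]
      by (cases n) (auto intro!: derivative_eq_intros simp: field_simps power2_eq_square split: if_splits)
    then have "(flat_fun n has_real_derivative
        (inverse t ^ (n + 2) * exp (- inverse t) - n * (inverse t ^ (n + 1) * exp (- inverse t)))) (at t)"
      by (rule has_field_derivative_transform_within_open[of _ _ _ "{0<..}"])
        (use 3 in \<open>auto simp: flat_fun_def\<close>)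
    then show ?thesis using 3 by (simp add: flat_fun_def)
  qed
qed

lemma smooth_on_flat_fun: "smooth_on UNIV (flat_fun n)"
  unfolding smooth_on_def
proof
  fix k show "Ck_on k UNIV (flat_fun n)"
  proof (induction k arbitrary: n)
    case 0
    show ?case
      using flat_fun_has_derivative by (auto intro!: DERIV_continuous_on)
  next
    case (Suc k)
    show ?case
    proof (rule Ck_on_SucI[where f' = "\<lambda>t v. (flat_fun (n+2) t + (- real n) * flat_fun (n+1) t) * v"])
      fix t show "(flat_fun n has_derivative (*) (flat_fun (n + 2) t + (- real n) * flat_fun (n + 1) t)) (at t)"
        using flat_fun_has_derivative[of n t] by (simp add: has_field_derivative_def)
    qed (intro open_UNIV Ck_on_bilinear[OF _ bounded_bilinear_mult] Ck_on_add Ck_on_const Suc)+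
  qed
qed

lemma smooth_bump:
  fixes y0 :: "'a::euclidean_space"
  assumes "open S" "y0 \<in> S"
  obtains \<psi> :: "'a \<Rightarrow> real" and r where "smooth_on UNIV \<psi>" "r > 0" "cball y0 r \<subseteq> S"
    "\<And>y. y \<notin> cball y0 r \<Longrightarrow> \<psi> y = 0" "\<And>y. y \<in> ball y0 (r/2) \<Longrightarrow> \<psi> y = 1"
proof -
  from assms obtain r where r: "r > 0" "cball y0 r \<subseteq> S"
    using open_contains_cball_eq by blast
  \<comment> \<open>\<open>q\<close> is at least 1 where the squared distance is at most
    \<open>r^2 / 4\<close>, and at most 0 where it is at least \<open>r^2 / 2\<close>, in particular
    outside the ball of radius \<open>r\<close>. The squared norm is taken because the norm is not
    smooth at the centre.\<close>
  define q where "q y = 2 - (4 / r^2) * ((y - y0) \<bullet> (y - y0))" for y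
  \<comment> \<open>This quotient is 0 for \<open>q y \<le> 0\<close> and 1 for
    \<open>q y \<ge> 1\<close>. Its denominator never vanishes, as \<open>q y\<close> and
    \<open>1 - q y\<close> are not both nonpositive.\<close>
  define \<psi> where "\<psi> y = flat_fun 0 (q y) * inverse (flat_fun 0 (q y) + flat_fun 0 (1 - q y))" for y
  have pos: "flat_fun 0 t + flat_fun 0 (1 - t) > 0" for t
    by (cases "t > 0") (auto simp: flat_fun_def add_pos_nonneg add_nonneg_pos)
  have sq: "smooth_on UNIV q"
    unfolding q_def
    by (intro smooth_on_diff smooth_on_mult smooth_on_inner smooth_on_const smooth_on_ident open_UNIV)
  have s1: "smooth_on UNIV (\<lambda>y. flat_fun 0 (q y))"
    by (rule smooth_on_compose[OF _ open_UNIV _ sq smooth_on_flat_fun]) auto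
  have s2: "smooth_on UNIV (\<lambda>y. flat_fun 0 (1 - q y))"
    by (rule smooth_on_compose[OF _ open_UNIV _ _ smooth_on_flat_fun])
      (auto intro!: smooth_on_diff smooth_on_const sq)
  have "smooth_on UNIV \<psi>"
    unfolding \<psi>_def
    by (intro smooth_on_mult smooth_on_inverse smooth_on_add s1 s2 open_UNIV) (metis pos less_irrefl)
  moreover have "\<psi> y = 0" if "y \<notin> cball y0 r" for y
  proof -
    have "r < norm (y - y0)" using that by (simp add: dist_norm norm_minus_commute)
    then have "r^2 < (y - y0) \<bullet> (y - y0)"
      using r(1) by (simp add: power_strict_mono flip: power2_norm_eq_inner)
    then have "r^2 \<le> 2 * ((y - y0) \<bullet> (y - y0))"
      using inner_ge_zero[of "y - y0"] by linarith
    then have "q y \<le> 0" using r(1) by (simp add: q_def field_simps)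
    then show ?thesis by (simp add: \<psi>_def flat_fun_def)
  qed
  moreover have "\<psi> y = 1" if "y \<in> ball y0 (r/2)" for y
  proof -
    have "norm (y - y0) < r/2" using that by (simp add: dist_norm norm_minus_commute)
    then have "(y - y0) \<bullet> (y - y0) < (r/2)^2"
      by (simp add: power_strict_mono flip: power2_norm_eq_inner)
    then have "q y \<ge> 1" using r(1) by (simp add: q_def field_simps power2_eq_square)
    then show ?thesis using pos[of "q y"] by (simp add: \<psi>_def flat_fun_def)
  qed
  ultimately show ?thesis using r that by blast
qed

section \<open>Symmetry of second derivatives\<close>

text \<open>The second difference over a parallelogram is a first difference, in direction
  \<open>u\<close>, of the increment of \<open>f\<close> in direction \<open>v\<close>. One
  application of the mean value theorem along \<open>u\<close> and one along \<open>v\<close> turn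
  it into a value of the mixed derivative.\<close>

lemma double_difference_mean_value:
  fixes f :: "'a::euclidean_space \<Rightarrow> real"
  assumes "smooth_on S f" "s > 0"
    and S: "\<And>\<sigma> \<tau>. 0 \<le> \<sigma> \<Longrightarrow> \<sigma> \<le> s \<Longrightarrow> 0 \<le> \<tau> \<Longrightarrow> \<tau> \<le> s \<Longrightarrow> x + \<sigma> *\<^sub>R u + \<tau> *\<^sub>R v \<in> S"
  obtains \<sigma> \<tau> where "0 \<le> \<sigma>" "\<sigma> \<le> s" "0 \<le> \<tau>" "\<tau> \<le> s"
    "f (x + s *\<^sub>R u + s *\<^sub>R v) - f (x + s *\<^sub>R u) - f (x + s *\<^sub>R v) + f x =
      s\<^sup>2 * \<DD> (\<lambda>y. \<DD> f y u) (x + \<sigma> *\<^sub>R u + \<tau> *\<^sub>R v) v"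
proof -
  let ?Du = "\<lambda>y. \<DD> f y u"
  have dirder: "((\<lambda>\<sigma>. h (z + \<sigma> *\<^sub>R w)) has_real_derivative \<DD> h (z + \<sigma> *\<^sub>R w) w) (at \<sigma>)"
    if h: "smooth_on S h" "z + \<sigma> *\<^sub>R w \<in> S" for h :: "'a \<Rightarrow> real" and z w \<sigma>
  proof -
    have "((\<lambda>\<sigma>. z + \<sigma> *\<^sub>R w) has_derivative (\<lambda>t. t *\<^sub>R w)) (at \<sigma>)"
      by (auto intro!: derivative_eq_intros)
    from has_derivative_compose[OF this smooth_on_has_derivative[OF h]]
    have "((\<lambda>\<sigma>. h (z + \<sigma> *\<^sub>R w)) has_derivative (\<lambda>t. \<DD> h (z + \<sigma> *\<^sub>R w) (t *\<^sub>R w))) (at \<sigma>)" .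
    then show ?thesis
      using linear_cmul[OF smooth_on_linear_derivative[OF h]]
      by (simp add: has_field_derivative_def mult_commute_abs)
  qed
  have "\<exists>\<sigma>>0. \<sigma> < s \<and> (f (x + s *\<^sub>R v + s *\<^sub>R u) - f (x + s *\<^sub>R u)) - (f (x + s *\<^sub>R v + 0 *\<^sub>R u) - f (x + 0 *\<^sub>R u)) =
      (s - 0) * (?Du (x + s *\<^sub>R v + \<sigma> *\<^sub>R u) - ?Du (x + \<sigma> *\<^sub>R u))"
  proof (intro MVT2 DERIV_diff dirder assms(1,2))
    fix \<sigma> assume "0 \<le> \<sigma>" "\<sigma> \<le> s"
    then show "x + s *\<^sub>R v + \<sigma> *\<^sub>R u \<in> S" "x + \<sigma> *\<^sub>R u \<in> S"
      using S[of \<sigma> s] S[of \<sigma> 0] assms(2) by (simp_all add: add_ac)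
  qed
  then obtain \<sigma> where \<sigma>: "0 < \<sigma>" "\<sigma> < s"
    "f (x + s *\<^sub>R v + s *\<^sub>R u) - f (x + s *\<^sub>R u) - (f (x + s *\<^sub>R v) - f x) =
      s * (?Du (x + s *\<^sub>R v + \<sigma> *\<^sub>R u) - ?Du (x + \<sigma> *\<^sub>R u))" by auto
  have "\<exists>\<tau>>0. \<tau> < s \<and> ?Du (x + \<sigma> *\<^sub>R u + s *\<^sub>R v) - ?Du (x + \<sigma> *\<^sub>R u + 0 *\<^sub>R v) =
      (s - 0) * \<DD> ?Du (x + \<sigma> *\<^sub>R u + \<tau> *\<^sub>R v) v"
  proof (intro MVT2 dirder smooth_on_derivative assms(1,2))
    fix \<tau> assume "0 \<le> \<tau>" "\<tau> \<le> s"
    then show "x + \<sigma> *\<^sub>R u + \<tau> *\<^sub>R v \<in> S"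
      using S[of \<sigma> \<tau>] \<sigma> by simp
  qed
  then obtain \<tau> where \<tau>: "0 < \<tau>" "\<tau> < s" "?Du (x + \<sigma> *\<^sub>R u + s *\<^sub>R v) - ?Du (x + \<sigma> *\<^sub>R u) =
      s * \<DD> ?Du (x + \<sigma> *\<^sub>R u + \<tau> *\<^sub>R v) v" by auto
  show ?thesis
  proof (rule that[of \<sigma> \<tau>])
    have "f (x + s *\<^sub>R u + s *\<^sub>R v) - f (x + s *\<^sub>R u) - f (x + s *\<^sub>R v) + f x =
        s * (?Du (x + \<sigma> *\<^sub>R u + s *\<^sub>R v) - ?Du (x + \<sigma> *\<^sub>R u))"
      using \<sigma>(3) by (simp add: add_ac)
    then show "f (x + s *\<^sub>R u + s *\<^sub>R v) - f (x + s *\<^sub>R u) - f (x + s *\<^sub>R v) + f x =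
        s\<^sup>2 * \<DD> ?Du (x + \<sigma> *\<^sub>R u + \<tau> *\<^sub>R v) v"
      using \<tau>(3) by (simp add: power2_eq_square)
  qed (use \<sigma> \<tau> in auto)
qed

text \<open>The second difference is symmetric in \<open>u\<close> and \<open>v\<close>, so the mean
  value lemma equates the two mixed derivatives at two points of the same small parallelogram.
  Continuity brings both values as close as desired to those at \<open>x\<close>.\<close>

lemma smooth_on_derivative_commute_real:
  fixes f :: "'a::euclidean_space \<Rightarrow> real"
  assumes "open S" "smooth_on S f" "x \<in> S"
  shows "\<DD> (\<lambda>y. \<DD> f y u) x v =
    \<DD> (\<lambda>y. \<DD> f y v) x u"
proof -
  define M where "M a b y = \<DD> (\<lambda>y. \<DD> f y a) y b" for a b y
  have sM: "smooth_on S (M a b)" for a b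
    unfolding M_def by (intro smooth_on_derivative assms(1,2))
  have "\<bar>M u v x - M v u x\<bar> < e" if "e > 0" for e
  proof -
    have "\<exists>d>0. \<forall>y. dist y x < d \<longrightarrow> dist (M a b y) (M a b x) < e/2" for a b
    proof -
      have "isCont (M a b) x"
        using smooth_on_continuous[OF sM[of a b]] assms(1,3) by (simp add: continuous_on_eq_continuous_at)
      with \<open>e > 0\<close> show ?thesis
        unfolding continuous_at_eps_delta by (meson half_gt_zero)
    qed
    then obtain d1 d2 where d1: "d1 > 0" "\<And>y. dist y x < d1 \<Longrightarrow> dist (M u v y) (M u v x) < e/2"
      and d2: "d2 > 0" "\<And>y. dist y x < d2 \<Longrightarrow> dist (M v u y) (M v u x) < e/2" by metis
    obtain d3 where d3: "d3 > 0" "ball x d3 \<subseteq> S"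
      using assms(1,3) open_contains_ball_eq by blast
    define d where "d = min d1 (min d2 d3)"
    have d: "d > 0" using d1 d2 d3 by (simp add: d_def)
    \<comment> \<open>Small enough for the parallelogram with sides \<open>s\<close> times
      \<open>u\<close> and \<open>s\<close> times \<open>v\<close> to stay within distance
      \<open>d\<close> of \<open>x\<close>; the summand 1 covers \<open>u = v = 0\<close>.\<close>
    define s where "s = d / (2 * (norm u + norm v + 1))"
    have nz: "norm u + norm v + 1 > 0" by (smt (verit) norm_ge_zero)
    have s: "s > 0" using d nz by (simp add: s_def)
    have near: "dist (x + \<sigma> *\<^sub>R u + \<tau> *\<^sub>R v) x < d" if "0 \<le> \<sigma>" "\<sigma> \<le> s" "0 \<le> \<tau>" "\<tau> \<le> s" for \<sigma> \<tau>
    proof -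
      have "dist (x + \<sigma> *\<^sub>R u + \<tau> *\<^sub>R v) x \<le> \<sigma> * norm u + \<tau> * norm v"
        using norm_triangle_ineq[of "\<sigma> *\<^sub>R u" "\<tau> *\<^sub>R v"] that by (simp add: dist_norm)
      also have "\<dots> \<le> s * norm u + s * norm v"
        using that by (intro add_mono mult_right_mono) auto
      also have "\<dots> < s * (2 * (norm u + norm v + 1))"
      proof -
        have "s * (norm u + norm v) < s * (2 * (norm u + norm v + 1))"
          using s by (intro mult_strict_left_mono) (smt (verit) norm_ge_zero, simp)
        then show ?thesis by (simp add: algebra_simps)
      qed
      also have "\<dots> = d" using nz by (simp add: s_def)
      finally show ?thesis .
    qed
    have inS: "x + \<sigma> *\<^sub>R u + \<tau> *\<^sub>R v \<in> S" "x + \<tau> *\<^sub>R v + \<sigma> *\<^sub>R u \<in> S"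
      if "0 \<le> \<sigma>" "\<sigma> \<le> s" "0 \<le> \<tau>" "\<tau> \<le> s" for \<sigma> \<tau>
      using near[OF that] d3 by (auto simp: d_def dist_commute add_ac subset_eq)
    let ?\<Delta> = "f (x + s *\<^sub>R u + s *\<^sub>R v) - f (x + s *\<^sub>R u) - f (x + s *\<^sub>R v) + f x"
    obtain \<sigma> \<tau> where 1: "0 \<le> \<sigma>" "\<sigma> \<le> s" "0 \<le> \<tau>" "\<tau> \<le> s" "?\<Delta> = s\<^sup>2 * M u v (x + \<sigma> *\<^sub>R u + \<tau> *\<^sub>R v)"
      unfolding M_def by (rule double_difference_mean_value[OF assms(2) s inS(1)])
    obtain \<sigma>' \<tau>' where 2: "0 \<le> \<sigma>'" "\<sigma>' \<le> s" "0 \<le> \<tau>'" "\<tau>' \<le> s"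
      "f (x + s *\<^sub>R v + s *\<^sub>R u) - f (x + s *\<^sub>R v) - f (x + s *\<^sub>R u) + f x = s\<^sup>2 * M v u (x + \<sigma>' *\<^sub>R v + \<tau>' *\<^sub>R u)"
      unfolding M_def by (rule double_difference_mean_value[OF assms(2) s inS(2)])
    have "M u v (x + \<sigma> *\<^sub>R u + \<tau> *\<^sub>R v) = M v u (x + \<tau>' *\<^sub>R u + \<sigma>' *\<^sub>R v)"
      using 1 2 s by (simp add: add_ac algebra_simps)
    moreover have "dist (M u v (x + \<sigma> *\<^sub>R u + \<tau> *\<^sub>R v)) (M u v x) < e/2"
      "dist (M v u (x + \<tau>' *\<^sub>R u + \<sigma>' *\<^sub>R v)) (M v u x) < e/2"
      using d1(2) d2(2) near[of \<sigma> \<tau>] near[of \<tau>' \<sigma>'] 1 2 by (simp_all add: d_def)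
    ultimately show ?thesis
      unfolding dist_real_def by linarith
  qed
  then have "M u v x = M v u x"
    by (meson less_irrefl right_minus_eq zero_less_abs_iff)
  then show ?thesis by (simp add: M_def)
qed

lemma smooth_on_derivative_commute:
  fixes f :: "'a::euclidean_space \<Rightarrow> 'b::euclidean_space"
  assumes "open S" "smooth_on S f" "x \<in> S"
  shows "\<DD> (\<lambda>y. \<DD> f y u) x v =
    \<DD> (\<lambda>y. \<DD> f y v) x u"
proof (rule euclidean_eqI)
  fix b :: 'b assume b: "b \<in> Basis"
  have inner_deriv: "\<DD> (\<lambda>y. g y \<bullet> b) y w = \<DD> g y w \<bullet> b"
    if "smooth_on S g" "y \<in> S" for g :: "'a \<Rightarrow> 'b" and y w
    using frechet_derivative_at[OF bounded_linear.has_derivative[OF bounded_linear_inner_left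
          smooth_on_has_derivative[OF that]], of b] by metis
  have "\<DD> (\<lambda>y. \<DD> f y u) x v \<bullet> b =
      \<DD> (\<lambda>y. \<DD> (\<lambda>y. f y \<bullet> b) y u) x v" for u v
    using inner_deriv[OF smooth_on_derivative[OF assms(2)] assms(3)] inner_deriv[OF assms(2)]
      frechet_derivative_cong_open[OF assms(1,3), of "\<lambda>y. \<DD> (\<lambda>y. f y \<bullet> b) y u"
        "\<lambda>y. \<DD> f y u \<bullet> b"] by metis
  then show "\<DD> (\<lambda>y. \<DD> f y u) x v \<bullet> b =
      \<DD> (\<lambda>y. \<DD> f y v) x u \<bullet> b"
    using smooth_on_derivative_commute_real[OF assms(1) smooth_on_inner[OF assms(1,2) smooth_on_const[OF assms(1)]] assms(3)]
    by metis
qed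

section \<open>Linear differential equations\<close>

text \<open>Bootstrap: if \<open>y\<close> is of class C^k, then so is \<open>B t (y t)\<close>,
  which is the derivative of \<open>y\<close>.\<close>

lemma linear_ode_smooth:
  fixes B :: "real \<Rightarrow> 'e::euclidean_space \<Rightarrow> 'e"
  assumes "open I" and lin: "\<And>t. t \<in> I \<Longrightarrow> linear (B t)"
    and sm: "\<And>e. smooth_on I (\<lambda>t. B t e)"
    and y: "\<And>t. t \<in> I \<Longrightarrow> (y has_vector_derivative B t (y t)) (at t)"
  shows "smooth_on I y"
  unfolding smooth_on_def
proof
  fix k show "Ck_on k I y"
  proof (induction k)
    case 0
    then show ?case
      using has_vector_derivative_continuous[OF y]
      by (auto simp: continuous_on_eq_continuous_at[OF \<open>open I\<close>])
  next
    case (Suc k)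
    have "Ck_on k I (\<lambda>t. \<Sum>b\<in>Basis. (y t \<bullet> b) *\<^sub>R B t b)"
      using sm by (intro Ck_on_sum Ck_on_bilinear[OF _ bounded_bilinear_scaleR] \<open>open I\<close> finite_Basis
          Ck_on_linear_comp[OF _ bounded_linear_inner_left] Suc) (auto simp: smooth_on_def)
    then have C: "Ck_on k I (\<lambda>t. B t (y t))"
      by (rule Ck_on_cong[OF \<open>open I\<close>, rotated]) (rule linear_Basis_sum[OF lin, symmetric])
    show ?case
      using y by (intro Ck_on_SucI[where f' = "\<lambda>t v. v *\<^sub>R B t (y t)"] \<open>open I\<close>
          Ck_on_bilinear[OF _ bounded_bilinear_scaleR] Ck_on_const C)
        (simp add: has_vector_derivative_def)
  qed
qed

text \<open>Picard iteration on an interval so short that the integral operator is a contraction.\<close>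

lemma linear_ode:
  fixes B :: "real \<Rightarrow> 'e::euclidean_space \<Rightarrow> 'e"
  assumes "a0 > 0" and lin: "\<And>t. t \<in> {-a0<..<a0} \<Longrightarrow> linear (B t)"
    and sm: "\<And>e. smooth_on {-a0<..<a0} (\<lambda>t. B t e)"
  obtains a y where "0 < a" "a \<le> a0" "smooth_on {-a<..<a} y" "y 0 = p"
    "\<And>t. t \<in> {-a<..<a} \<Longrightarrow> (y has_vector_derivative B t (y t)) (at t)"
proof -
  define J where "J = {-(a0/2)..a0/2}"
  have J: "J \<subseteq> {-a0<..<a0}" "compact J" using \<open>a0 > 0\<close> by (auto simp: J_def)
  have cB: "continuous_on J (\<lambda>t. B t e)" for e
    using smooth_on_continuous[OF sm] J(1) continuous_on_subset by blast
  have "\<exists>M. \<forall>t\<in>J. norm (B t b) \<le> M" for b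
    using compact_imp_bounded[OF compact_continuous_image[OF cB J(2)]] by (auto simp: bounded_iff)
  then obtain M where M: "\<And>b t. t \<in> J \<Longrightarrow> norm (B t b) \<le> M b" by metis
  \<comment> \<open>A bound for the operator norm of \<open>B t\<close>, uniform over the compact
    interval \<open>J\<close>; the summand 1 makes it positive.\<close>
  define L where "L = 1 + (\<Sum>b\<in>Basis. \<bar>M b\<bar>)"
  have L: "L > 0" by (simp add: L_def add_pos_nonneg sum_nonneg)
  have BL: "norm (B t e) \<le> L * norm e" if "t \<in> J" for t e
  proof -
    have "linear (B t)" using lin J that by auto
    then have "norm (B t e) = norm (\<Sum>b\<in>Basis. (e \<bullet> b) *\<^sub>R B t b)"
      by (metis linear_Basis_sum)
    also have "\<dots> \<le> (\<Sum>b\<in>Basis. norm e * \<bar>M b\<bar>)"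
      using M[OF that] by (intro sum_norm_le) (auto intro!: mult_mono Basis_le_norm intro: order_trans[OF _ abs_ge_self])
    also have "\<dots> \<le> L * norm e"
      by (simp add: L_def sum_distrib_left[symmetric] algebra_simps)
    finally show ?thesis .
  qed
  \<comment> \<open>\<open>F\<close> below integrates over an interval of length at most
    \<open>2 * a\<close> and over one of length \<open>a\<close>. Its Lipschitz constant is
    therefore \<open>3 * a * L\<close>, which this choice keeps at or below 1/2.\<close>
  define a where "a = min (a0/2) (1 / (6 * L))"
  have a: "a > 0" "a \<le> a0/2" "a * L \<le> 1/6"
    using \<open>a0 > 0\<close> L by (auto simp: a_def min_def field_simps)
  have aJ: "{-a..a} \<subseteq> J" using a by (auto simp: J_def)
  \<comment> \<open>Clamping the time to \<open>{-a..a}\<close> makes every image under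
    \<open>F\<close> a bounded continuous function on the whole line, hence a point of the complete
    space \<open>bcontfun\<close>.\<close>
  define c where "c t = max (-a) (min a t)" for t :: real
  have c: "c t \<in> {-a..a}" "continuous_on UNIV c" for t
    using a by (auto simp: c_def[abs_def] intro!: continuous_intros)
  have cBy: "continuous_on {-a..a} (\<lambda>t. B t (y t))" if "continuous_on UNIV y" for y
  proof -
    have "continuous_on {-a..a} (\<lambda>t. \<Sum>b\<in>Basis. (y t \<bullet> b) *\<^sub>R B t b)"
      by (intro continuous_intros continuous_on_subset[OF cB aJ] continuous_on_subset[OF that]) auto
    then show ?thesis
      by (rule continuous_on_eq) (rule linear_Basis_sum[OF lin, symmetric], use aJ J in blast)
  qed
  \<comment> \<open>Both integrals start at \<open>-a\<close>, which avoids oriented integrals for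
    negative \<open>t\<close>; their difference is the integral from 0 to
    \<open>c t\<close>.\<close>
  define F where "F y t = p + integral {-a..c t} (\<lambda>s. B s (y s)) - integral {-a..0} (\<lambda>s. B s (y s))" for y :: "real \<Rightarrow> 'e" and t
  have cF: "F y \<in> bcontfun" if y: "continuous_on UNIV y" for y
  proof -
    have "continuous_on {-a..a} (\<lambda>u. integral {-a..u} (\<lambda>s. B s (y s)))"
      using has_vector_derivative_continuous[OF integral_has_vector_derivative[OF cBy[OF y]]]
      by (auto simp: continuous_on_eq_continuous_within)
    then have i: "continuous_on {-a..a} (\<lambda>u. p + integral {-a..u} (\<lambda>s. B s (y s)) - integral {-a..0} (\<lambda>s. B s (y s)))" (is "continuous_on _ ?g")
      by (intro continuous_intros)
    have "continuous_on UNIV (F y)"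
      unfolding F_def using c by (intro continuous_on_compose2[OF i]) auto
    moreover have "bounded (range (F y))"
    proof (rule bounded_subset)
      show "bounded (?g ` {-a..a})"
        using compact_imp_bounded[OF compact_continuous_image[OF i]] by simp
    qed (use c in \<open>auto simp: F_def\<close>)
    ultimately show ?thesis by (simp add: bcontfun_def)
  qed
  define T where "T y = Bcontfun (F (apply_bcontfun y))" for y
  have T: "apply_bcontfun (T y) = F (apply_bcontfun y)" for y
    unfolding T_def by (rule Bcontfun_inverse[OF cF]) (simp add: continuous_on_apply_bcontfun)
  have "\<exists>!y. T y = y"
  proof (rule banach_fix_type[of "1/2"])
    show "\<forall>y z. dist (T y) (T z) \<le> 1/2 * dist y z"
    proof (intro allI dist_bound)
      fix y z :: "(real, 'e) bcontfun" and t :: real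
      have "continuous_on UNIV (apply_bcontfun y)" "continuous_on UNIV (apply_bcontfun z)"
        by (simp_all add: continuous_on_apply_bcontfun)
      note cy = cBy[OF this(1)] and cz = cBy[OF this(2)]
      have le: "norm (integral {-a..u} (\<lambda>s. B s (y s)) - integral {-a..u} (\<lambda>s. B s (z s))) \<le> L * dist y z * (u + a)"
        if "u \<in> {-a..a}" for u
      proof -
        have sub: "{-a..u} \<subseteq> {-a..a}" using that by auto
        note cy' = continuous_on_subset[OF cy sub] and cz' = continuous_on_subset[OF cz sub]
        have "integral {-a..u} (\<lambda>s. B s (y s)) - integral {-a..u} (\<lambda>s. B s (z s)) =
            integral {-a..u} (\<lambda>s. B s (y s) - B s (z s))"
          by (rule integral_diff[symmetric]; rule integrable_continuous_real; fact)
        also have "norm \<dots> \<le> L * dist y z * (u - (-a))"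
        proof (rule integral_bound)
          fix s assume "s \<in> {-a..u}"
          then have s: "s \<in> J" using sub aJ by auto
          then have "linear (B s)" using lin J by auto
          then have "norm (B s (y s) - B s (z s)) \<le> L * norm (y s - z s)"
            using BL[OF s] by (metis linear_diff)
          also have "\<dots> \<le> L * dist y z"
            using L dist_bounded[of y _ z] by (simp add: dist_norm)
          finally show "norm (B s (y s) - B s (z s)) \<le> L * dist y z" .
        qed (use that in \<open>auto intro!: continuous_on_diff cy' cz'\<close>)
        finally show ?thesis by simp
      qed
      have "dist (T y t) (T z t) = norm ((integral {-a..c t} (\<lambda>s. B s (y s)) - integral {-a..c t} (\<lambda>s. B s (z s))) -
          (integral {-a..0} (\<lambda>s. B s (y s)) - integral {-a..0} (\<lambda>s. B s (z s))))"
        by (simp add: T F_def dist_norm algebra_simps)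
      also have "\<dots> \<le> L * dist y z * (c t + a) + L * dist y z * (0 + a)"
        using c a by (intro order_trans[OF norm_triangle_ineq4] add_mono le) auto
      also have "\<dots> \<le> L * dist y z * (2 * a) + L * dist y z * a"
        using c(1)[of t] L by (intro add_mono mult_left_mono) auto
      also have "\<dots> = 3 * (a * L) * dist y z" by simp
      also have "\<dots> \<le> 1/2 * dist y z"
        using a(3) by (intro mult_right_mono) auto
      finally show "dist (T y t) (T z t) \<le> 1/2 * dist y z" .
    qed
  qed auto
  then obtain y where "T y = y" by blast
  then have yF: "apply_bcontfun y t = F (apply_bcontfun y) t" for t by (metis T)
  have cy: "continuous_on UNIV (apply_bcontfun y)" by (simp add: continuous_on_apply_bcontfun)
  have der: "(apply_bcontfun y has_vector_derivative B t (y t)) (at t)" if "t \<in> {-a<..<a}" for t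
  proof -
    have "((\<lambda>u. p + integral {-a..u} (\<lambda>s. B s (y s)) - integral {-a..0} (\<lambda>s. B s (y s)))
        has_vector_derivative B t (y t)) (at t within {-a..a})"
      using that by (auto intro!: derivative_eq_intros integral_has_vector_derivative[OF cBy[OF cy]])
    then have "((\<lambda>u. p + integral {-a..u} (\<lambda>s. B s (y s)) - integral {-a..0} (\<lambda>s. B s (y s)))
        has_vector_derivative B t (y t)) (at t)"
      using that by (simp add: at_within_Icc_at)
    then show ?thesis
    proof (rule has_vector_derivative_transform_within_open[OF _ open_greaterThanLessThan that])
      fix u assume "u \<in> {-a<..<a}"
      then show "p + integral {-a..u} (\<lambda>s. B s (y s)) - integral {-a..0} (\<lambda>s. B s (y s)) = y u"
        by (subst yF) (auto simp: F_def c_def)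
    qed
  qed
  show ?thesis
  proof (rule that[OF a(1) _ _ _ der])
    show "a \<le> a0" using a \<open>a0 > 0\<close> by simp
    show "apply_bcontfun y 0 = p" using a by (subst yF) (simp add: F_def c_def)
    have sub: "{-a<..<a} \<subseteq> {-a0<..<a0}" using a by auto
    show "smooth_on {-a<..<a} (apply_bcontfun y)"
      by (rule linear_ode_smooth[where B = B, OF _ _ _ der])
        (use sub lin smooth_on_subset[OF sm sub] in auto)
  qed
qed

section \<open>Families of linear maps\<close>

text \<open>A product rule in which only the values \<open>L y w\<close> for fixed \<open>w\<close>
  are assumed differentiable, not \<open>L\<close> as a map into a space of operators. Linearity
  reduces it to the finitely many \<open>w\<close> in \<open>Basis\<close>.\<close>

lemma has_derivative_linear_family:
  fixes L :: "'a::real_normed_vector \<Rightarrow> 'b::euclidean_space \<Rightarrow> 'c::real_normed_vector"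
  assumes "open S" "x \<in> S" and lin: "\<And>y. y \<in> S \<Longrightarrow> linear (L y)"
    and diff: "\<And>w. (\<lambda>y. L y w) differentiable (at x)"
    and g: "(g has_derivative g') (at x)"
  shows "((\<lambda>y. L y (g y)) has_derivative
    (\<lambda>a. \<DD> (\<lambda>y. L y (g x)) x a + L x (g' a))) (at x)"
proof -
  let ?D = "\<lambda>w. \<DD> (\<lambda>y. L y w) x"
  have D: "((\<lambda>y. L y w) has_derivative ?D w) (at x)" for w
    using diff by (simp add: frechet_derivative_works[symmetric])
  have sum: "((\<lambda>y. L y (h y)) has_derivative
      (\<lambda>a. \<Sum>b\<in>Basis. (h x \<bullet> b) *\<^sub>R ?D b a + (h' a \<bullet> b) *\<^sub>R L x b)) (at x)"
    if "(h has_derivative h') (at x)" for h h'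
  proof (rule has_derivative_transform_within_open[OF _ assms(1,2)])
    show "((\<lambda>y. \<Sum>b\<in>Basis. (h y \<bullet> b) *\<^sub>R L y b) has_derivative
      (\<lambda>a. \<Sum>b\<in>Basis. (h x \<bullet> b) *\<^sub>R ?D b a + (h' a \<bullet> b) *\<^sub>R L x b)) (at x)"
      by (intro has_derivative_sum has_derivative_scaleR D has_derivative_inner_left that)
  qed (rule linear_Basis_sum[OF lin, symmetric])
  \<comment> \<open>The sum rule for a constant argument identifies the sum over
    \<open>Basis\<close> with the derivative of \<open>L y w\<close> in \<open>y\<close>.\<close>
  have const: "?D w a = (\<Sum>b\<in>Basis. (w \<bullet> b) *\<^sub>R ?D b a)" for w a
    using frechet_derivative_at[OF sum[OF has_derivative_const[of w]]] by (simp add: fun_eq_iff)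
  show ?thesis
    by (rule has_derivative_eq_rhs[OF sum[OF g]])
      (simp add: fun_eq_iff sum.distrib const[of "g x"] linear_Basis_sum[OF lin[OF assms(2)], of "g' _"])
qed

lemma smooth_on_linear_family:
  fixes L :: "'a::real_normed_vector \<Rightarrow> 'b::euclidean_space \<Rightarrow> 'c::real_normed_vector"
  assumes "open S" and lin: "\<And>y. y \<in> S \<Longrightarrow> linear (L y)"
    and "\<And>w. smooth_on S (\<lambda>y. L y w)" and "smooth_on S g"
  shows "smooth_on S (\<lambda>y. L y (g y))"
proof (rule smooth_on_cong[OF assms(1)])
  show "smooth_on S (\<lambda>y. \<Sum>b\<in>Basis. (g y \<bullet> b) *\<^sub>R L y b)"
    by (intro smooth_on_sum smooth_on_scaleR smooth_on_inner smooth_on_const assms finite_Basis)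
qed (rule linear_Basis_sum[OF lin, symmetric])

lemma has_derivative_derivative_field:
  fixes f :: "'a::euclidean_space \<Rightarrow> 'b::real_normed_vector"
  assumes "open S" "x \<in> S" "smooth_on S f" "(g has_derivative g') (at x)"
  shows "((\<lambda>y. \<DD> f y (g y)) has_derivative
    (\<lambda>a. \<DD> (\<lambda>y. \<DD> f y (g x)) x a +
      \<DD> f x (g' a))) (at x)"
  by (rule has_derivative_linear_family[OF assms(1,2) _ _ assms(4)])
    (use smooth_on_linear_derivative[OF assms(3)]
      smooth_on_differentiable[OF smooth_on_derivative[OF assms(3)] assms(2)] in auto)

section \<open>Tangent and cotangent spaces in charts\<close>

text \<open>Charts are pairs; quantifiers over charts must not be split into their components.\<close>

declare split_paired_All [simp del] split_paired_Ex [simp del]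

lemma charts_at_iff: "c \<in> charts_at A x \<longleftrightarrow> c \<in> A \<and> x \<in> chart_dom c"
  by (simp add: charts_at_def)

lemma points_iff: "x \<in> points A \<longleftrightarrow> (\<exists>c. c \<in> charts_at A x)"
  unfolding points_def charts_at_def by blast

lemma chart_inv_in_dom: "y \<in> chart_image c \<Longrightarrow> chart_inv c y \<in> chart_dom c"
  by (simp add: chart_inv_def chart_image_def inv_into_into)

lemma chart_map_inv: "y \<in> chart_image c \<Longrightarrow> chart_map c (chart_inv c y) = y"
  by (simp add: chart_inv_def chart_image_def f_inv_into_f)

lemma chart_map_in_image: "x \<in> chart_dom c \<Longrightarrow> chart_map c x \<in> chart_image c"
  by (simp add: chart_image_def)

definition overlap :: "('m, 'e) chart \<Rightarrow> ('m, 'f) chart \<Rightarrow> 'e set"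
  where "overlap c d = chart_map c ` (chart_dom c \<inter> chart_dom d)"

abbreviation transition :: "('m, 'e) chart \<Rightarrow> ('m, 'f) chart \<Rightarrow> 'e \<Rightarrow> 'f"
  where "transition c d \<equiv> chart_map d \<circ> chart_inv c"

abbreviation transition_deriv ::
    "('m, 'e::euclidean_space) chart \<Rightarrow> ('m, 'e) chart \<Rightarrow> 'm \<Rightarrow> 'e \<Rightarrow> 'e"
  where "transition_deriv c d x \<equiv> \<DD> (transition c d) (chart_map c x)"

definition riesz :: "('e::euclidean_space \<Rightarrow> real) \<Rightarrow> 'e"
  where "riesz f = (\<Sum>b\<in>Basis. f b *\<^sub>R b)"

lemma riesz_inner: "linear f \<Longrightarrow> riesz f \<bullet> w = f w"
  using linear_Basis_sum[of f w] by (simp add: riesz_def inner_sum_right inner_commute mult.commute)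

lemma riesz_inner_left: "riesz (\<lambda>w. e \<bullet> w) = e"
  by (simp add: riesz_def euclidean_representation)

locale atlas =
  fixes A :: "('m, 'e::euclidean_space) chart set"
  assumes smooth_atlas: "smooth_atlas A"
begin

abbreviation vf_coords :: "('m, 'e) chart \<Rightarrow> ('m \<Rightarrow> ('m, 'e) tvec) \<Rightarrow> 'e \<Rightarrow> 'e"
  where "vf_coords c X \<equiv> \<lambda>y. X (chart_inv c y) c"

abbreviation form_coords :: "('m, 'e) chart \<Rightarrow> ('m \<Rightarrow> ('m, 'e) covec) \<Rightarrow> 'e \<Rightarrow> 'e"
  where "form_coords c \<beta> \<equiv> \<lambda>y. covec_coords A c (chart_inv c y) (\<beta> (chart_inv c y))"

abbreviation TM :: "'m \<Rightarrow> ('m, 'e) tvec set"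
  where "TM \<equiv> tangent_space A"

abbreviation TsM :: "'m \<Rightarrow> ('m, 'e) covec set"
  where "TsM \<equiv> cotangent_space A"

abbreviation VF :: "('m \<Rightarrow> ('m, 'e) tvec) set"
  where "VF \<equiv> vector_fields A"

abbreviation coords :: "('m, 'e) chart \<Rightarrow> 'm \<Rightarrow> ('m, 'e) covec \<Rightarrow> 'e"
  where "coords \<equiv> covec_coords A"

section \<open>Charts, overlaps and transition maps\<close>

lemma chart_inv_map: "c \<in> A \<Longrightarrow> x \<in> chart_dom c \<Longrightarrow> chart_inv c (chart_map c x) = x"
  using smooth_atlas by (auto simp: smooth_atlas_def chart_inv_def)

lemma open_chart_image: "c \<in> A \<Longrightarrow> open (chart_image c)"
  using smooth_atlas by (auto simp: smooth_atlas_def)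

lemma open_overlap: "c \<in> A \<Longrightarrow> d \<in> A \<Longrightarrow> open (overlap c d)"
  using smooth_atlas by (auto simp: smooth_atlas_def overlap_def)

lemma smooth_transition: "c \<in> A \<Longrightarrow> d \<in> A \<Longrightarrow> smooth_on (overlap c d) (transition c d)"
  using smooth_atlas by (auto simp: smooth_atlas_def overlap_def)

lemma overlap_iff: "c \<in> A \<Longrightarrow> y \<in> overlap c d \<longleftrightarrow> y \<in> chart_image c \<and> chart_inv c y \<in> chart_dom d"
  using chart_inv_map[of c] by (auto simp: overlap_def chart_image_def image_iff)

lemma chart_map_in_overlap: "c \<in> charts_at A x \<Longrightarrow> d \<in> charts_at A x \<Longrightarrow> chart_map c x \<in> overlap c d"
  by (auto simp: overlap_def charts_at_iff)

lemma transition_in_overlap: "c \<in> A \<Longrightarrow> d \<in> A \<Longrightarrow> y \<in> overlap c d \<Longrightarrow> transition c d y \<in> overlap d c"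
  using chart_inv_map[of c] by (auto simp: overlap_def)

lemma chart_inv_transition:
  "c \<in> A \<Longrightarrow> d \<in> A \<Longrightarrow> y \<in> overlap c d \<Longrightarrow> chart_inv d (transition c d y) = chart_inv c y"
  using chart_inv_map by (auto simp: overlap_iff)

lemma transition_has_derivative:
  assumes "c \<in> charts_at A x" "d \<in> charts_at A x"
  shows "(transition c d has_derivative transition_deriv c d x) (at (chart_map c x))"
  using assms smooth_on_has_derivative[OF smooth_transition chart_map_in_overlap]
  by (auto simp: charts_at_iff)

lemma linear_transition_deriv:
  "c \<in> charts_at A x \<Longrightarrow> d \<in> charts_at A x \<Longrightarrow> linear (transition_deriv c d x)"
  using transition_has_derivative has_derivative_linear by blast

lemma transition_deriv_self:
  assumes "c \<in> charts_at A x"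
  shows "transition_deriv c c x v = v"
proof -
  have "((\<lambda>y. y) has_derivative (\<lambda>v. v)) (at (chart_map c x))" by simp
  then have "(transition c c has_derivative (\<lambda>v. v)) (at (chart_map c x))"
    by (rule has_derivative_transform_within_open[of _ _ _ _ "chart_image c"])
      (use assms in \<open>auto simp: charts_at_iff open_chart_image chart_map_inv chart_map_in_image\<close>)
  then show ?thesis
    using frechet_derivative_at by metis
qed

text \<open>The cocycle identity, by the chain rule. It makes the family \<open>coord_vec\<close>
  consistent between charts, hence a tangent vector.\<close>

lemma transition_deriv_comp:
  assumes "c \<in> charts_at A x" "d \<in> charts_at A x" "e \<in> charts_at A x"
  shows "transition_deriv d e x (transition_deriv c d x v) = transition_deriv c e x v"
proof -
  have x: "transition c d (chart_map c x) = chart_map d x"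
    using assms by (simp add: charts_at_iff chart_inv_map)
  have "(transition d e \<circ> transition c d has_derivative transition_deriv d e x \<circ> transition_deriv c d x)
      (at (chart_map c x))"
    using transition_has_derivative[OF assms(2,3)] transition_has_derivative[OF assms(1,2)]
    by (intro diff_chain_at) (simp_all only: x)
  then have "(transition c e has_derivative transition_deriv d e x \<circ> transition_deriv c d x) (at (chart_map c x))"
    by (rule has_derivative_transform_within_open[of _ _ _ _ "overlap c d"])
      (use assms chart_inv_transition[of c d] chart_map_in_overlap in
        \<open>simp_all add: charts_at_iff open_overlap\<close>)
  then have "transition_deriv d e x \<circ> transition_deriv c d x = transition_deriv c e x"
    by (rule frechet_derivative_at)
  then show ?thesis by (metis comp_apply)
qed

section \<open>Tangent vectors in a chart\<close>

lemma tangent_space_transition: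
  "v \<in> TM x \<Longrightarrow> c \<in> charts_at A x \<Longrightarrow> d \<in> charts_at A x \<Longrightarrow> v d = transition_deriv c d x (v c)"
  unfolding tangent_space_def by blast

lemma tangent_space_outside: "v \<in> TM x \<Longrightarrow> c \<notin> charts_at A x \<Longrightarrow> v c = 0"
  unfolding tangent_space_def by blast

lemma tangent_spaceI:
  assumes "\<And>c. c \<notin> charts_at A x \<Longrightarrow> v c = 0"
    "\<And>c d. c \<in> charts_at A x \<Longrightarrow> d \<in> charts_at A x \<Longrightarrow> v d = transition_deriv c d x (v c)"
  shows "v \<in> TM x"
  using assms unfolding tangent_space_def by blast

lemma coord_vec_tangent: "c \<in> charts_at A x \<Longrightarrow> coord_vec A c x e \<in> TM x"
  by (rule tangent_spaceI) (simp_all add: coord_vec_def transition_deriv_comp)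

lemma coord_vec_apply: "d \<in> charts_at A x \<Longrightarrow> coord_vec A c x e d = transition_deriv c d x e"
  by (simp add: coord_vec_def)

lemma coord_vec_self: "c \<in> charts_at A x \<Longrightarrow> coord_vec A c x e c = e"
  by (simp add: coord_vec_def transition_deriv_self)

lemma coord_vec_of_tangent:
  assumes "v \<in> TM x" "c \<in> charts_at A x"
  shows "coord_vec A c x (v c) = v"
proof
  fix d show "coord_vec A c x (v c) d = v d"
    using tangent_space_transition[OF assms] tangent_space_outside[OF assms(1)]
    by (cases "d \<in> charts_at A x") (simp_all add: coord_vec_def)
qed

lemma tangent_space_eqI:
  "v \<in> TM x \<Longrightarrow> w \<in> TM x \<Longrightarrow> c \<in> charts_at A x \<Longrightarrow> v c = w c \<Longrightarrow> v = w"
  using coord_vec_of_tangent by metis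

lemma tangent_space_0: "0 \<in> TM x"
  by (rule tangent_spaceI) (simp_all add: linear_0[OF linear_transition_deriv])

lemma tangent_space_add:
  assumes "v \<in> TM x" "w \<in> TM x"
  shows "v + w \<in> TM x"
proof (rule tangent_spaceI)
  fix c d assume cd: "c \<in> charts_at A x" "d \<in> charts_at A x"
  show "(v + w) d = transition_deriv c d x ((v + w) c)"
    using tangent_space_transition[OF assms(1) cd] tangent_space_transition[OF assms(2) cd]
      linear_add[OF linear_transition_deriv[OF cd]] by simp
qed (simp add: tangent_space_outside[OF assms(1)] tangent_space_outside[OF assms(2)])

lemma tangent_space_scaleR:
  assumes "v \<in> TM x"
  shows "r *\<^sub>R v \<in> TM x"
proof (rule tangent_spaceI)
  fix c d assume cd: "c \<in> charts_at A x" "d \<in> charts_at A x"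
  show "(r *\<^sub>R v) d = transition_deriv c d x ((r *\<^sub>R v) c)"
    using tangent_space_transition[OF assms cd] linear_cmul[OF linear_transition_deriv[OF cd]]
    by (simp add: scaleR_fun_def)
qed (simp add: tangent_space_outside[OF assms] scaleR_fun_def)

lemma tangent_space_minus: "v \<in> TM x \<Longrightarrow> - v \<in> TM x"
  using tangent_space_scaleR[of v x "-1"] by simp

lemma tangent_space_diff: "v \<in> TM x \<Longrightarrow> w \<in> TM x \<Longrightarrow> v - w \<in> TM x"
  using tangent_space_add[OF _ tangent_space_minus[of w x], of v] by simp

lemma coord_vec_add:
  "c \<in> charts_at A x \<Longrightarrow> coord_vec A c x (a + b) = coord_vec A c x a + coord_vec A c x b"
  by (auto simp: coord_vec_def fun_eq_iff linear_add[OF linear_transition_deriv])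

lemma coord_vec_scaleR:
  "c \<in> charts_at A x \<Longrightarrow> coord_vec A c x (r *\<^sub>R a) = r *\<^sub>R coord_vec A c x a"
  by (auto simp: coord_vec_def fun_eq_iff scaleR_fun_def linear_cmul[OF linear_transition_deriv])

section \<open>Covectors in a chart\<close>

lemma cotangent_space_add: "p \<in> TsM x \<Longrightarrow> q \<in> TsM x \<Longrightarrow> p + q \<in> TsM x"
  by (auto simp: cotangent_space_def algebra_simps)

lemma cotangent_space_scaleR: "p \<in> TsM x \<Longrightarrow> r *\<^sub>R p \<in> TsM x"
  by (auto simp: cotangent_space_def scaleR_fun_def algebra_simps)

lemma cotangent_space_minus: "p \<in> TsM x \<Longrightarrow> - p \<in> TsM x"
  using cotangent_space_scaleR[of p x "-1"] by simp

lemma cotangent_space_diff: "p \<in> TsM x \<Longrightarrow> q \<in> TsM x \<Longrightarrow> p - q \<in> TsM x"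
  using cotangent_space_add[OF _ cotangent_space_minus[of q x], of p] by simp

lemma cotangent_space_0: "0 \<in> TsM x"
  by (auto simp: cotangent_space_def)

lemma cotangent_linear_coord:
  assumes "p \<in> TsM x" "c \<in> charts_at A x"
  shows "linear (\<lambda>e. p (coord_vec A c x e))"
  using assms by (auto intro!: linearI simp: coord_vec_add coord_vec_scaleR cotangent_space_def coord_vec_tangent)

lemma covec_coords_inner:
  assumes "p \<in> TsM x" "c \<in> charts_at A x"
  shows "coords c x p \<bullet> e = p (coord_vec A c x e)"
  using riesz_inner[OF cotangent_linear_coord[OF assms]] by (simp add: covec_coords_def riesz_def)

lemma cotangent_apply:
  assumes "p \<in> TsM x" "c \<in> charts_at A x" "v \<in> TM x"
  shows "p v = coords c x p \<bullet> v c"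
  using covec_coords_inner[OF assms(1,2)] coord_vec_of_tangent[OF assms(3,2)] by simp

lemma cotangent_outside: "p \<in> TsM x \<Longrightarrow> v \<notin> TM x \<Longrightarrow> p v = 0"
  by (simp add: cotangent_space_def)

lemma cotangent_space_eqI:
  assumes "p \<in> TsM x" "q \<in> TsM x" "c \<in> charts_at A x"
    "coords c x p = coords c x q"
  shows "p = q"
proof
  fix v show "p v = q v"
    using assms cotangent_apply cotangent_outside by metis
qed

text \<open>The fibrewise inverse of \<open>covec_coords\<close>; it is zero off the tangent space
  because covectors are normalised that way.\<close>

definition covec_of :: "('m, 'e) chart \<Rightarrow> 'm \<Rightarrow> 'e \<Rightarrow> ('m, 'e) covec"
  where "covec_of c x e = (\<lambda>v. if v \<in> TM x then e \<bullet> v c else 0)"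

lemma covec_of_cotangent: "covec_of c x e \<in> TsM x"
  using tangent_space_add tangent_space_scaleR
  by (auto simp: cotangent_space_def covec_of_def inner_add_right) (simp add: scaleR_fun_def)

lemma covec_coords_of: "c \<in> charts_at A x \<Longrightarrow> coords c x (covec_of c x e) = e"
  using riesz_inner_left[of e]
  by (simp add: covec_coords_def covec_of_def coord_vec_tangent coord_vec_self riesz_def)

lemma covec_of_coords:
  "p \<in> TsM x \<Longrightarrow> c \<in> charts_at A x \<Longrightarrow> covec_of c x (coords c x p) = p"
  using cotangent_space_eqI[OF covec_of_cotangent] covec_coords_of by blast

lemma covec_coords_add: "coords c x (p + q) = coords c x p + coords c x q"
  by (simp add: covec_coords_def scaleR_add_left sum.distrib)

lemma covec_coords_scaleR: "coords c x (r *\<^sub>R p) = r *\<^sub>R coords c x p"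
  by (simp add: covec_coords_def scaleR_sum_right scaleR_fun_def)

lemma covec_coords_diff: "coords c x (p - q) = coords c x p - coords c x q"
  by (simp add: covec_coords_def scaleR_diff_left sum_subtractf)

text \<open>Serves \<open>fibre_deriv\<close> and \<open>hessian_sharp\<close>, both given by such a
  \<open>THE\<close>. Uniqueness is reflexivity in finite dimension: the covectors
  \<open>covec_of c x b\<close> read off every component of \<open>v\<close>.\<close>

lemma the_tangent_vector:
  assumes c: "c \<in> charts_at A x"
    and f: "\<And>\<alpha>. \<alpha> \<in> TsM x \<Longrightarrow> f \<alpha> = coords c x \<alpha> \<bullet> u"
  shows "(THE v. v \<in> TM x \<and> (\<forall>\<alpha>\<in>TsM x. \<alpha> v = f \<alpha>)) = coord_vec A c x u"
proof (rule the_equality)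
  let ?v = "coord_vec A c x u"
  have v: "?v \<in> TM x" by (rule coord_vec_tangent[OF c])
  show "?v \<in> TM x \<and> (\<forall>\<alpha>\<in>TsM x. \<alpha> ?v = f \<alpha>)"
    using v f cotangent_apply[OF _ c v] coord_vec_self[OF c] by simp
  fix v' assume v': "v' \<in> TM x \<and> (\<forall>\<alpha>\<in>TsM x. \<alpha> v' = f \<alpha>)"
  have "v' c = ?v c"
  proof (rule euclidean_eqI)
    fix b
    have "covec_of c x b v' = b \<bullet> u"
      using v' f[OF covec_of_cotangent, of c b] covec_of_cotangent covec_coords_of[OF c] by simp
    then show "v' c \<bullet> b = ?v c \<bullet> b"
      using v' coord_vec_self[OF c] by (simp add: covec_of_def inner_commute)
  qed
  then show "v' = ?v" using tangent_space_eqI[OF _ v c] v' by blast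
qed

text \<open>Components transform with the transpose of the derivative of the opposite transition,
  from \<open>d\<close> to \<open>c\<close>, because the coordinate vectors of \<open>d\<close> have
  to be expressed in \<open>c\<close>.\<close>

lemma covec_coords_transition:
  assumes "p \<in> TsM x" "c \<in> charts_at A x" "d \<in> charts_at A x"
  shows "coords d x p = riesz (\<lambda>b. coords c x p \<bullet> transition_deriv d c x b)"
  using cotangent_apply[OF assms(1,2) coord_vec_tangent[OF assms(3)]] assms
  by (simp add: covec_coords_def[of A d] riesz_def coord_vec_apply)

section \<open>Differentials and curves in a chart\<close>

lemma has_derivative_change_chart:
  assumes c: "c \<in> charts_at A x" and d: "d \<in> charts_at A x"
    and f: "(f \<circ> chart_inv d has_derivative D) (at (chart_map d x))"
  shows "(f \<circ> chart_inv c has_derivative D \<circ> transition_deriv c d x) (at (chart_map c x))"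
proof -
  have x: "transition c d (chart_map c x) = chart_map d x"
    using assms by (simp add: charts_at_iff chart_inv_map)
  have "((f \<circ> chart_inv d) \<circ> transition c d has_derivative D \<circ> transition_deriv c d x) (at (chart_map c x))"
    using transition_has_derivative[OF c d] f by (intro diff_chain_at) (simp_all only: x)
  then show ?thesis
    by (rule has_derivative_transform_within_open[of _ _ _ _ "overlap c d"])
      (use c d chart_inv_transition[of c d] chart_map_in_overlap in
        \<open>simp_all add: charts_at_iff open_overlap\<close>)
qed

text \<open>\<open>differential\<close> takes its chart from \<open>SOME\<close>. The chain rule
  transports the derivative to that chart, and the transformation law of \<open>v\<close> undoes the
  transport.\<close>

lemma differential_chart:
  assumes c: "c \<in> charts_at A x" and v: "v \<in> TM x"
    and f: "(f \<circ> chart_inv c has_derivative D) (at (chart_map c x))"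
  shows "differential A f x v = D (v c)"
proof -
  define d where "d = (SOME d. d \<in> charts_at A x)"
  have d: "d \<in> charts_at A x"
    unfolding d_def using c by (rule someI)
  have "\<DD> (f \<circ> chart_inv d) (chart_map d x) = D \<circ> transition_deriv d c x"
    using frechet_derivative_at[OF has_derivative_change_chart[OF d c f]] by simp
  then show ?thesis
    using tangent_space_transition[OF v d c] by (simp add: differential_def d_def[symmetric])
qed

lemma smooth_curveI_chart:
  assumes "c \<in> A" "open I" "smooth_on I u" "u ` I \<subseteq> chart_image c"
  shows "smooth_curve A I (\<lambda>t. chart_inv c (u t))"
  unfolding smooth_curve_def
proof (intro conjI ballI)
  show "(\<lambda>t. chart_inv c (u t)) ` I \<subseteq> points A"
    using assms chart_inv_in_dom by (fastforce simp: points_def)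
next
  fix d assume d: "d \<in> A"
  have eq: "{t \<in> I. chart_inv c (u t) \<in> chart_dom d} = I \<inter> u -` overlap c d"
    using assms d by (auto simp: overlap_iff)
  show o: "open {t \<in> I. chart_inv c (u t) \<in> chart_dom d}"
    unfolding eq using assms d smooth_on_continuous
    by (intro continuous_open_preimage open_overlap) auto
  show "smooth_on {t \<in> I. chart_inv c (u t) \<in> chart_dom d} (chart_map d \<circ> (\<lambda>t. chart_inv c (u t)))"
    using smooth_on_compose[OF o open_overlap[OF \<open>c \<in> A\<close> d], of u "transition c d"]
      smooth_transition[OF \<open>c \<in> A\<close> d] smooth_on_subset[OF assms(3)] assms(1) d
    by (simp add: o_def eq image_subset_iff)
qed

lemma smooth_curve_has_vector_derivative:
  assumes "smooth_curve A I \<gamma>" "t \<in> I" "c \<in> charts_at A (\<gamma> t)"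
  shows "(chart_map c \<circ> \<gamma> has_vector_derivative velocity A \<gamma> t c) (at t)"
proof -
  have "(chart_map c \<circ> \<gamma>) differentiable (at t)"
    using assms smooth_on_differentiable[of "{t \<in> I. \<gamma> t \<in> chart_dom c}"]
    by (auto simp: smooth_curve_def charts_at_iff)
  then show ?thesis
    using assms by (simp add: velocity_def vector_derivative_works[symmetric])
qed

lemma velocity_tangent:
  assumes "smooth_curve A I \<gamma>" "t \<in> I"
  shows "velocity A \<gamma> t \<in> TM (\<gamma> t)"
proof (rule tangent_spaceI)
  fix c d assume c: "c \<in> charts_at A (\<gamma> t)" and d: "d \<in> charts_at A (\<gamma> t)"
  have "(transition c d \<circ> (chart_map c \<circ> \<gamma>) has_vector_derivative
      transition_deriv c d (\<gamma> t) (velocity A \<gamma> t c)) (at t)"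
    using vector_derivative_diff_chain_within[OF smooth_curve_has_vector_derivative[OF assms c]]
      has_derivative_at_withinI[OF transition_has_derivative[OF c d]] by auto
  moreover have "open {s \<in> I. \<gamma> s \<in> chart_dom c}"
    using assms(1) c by (simp add: smooth_curve_def charts_at_iff)
  ultimately have "(chart_map d \<circ> \<gamma> has_vector_derivative
      transition_deriv c d (\<gamma> t) (velocity A \<gamma> t c)) (at t)"
    by (rule has_vector_derivative_transform_within_open)
      (use assms c in \<open>auto simp: charts_at_iff chart_inv_map\<close>)
  then show "velocity A \<gamma> t d = transition_deriv c d (\<gamma> t) (velocity A \<gamma> t c)"
    using vector_derivative_unique_at[OF smooth_curve_has_vector_derivative[OF assms d]] by blast
qed (simp add: velocity_def)

section \<open>Vector fields and the Lie bracket\<close>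

lemma vector_field_tangent: "X \<in> VF \<Longrightarrow> X x \<in> TM x"
  by (simp add: vector_fields_def)

lemma vector_field_smooth:
  "X \<in> VF \<Longrightarrow> c \<in> A \<Longrightarrow> smooth_on (chart_image c) (vf_coords c X)"
  by (simp add: vector_fields_def)

lemma vector_field_has_derivative:
  assumes "X \<in> VF" "c \<in> charts_at A x"
  shows "((vf_coords c X) has_derivative
    \<DD> (vf_coords c X) (chart_map c x)) (at (chart_map c x))"
  using assms by (intro smooth_on_has_derivative[OF vector_field_smooth])
    (auto simp: charts_at_iff chart_map_in_image)

text \<open>The transformation law of \<open>Y\<close> is differentiated. The first term on the
  right, a second derivative of the transition, is what keeps the coordinate derivative of a vector
  field from being a tangent vector.\<close>

lemma vector_field_derivative_transition:
  assumes Y: "Y \<in> VF" and c: "c \<in> charts_at A x" and d: "d \<in> charts_at A x"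
  shows "\<DD> (vf_coords d Y) (chart_map d x) (transition_deriv c d x a) =
    \<DD> (\<lambda>y. \<DD> (transition c d) y (Y x c)) (chart_map c x) a +
    transition_deriv c d x (\<DD> (vf_coords c Y) (chart_map c x) a)"
proof -
  have A: "c \<in> A" "d \<in> A" using c d by (simp_all add: charts_at_iff)
  have x: "transition c d (chart_map c x) = chart_map d x" "chart_inv c (chart_map c x) = x"
    using c d by (simp_all add: charts_at_iff chart_inv_map)
  let ?O = "overlap c d"
  have "((vf_coords d Y) \<circ> transition c d has_derivative
      \<DD> (vf_coords d Y) (chart_map d x) \<circ> transition_deriv c d x) (at (chart_map c x))"
    using transition_has_derivative[OF c d] vector_field_has_derivative[OF Y d]
    by (intro diff_chain_at) (simp_all only: x)
  then have 1: "((\<lambda>y. \<DD> (transition c d) y (Y (chart_inv c y) c)) has_derivative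
      \<DD> (vf_coords d Y) (chart_map d x) \<circ> transition_deriv c d x) (at (chart_map c x))"
  proof (rule has_derivative_transform_within_open)
    show "open ?O" "chart_map c x \<in> ?O"
      using A c d by (simp_all add: open_overlap chart_map_in_overlap)
    fix y assume y: "y \<in> ?O"
    then have yc: "y \<in> chart_image c" and cd: "c \<in> charts_at A (chart_inv c y)" "d \<in> charts_at A (chart_inv c y)"
      using A by (simp_all add: charts_at_iff overlap_iff chart_inv_in_dom)
    have "Y (chart_inv c y) d = \<DD> (transition c d) y (Y (chart_inv c y) c)"
      using tangent_space_transition[OF vector_field_tangent[OF Y] cd] by (simp only: chart_map_inv[OF yc])
    then show "((vf_coords d Y) \<circ> transition c d) y =
        \<DD> (transition c d) y (Y (chart_inv c y) c)"
      using chart_inv_transition[OF A y] by (simp only: comp_apply)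
  qed
  have 2: "((\<lambda>y. \<DD> (transition c d) y (Y (chart_inv c y) c)) has_derivative
      (\<lambda>a. \<DD> (\<lambda>y. \<DD> (transition c d) y (Y x c)) (chart_map c x) a +
    transition_deriv c d x (\<DD> (vf_coords c Y) (chart_map c x) a))) (at (chart_map c x))"
    using has_derivative_derivative_field[OF open_overlap[OF A] chart_map_in_overlap[OF c d] smooth_transition[OF A]
        vector_field_has_derivative[OF Y c]] by (simp only: x)
  show ?thesis
    using has_derivative_unique[OF 1 2] by (metis comp_apply)
qed

text \<open>The second derivatives of the transition enter once for each order of \<open>X\<close>
  and \<open>Y\<close>, and cancel by symmetry.\<close>

lemma lie_bracket_tangent:
  assumes X: "X \<in> VF" and Y: "Y \<in> VF"
  shows "lie_bracket A X Y x \<in> TM x"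
proof (rule tangent_spaceI)
  fix c d assume c: "c \<in> charts_at A x" and d: "d \<in> charts_at A x"
  have A: "c \<in> A" "d \<in> A" using c d by (simp_all add: charts_at_iff)
  note tr = tangent_space_transition[OF vector_field_tangent[OF X] c d]
    tangent_space_transition[OF vector_field_tangent[OF Y] c d]
  have "lie_bracket A X Y x d =
      \<DD> (vf_coords d Y) (chart_map d x) (transition_deriv c d x (X x c)) -
      \<DD> (vf_coords d X) (chart_map d x) (transition_deriv c d x (Y x c))"
    using d by (simp only: lie_bracket_def tr if_True)
  also have "\<dots> = transition_deriv c d x (lie_bracket A X Y x c)"
    unfolding vector_field_derivative_transition[OF X c d] vector_field_derivative_transition[OF Y c d]
    using smooth_on_derivative_commute[OF open_overlap[OF A] smooth_transition[OF A] chart_map_in_overlap[OF c d],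
        of "X x c" "Y x c"] c
    by (simp add: lie_bracket_def linear_diff[OF linear_transition_deriv[OF c d]])
  finally show "lie_bracket A X Y x d = transition_deriv c d x (lie_bracket A X Y x c)" .
qed (simp add: lie_bracket_def)

end

section \<open>Extension of local sections\<close>

locale hausdorff_atlas = atlas A for A :: "('m, 'e::euclidean_space) chart set" +
  assumes hausdorff: "Hausdorff_space (atlas_topology A)"
begin

section \<open>Compact subsets of charts in the atlas topology\<close>

lemma atlas_open_points: "atlas_open A (points A)"
proof -
  have "chart_map c ` (chart_dom c \<inter> points A) = chart_image c" if "c \<in> A" for c
    using that by (auto simp: points_def chart_image_def)
  then show ?thesis
    by (simp add: atlas_open_def open_chart_image)
qed

lemma topspace_atlas: "topspace (atlas_topology A) = points A"
  using atlas_open_points unfolding topspace_def openin_atlas_topology[OF smooth_atlas]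
  by (auto simp: atlas_open_def)

text \<open>Compact sets are closed in a Hausdorff space. This permits extension by zero: on the
  line with two origins, a function with compact support in one chart need not extend continuously
  by zero.\<close>

lemma atlas_open_complement_compact:
  assumes c: "c \<in> A" and K: "compact K" "K \<subseteq> chart_image c"
  shows "atlas_open A (points A - chart_inv c ` K)"
proof -
  have "continuous_map (top_of_set (chart_image c)) (atlas_topology A) (chart_inv c)"
    unfolding continuous_map_def
  proof (intro conjI allI impI)
    show "chart_inv c \<in> topspace (top_of_set (chart_image c)) \<rightarrow> topspace (atlas_topology A)"
      using c chart_inv_in_dom by (fastforce simp: topspace_atlas points_def)
    fix U assume "openin (atlas_topology A) U"
    then have "open (chart_map c ` (chart_dom c \<inter> U))"
      using c by (simp add: openin_atlas_topology[OF smooth_atlas] atlas_open_def)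
    moreover have "{y \<in> chart_image c. chart_inv c y \<in> U} = chart_map c ` (chart_dom c \<inter> U)"
      using c by (auto simp: chart_image_def chart_inv_map)
    ultimately show "openin (top_of_set (chart_image c)) {x \<in> topspace (top_of_set (chart_image c)). chart_inv c x \<in> U}"
      unfolding openin_open_eq[OF open_chart_image[OF c]] by auto
  qed
  then have "compactin (atlas_topology A) (chart_inv c ` K)"
    by (rule image_compactin[rotated]) (use K in \<open>simp add: compactin_subtopology\<close>)
  then have "closedin (atlas_topology A) (chart_inv c ` K)"
    using compactin_imp_closedin[OF hausdorff] by blast
  then show ?thesis
    by (simp add: closedin_def topspace_atlas openin_atlas_topology[OF smooth_atlas])
qed

text \<open>The image of \<open>d\<close> is covered by two open sets: the overlap with
  \<open>c\<close>, where \<open>F\<close> is smooth by assumption, and the part lying outside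
  \<open>K\<close>, where \<open>F\<close> vanishes.\<close>

lemma smooth_on_extend_by_0:
  assumes A: "c \<in> A" "d \<in> A" and K: "compact K" "K \<subseteq> chart_image c"
    and F: "smooth_on (overlap d c) F"
    and 0: "\<And>y. y \<in> chart_image d \<Longrightarrow> chart_inv d y \<notin> chart_inv c ` K \<Longrightarrow> F y = 0"
  shows "smooth_on (chart_image d) F"
proof (rule smooth_on_local)
  fix y assume y: "y \<in> chart_image d"
  show "\<exists>T. open T \<and> y \<in> T \<and> smooth_on T F"
  proof (cases "chart_inv d y \<in> chart_dom c")
    case True
    then show ?thesis
      using F y A by (auto simp: overlap_iff intro!: exI[of _ "overlap d c"] open_overlap)
  next
    case False
    let ?T = "chart_map d ` (chart_dom d \<inter> (points A - chart_inv c ` K))"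
    have "open ?T"
      using atlas_open_complement_compact[OF A(1) K] A(2) by (simp add: atlas_open_def)
    moreover have "smooth_on ?T F"
      using \<open>open ?T\<close>
    proof (rule smooth_on_eq_0)
      fix z assume "z \<in> ?T"
      then show "F z = 0"
        using chart_inv_map[OF A(2)] by (intro 0) (auto simp: chart_image_def)
    qed
    moreover have "y \<in> ?T"
    proof
      show "y = chart_map d (chart_inv d y)" using chart_map_inv[OF y] by simp
      have "chart_inv d y \<notin> chart_inv c ` K"
        using False chart_inv_in_dom[of _ c] K(2) by (metis imageE subsetD)
      then show "chart_inv d y \<in> chart_dom d \<inter> (points A - chart_inv c ` K)"
        using chart_inv_in_dom[OF y] A(2) by (auto simp: points_def)
    qed
    ultimately show ?thesis by blast
  qed
qed

lemma smooth_on_transition_compose: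
  fixes f :: "'e \<Rightarrow> 'f::real_normed_vector"
  assumes A: "c \<in> A" "d \<in> A" and f: "smooth_on (overlap c d) f"
  shows "smooth_on (overlap d c) (\<lambda>y. f (transition d c y))"
  using transition_in_overlap[OF A(2,1)]
  by (intro smooth_on_compose[OF open_overlap[OF A(2,1)] open_overlap[OF A] _ smooth_transition[OF A(2,1)] f]) auto

lemma overlap_subset: "c \<in> A \<Longrightarrow> overlap c d \<subseteq> chart_image c"
  by (auto simp: overlap_iff)

lemma not_in_K:
  assumes "c \<in> A" "x \<in> chart_dom c" "x \<notin> chart_inv c ` K"
  shows "chart_map c x \<notin> K"
  using assms chart_inv_map by (metis imageI)

context
  fixes c K
  assumes c: "c \<in> A" and K: "compact K" "K \<subseteq> chart_image c"
begin

lemma smooth_fun_extend: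
  assumes "smooth_on (chart_image c) f" "\<And>y. y \<in> chart_image c \<Longrightarrow> y \<notin> K \<Longrightarrow> f y = (0::real)"
  shows "smooth_fun A (\<lambda>x. if x \<in> chart_dom c then f (chart_map c x) else 0)"
  unfolding smooth_fun_def
proof
  fix d assume d: "d \<in> A"
  let ?F = "(\<lambda>x. if x \<in> chart_dom c then f (chart_map c x) else 0) \<circ> chart_inv d"
  show "smooth_on (chart_image d) ?F"
  proof (rule smooth_on_extend_by_0[OF c d K])
    have "smooth_on (overlap d c) (\<lambda>y. f (transition d c y))"
      by (rule smooth_on_transition_compose[OF c d smooth_on_subset[OF assms(1) overlap_subset[OF c]]])
    then show "smooth_on (overlap d c) ?F"
      by (rule smooth_on_cong[OF open_overlap[OF d c], rotated]) (simp add: overlap_iff d)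
    fix y assume "y \<in> chart_image d" "chart_inv d y \<notin> chart_inv c ` K"
    then show "?F y = 0"
      using assms(2) not_in_K[OF c] chart_map_in_image[of _ c] by auto
  qed
qed

lemma vector_field_extend:
  assumes "smooth_on (chart_image c) f" "\<And>y. y \<in> chart_image c \<Longrightarrow> y \<notin> K \<Longrightarrow> f y = 0"
  shows "(\<lambda>x. if x \<in> chart_dom c then coord_vec A c x (f (chart_map c x)) else 0) \<in> VF"
    (is "?X \<in> _")
  unfolding vector_fields_def
proof (intro CollectI conjI allI ballI)
  fix x show "?X x \<in> TM x"
    using c by (auto simp: tangent_space_0 charts_at_iff intro: coord_vec_tangent)
next
  fix d assume d: "d \<in> A"
  let ?F = "\<lambda>y. ?X (chart_inv d y) d"
  show "smooth_on (chart_image d) ?F"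
  proof (rule smooth_on_extend_by_0[OF c d K])
    have "smooth_on (overlap d c) (\<lambda>y. \<DD> (transition c d) (transition d c y) (f (transition d c y)))"
      by (rule smooth_on_transition_compose[OF c d smooth_on_derivative_field[OF open_overlap[OF c d] smooth_transition[OF c d]
              smooth_on_subset[OF assms(1) overlap_subset[OF c]]]])
    then show "smooth_on (overlap d c) ?F"
      by (rule smooth_on_cong[OF open_overlap[OF d c], rotated])
        (simp add: overlap_iff d coord_vec_def charts_at_iff chart_inv_in_dom)
    fix y assume y: "y \<in> chart_image d" "chart_inv d y \<notin> chart_inv c ` K"
    show "?F y = 0"
    proof (cases "chart_inv d y \<in> chart_dom c")
      case True
      then have "coord_vec A c (chart_inv d y) (f (chart_map c (chart_inv d y))) = 0"
        using assms(2) not_in_K[OF c] chart_map_in_image[of _ c] y coord_vec_scaleR[of c "chart_inv d y" 0] c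
        by (auto simp: charts_at_iff)
      then show ?thesis by simp
    qed simp
  qed
qed

lemma one_form_extend:
  assumes "smooth_on (chart_image c) f" "\<And>y. y \<in> chart_image c \<Longrightarrow> y \<notin> K \<Longrightarrow> f y = 0"
  shows "(\<lambda>x. if x \<in> chart_dom c then covec_of c x (f (chart_map c x)) else 0) \<in> one_forms A"
    (is "?\<beta> \<in> _")
  unfolding one_forms_def
proof (intro CollectI conjI allI ballI)
  fix x show "?\<beta> x \<in> TsM x"
    using c by (auto simp: cotangent_space_0 covec_of_cotangent)
next
  fix d assume d: "d \<in> A"
  let ?F = "\<lambda>y. coords d (chart_inv d y) (?\<beta> (chart_inv d y))"
  show "smooth_on (chart_image d) ?F"
  proof (rule smooth_on_extend_by_0[OF c d K])
    have "smooth_on (overlap d c) (\<lambda>y. \<Sum>b\<in>Basis. (f (transition d c y) \<bullet> \<DD> (transition d c) y b) *\<^sub>R b)"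
      by (intro smooth_on_sum smooth_on_scaleR smooth_on_inner smooth_on_const open_overlap c d finite_Basis
          smooth_on_derivative smooth_transition
          smooth_on_transition_compose[OF c d smooth_on_subset[OF assms(1) overlap_subset[OF c]]])
    then show "smooth_on (overlap d c) ?F"
    proof (rule smooth_on_cong[OF open_overlap[OF d c], rotated])
      fix y assume y: "y \<in> overlap d c"
      then have cd: "c \<in> charts_at A (chart_inv d y)" "d \<in> charts_at A (chart_inv d y)" "y \<in> chart_image d"
        using c d by (auto simp: overlap_iff charts_at_iff chart_inv_in_dom)
      then show "(\<Sum>b\<in>Basis. (f (transition d c y) \<bullet> \<DD> (transition d c) y b) *\<^sub>R b) = ?F y"
        using covec_coords_transition[OF covec_of_cotangent cd(1,2), of c]
        by (simp add: riesz_def covec_coords_of charts_at_iff chart_map_inv)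
    qed
    fix y assume y: "y \<in> chart_image d" "chart_inv d y \<notin> chart_inv c ` K"
    show "?F y = 0"
    proof (cases "chart_inv d y \<in> chart_dom c")
      case True
      then have "f (chart_map c (chart_inv d y)) = 0"
        using assms(2) not_in_K[OF c] chart_map_in_image[of _ c] y by blast
      then show ?thesis by (simp add: covec_coords_def covec_of_def cong: if_cong)
    qed (simp add: covec_coords_def)
  qed
qed

end

lemma chart_bump:
  assumes "c \<in> charts_at A x"
  obtains \<psi> :: "'e \<Rightarrow> real" and K N where "smooth_on (chart_image c) \<psi>" "compact K" "K \<subseteq> chart_image c"
    "\<forall>y\<in>chart_image c - K. \<psi> y = 0"
    "open N" "chart_map c x \<in> N" "N \<subseteq> chart_image c" "\<forall>y\<in>N. \<psi> y = 1"
proof -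
  have "open (chart_image c)" "chart_map c x \<in> chart_image c"
    using assms by (auto simp: charts_at_iff open_chart_image chart_map_in_image)
  then obtain \<psi> r where *: "smooth_on UNIV \<psi>" "r > 0" "cball (chart_map c x) r \<subseteq> chart_image c"
    "\<And>y. y \<notin> cball (chart_map c x) r \<Longrightarrow> \<psi> y = 0" "\<And>y. y \<in> ball (chart_map c x) (r/2) \<Longrightarrow> \<psi> y = (1::real)" by (rule smooth_bump) blast
  have "ball (chart_map c x) (r/2) \<subseteq> cball (chart_map c x) r" using *(2) by auto
  with * show ?thesis
    by (intro that[of \<psi> "cball (chart_map c x) r" "ball (chart_map c x) (r/2)"])
      (auto intro: smooth_on_subset)
qed

text \<open>\<open>torsion\<close>, \<open>dual_connection\<close> and \<open>dual_curvature\<close>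
  are characterised through the values of global sections at a point; enough such sections must
  exist for the \<open>THE\<close> to single out one object.\<close>

lemma vector_field_exists:
  assumes "x \<in> points A" "v \<in> TM x"
  obtains X where "X \<in> VF" "X x = v"
proof -
  obtain c where c: "c \<in> charts_at A x" using assms(1) by (auto simp: points_iff)
  obtain \<psi> :: "'e \<Rightarrow> real" and K N where \<psi>: "smooth_on (chart_image c) \<psi>" "compact K" "K \<subseteq> chart_image c"
    "\<forall>y\<in>chart_image c - K. \<psi> y = 0"
    "open N" "chart_map c x \<in> N" "N \<subseteq> chart_image c" "\<forall>y\<in>N. \<psi> y = 1"
    using chart_bump[OF c] by blast
  have cA: "c \<in> A" "x \<in> chart_dom c" using c by (auto simp: charts_at_iff)
  have "(\<lambda>z. if z \<in> chart_dom c then coord_vec A c z (\<psi> (chart_map c z) *\<^sub>R v c) else 0) \<in> VF"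
    using \<psi> cA by (intro vector_field_extend smooth_on_scaleR smooth_on_const open_chart_image) auto
  from that[OF this] show ?thesis
    using \<psi> cA coord_vec_of_tangent[OF assms(2) c] by simp
qed

lemma one_form_exists:
  assumes "x \<in> points A" "p \<in> TsM x"
  obtains \<beta> where "\<beta> \<in> one_forms A" "\<beta> x = p"
proof -
  obtain c where c: "c \<in> charts_at A x" using assms(1) by (auto simp: points_iff)
  obtain \<psi> :: "'e \<Rightarrow> real" and K N where \<psi>: "smooth_on (chart_image c) \<psi>" "compact K" "K \<subseteq> chart_image c"
    "\<forall>y\<in>chart_image c - K. \<psi> y = 0"
    "open N" "chart_map c x \<in> N" "N \<subseteq> chart_image c" "\<forall>y\<in>N. \<psi> y = 1"
    using chart_bump[OF c] by blast
  have cA: "c \<in> A" "x \<in> chart_dom c" using c by (auto simp: charts_at_iff)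
  have "(\<lambda>z. if z \<in> chart_dom c then covec_of c z (\<psi> (chart_map c z) *\<^sub>R coords c x p) else 0) \<in> one_forms A"
    using \<psi> cA by (intro one_form_extend smooth_on_scaleR smooth_on_const open_chart_image) auto
  from that[OF this] show ?thesis
    using \<psi> cA covec_of_coords[OF assms(2) c] by simp
qed

end

section \<open>Algebraic operations on vector fields\<close>

lemma (in atlas) vector_fields_0: "0 \<in> VF"
  using open_chart_image by (auto simp: vector_fields_def tangent_space_0 intro!: smooth_on_const)

lemma (in atlas) vector_fields_add:
  assumes "X \<in> VF" "Y \<in> VF"
  shows "X + Y \<in> VF"
  using assms by (auto simp: vector_fields_def tangent_space_add intro!: smooth_on_add open_chart_image)

lemma (in atlas) vector_fields_scale:
  assumes "smooth_fun A f" "X \<in> VF"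
  shows "(\<lambda>x. f x *\<^sub>R X x) \<in> VF"
proof -
  have "smooth_on (chart_image c) (\<lambda>y. f (chart_inv c y) *\<^sub>R X (chart_inv c y) c)" if "c \<in> A" for c
    using assms that
    by (intro smooth_on_scaleR open_chart_image) (auto simp: vector_fields_def smooth_fun_def o_def)
  moreover have "f x *\<^sub>R X x \<in> TM x" for x
    using assms(2) by (simp add: vector_fields_def tangent_space_scaleR)
  ultimately show ?thesis
    by (simp add: vector_fields_def scaleR_fun_def)
qed

lemma (in atlas) vector_fields_sum:
  "finite I \<Longrightarrow> (\<And>i. i \<in> I \<Longrightarrow> X i \<in> VF) \<Longrightarrow> (\<Sum>i\<in>I. X i) \<in> VF"
  by (induction I rule: finite_induct) (simp_all add: vector_fields_0 vector_fields_add)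

section \<open>Connection coefficients\<close>

lemma sum_fun_apply: "(\<Sum>i\<in>I. f i) x = (\<Sum>i\<in>I. f i x)"
  for f :: "'i \<Rightarrow> 'x \<Rightarrow> 'y::comm_monoid_add"
  by (induction I rule: infinite_finite_induct) auto

context hausdorff_atlas
begin

text \<open>The working interface of a connection. The adjoint connection is treated through it as
  well, so that one set of coordinate lemmas serves both \<open>nab\<close> and its adjoint.\<close>

definition conn_coeffs :: "('m, 'e) conn \<Rightarrow> ('m, 'e) chart \<Rightarrow> ('e \<Rightarrow> 'e \<Rightarrow> 'e \<Rightarrow> 'e) \<Rightarrow> bool"
  where "conn_coeffs nab c G \<longleftrightarrow>
    (\<forall>y\<in>chart_image c. \<forall>u. linear (G y u)) \<and>
    (\<forall>y\<in>chart_image c. \<forall>w. linear (\<lambda>u. G y u w)) \<and>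
    (\<forall>u w. smooth_on (chart_image c) (\<lambda>y. G y u w)) \<and>
    (\<forall>x\<in>chart_dom c. \<forall>v\<in>TM x. \<forall>Y\<in>VF.
      nab x v Y \<in> TM x \<and>
      nab x v Y c = \<DD> (vf_coords c Y) (chart_map c x) (v c)
        + G (chart_map c x) (v c) (Y x c))"

context
  fixes nab :: "('m, 'e) conn"
  assumes conn: "affine_connection A nab"
begin

section \<open>Locality of an affine connection and its Christoffel coefficients\<close>

lemma nab_vector_field:
  "X \<in> VF \<Longrightarrow> Y \<in> VF \<Longrightarrow> (\<lambda>x. nab x (X x) Y) \<in> VF"
  using conn by (simp add: affine_connection_def)

text \<open>\<open>affine_connection\<close> states tangency for derivatives along fields, so
  \<open>v\<close> is first extended to a field.\<close>

lemma nab_tangent: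
  assumes "x \<in> points A" "v \<in> TM x" "Y \<in> VF"
  shows "nab x v Y \<in> TM x"
proof -
  obtain X where "X \<in> VF" "X x = v"
    using vector_field_exists[OF assms(1,2)] .
  then show ?thesis
    using vector_field_tangent[OF nab_vector_field[OF _ assms(3)]] by metis
qed

lemma linear_nab_coord:
  assumes "c \<in> charts_at A x" "Y \<in> VF"
  shows "linear (\<lambda>u. nab x (coord_vec A c x u) Y c)"
proof -
  have "x \<in> points A" using assms(1) by (auto simp: points_iff)
  with conn assms show ?thesis
    by (intro linearI)
      (simp_all add: affine_connection_def coord_vec_add coord_vec_scaleR coord_vec_tangent scaleR_fun_def)
qed

lemma nab_sum:
  assumes "x \<in> points A" "v \<in> TM x" "finite I"
    "\<And>i. i \<in> I \<Longrightarrow> Y i \<in> VF" "\<And>i. i \<in> I \<Longrightarrow> smooth_fun A (f i)"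
  shows "nab x v (\<Sum>i\<in>I. (\<lambda>z. f i z *\<^sub>R Y i z)) =
    (\<Sum>i\<in>I. differential A (f i) x v *\<^sub>R Y i x + f i x *\<^sub>R nab x v (Y i))"
  using assms(3-5)
proof (induction I rule: finite_induct)
  case empty
  have "nab x v (0 + 0) = nab x v 0 + nab x v 0"
    using conn assms(1,2) vector_fields_0 unfolding affine_connection_def by blast
  then show ?case by (simp add: zero_fun_def[symmetric])
next
  case (insert i I)
  have 1: "(\<lambda>z. f i z *\<^sub>R Y i z) \<in> VF"
    using insert by (intro vector_fields_scale) auto
  have 2: "(\<Sum>i\<in>I. (\<lambda>z. f i z *\<^sub>R Y i z)) \<in> VF"
    using insert by (intro vector_fields_sum vector_fields_scale) auto
  have "nab x v ((\<lambda>z. f i z *\<^sub>R Y i z) + (\<Sum>i\<in>I. (\<lambda>z. f i z *\<^sub>R Y i z))) =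
      nab x v (\<lambda>z. f i z *\<^sub>R Y i z) + nab x v (\<Sum>i\<in>I. (\<lambda>z. f i z *\<^sub>R Y i z))"
    using conn assms(1,2) 1 2 unfolding affine_connection_def by blast
  moreover have "nab x v (\<lambda>z. f i z *\<^sub>R Y i z) = differential A (f i) x v *\<^sub>R Y i x + f i x *\<^sub>R nab x v (Y i)"
    using conn assms(1,2) insert.prems unfolding affine_connection_def by blast
  moreover have "nab x v (\<Sum>i\<in>I. (\<lambda>z. f i z *\<^sub>R Y i z)) =
      (\<Sum>i\<in>I. differential A (f i) x v *\<^sub>R Y i x + f i x *\<^sub>R nab x v (Y i))"
    using insert by blast
  ultimately show ?case
    by (simp only: sum.insert[OF insert.hyps(1,2)])
qed

text \<open>\<open>E w\<close> is a global field whose coordinates are constant over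
  \<open>N\<close>. The last clause is the Leibniz rule for the expansion of \<open>Y\<close> in
  this frame; it is what makes \<open>nab\<close> local.\<close>

definition local_frame :: "('m, 'e) chart \<Rightarrow> 'e set \<Rightarrow> ('e \<Rightarrow> 'm \<Rightarrow> ('m, 'e) tvec) \<Rightarrow> bool"
  where "local_frame c N E \<longleftrightarrow> open N \<and> N \<subseteq> chart_image c \<and> (\<forall>w. E w \<in> VF) \<and>
    (\<forall>y\<in>N. \<forall>w. E w (chart_inv c y) c = w) \<and>
    (\<forall>y\<in>N. \<forall>v\<in>TM (chart_inv c y). \<forall>Y\<in>VF.
      nab (chart_inv c y) v Y c = \<DD> (vf_coords c Y) y (v c)
        + (\<Sum>b\<in>Basis. (Y (chart_inv c y) c \<bullet> b) *\<^sub>R nab (chart_inv c y) v (E b) c))"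

lemma local_frameD:
  assumes "local_frame c N E"
  shows "open N" "N \<subseteq> chart_image c" "E w \<in> VF" "y \<in> N \<Longrightarrow> E w (chart_inv c y) c = w"
    "y \<in> N \<Longrightarrow> v \<in> TM (chart_inv c y) \<Longrightarrow> Y \<in> VF \<Longrightarrow>
      nab (chart_inv c y) v Y c = \<DD> (vf_coords c Y) y (v c)
        + (\<Sum>b\<in>Basis. (Y (chart_inv c y) c \<bullet> b) *\<^sub>R nab (chart_inv c y) v (E b) c)"
  using assms unfolding local_frame_def by blast+

text \<open>Cutting off the expansion of \<open>Y\<close> in the coordinate frame by a bump function gives an identity
  between global sections, to which the Leibniz rule applies.\<close>

lemma local_frame_exists:
  assumes c: "c \<in> charts_at A x0"
  obtains N E where "chart_map c x0 \<in> N" "local_frame c N E"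
proof -
  obtain \<psi> :: "'e \<Rightarrow> real" and K N where \<psi>: "smooth_on (chart_image c) \<psi>" "compact K" "K \<subseteq> chart_image c"
    "\<forall>y\<in>chart_image c - K. \<psi> y = 0"
    and N: "open N" "chart_map c x0 \<in> N" "N \<subseteq> chart_image c" "\<forall>y\<in>N. \<psi> y = 1"
    using chart_bump[OF c] by blast
  have cA: "c \<in> A" using c by (simp add: charts_at_iff)
  note o = open_chart_image[OF cA]
  note ext_fun = smooth_fun_extend[OF cA \<psi>(2,3)]
  define E where "E w = (\<lambda>z. if z \<in> chart_dom c then coord_vec A c z (\<psi> (chart_map c z) *\<^sub>R w) else 0)" for w
  \<comment> \<open>One factor of the bump cuts off the coefficients \<open>g b\<close> of
    \<open>Y\<close>, the other cuts off the frame fields \<open>E b\<close>.\<close>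
  define \<psi>2 where "\<psi>2 z = (if z \<in> chart_dom c then \<psi> (chart_map c z) * \<psi> (chart_map c z) else 0)" for z
  have EV: "E w \<in> VF" for w
    unfolding E_def using \<psi> cA by (intro vector_field_extend smooth_on_scaleR smooth_on_const o) auto
  have s2: "smooth_fun A \<psi>2"
    unfolding \<psi>2_def[abs_def] using \<psi> by (intro ext_fun smooth_on_mult o) auto
  have EN: "E w (chart_inv c y) c = w" if "y \<in> N" for w y
  proof -
    have y: "y \<in> chart_image c" using that N(3) by auto
    then show ?thesis
      using that N(4) cA by (simp add: E_def chart_inv_in_dom chart_map_inv coord_vec_self charts_at_iff)
  qed
  have formula: "nab x v Y c = \<DD> (vf_coords c Y) (chart_map c x) (v c)
        + (\<Sum>b\<in>Basis. (Y x c \<bullet> b) *\<^sub>R nab x v (E b) c)"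
    if x: "x \<in> chart_dom c" "chart_map c x \<in> N" and v: "v \<in> TM x" and Y: "Y \<in> VF" for x v Y
  proof -
    have xc: "c \<in> charts_at A x" and xp: "x \<in> points A"
      using x cA by (auto simp: charts_at_iff points_iff)
    \<comment> \<open>The detour through \<open>chart_inv c (chart_map c z)\<close> writes the
      coefficient as a function of \<open>chart_map c z\<close>, the form that
      \<open>smooth_fun_extend\<close> accepts.\<close>
    define g where "g b z = (if z \<in> chart_dom c then \<psi> (chart_map c z) * (Y (chart_inv c (chart_map c z)) c \<bullet> b) else 0)" for b z
    have sg: "smooth_fun A (g b)" for b
      unfolding g_def[abs_def] using \<psi>
      by (intro ext_fun smooth_on_mult smooth_on_inner smooth_on_const o vector_field_smooth[OF Y cA]) auto
    have "(\<lambda>z. \<psi>2 z *\<^sub>R Y z) = (\<Sum>b\<in>Basis. (\<lambda>z. g b z *\<^sub>R E b z))"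
    proof
      fix z
      show "\<psi>2 z *\<^sub>R Y z = (\<Sum>b\<in>Basis. (\<lambda>z. g b z *\<^sub>R E b z)) z"
      proof (cases "z \<in> chart_dom c")
        case True
        then have zc: "c \<in> charts_at A z" using cA by (simp add: charts_at_iff)
        have "(\<Sum>b\<in>Basis. (Y z c \<bullet> b) *\<^sub>R coord_vec A c z b) = coord_vec A c z (Y z c)"
          using linear_Basis_sum[of "coord_vec A c z" "Y z c"]
          by (metis linearI coord_vec_add[OF zc] coord_vec_scaleR[OF zc])
        also have "\<dots> = Y z" by (rule coord_vec_of_tangent[OF vector_field_tangent[OF Y] zc])
        finally have Yz: "(\<Sum>b\<in>Basis. (Y z c \<bullet> b) *\<^sub>R coord_vec A c z b) = Y z" .
        have "(\<Sum>b\<in>Basis. (\<lambda>z. g b z *\<^sub>R E b z)) z = (\<Sum>b\<in>Basis. g b z *\<^sub>R E b z)"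
          by (rule sum_fun_apply)
        also have "\<dots> = (\<Sum>b\<in>Basis. \<psi>2 z *\<^sub>R ((Y z c \<bullet> b) *\<^sub>R coord_vec A c z b))"
          using True zc by (intro sum.cong refl)
            (simp add: \<psi>2_def g_def E_def chart_inv_map[OF cA] coord_vec_scaleR mult.assoc mult.left_commute)
        also have "\<dots> = \<psi>2 z *\<^sub>R Y z"
          by (simp only: scaleR_sum_right[symmetric] Yz)
        finally show ?thesis ..
      qed (simp add: sum_fun_apply \<psi>2_def g_def)
    qed
    then have eq: "nab x v (\<lambda>z. \<psi>2 z *\<^sub>R Y z) =
        (\<Sum>b\<in>Basis. differential A (g b) x v *\<^sub>R E b x + g b x *\<^sub>R nab x v (E b))"
      using nab_sum[OF xp v finite_Basis EV sg] by simp
    \<comment> \<open>Over \<open>N\<close> the factor \<open>\<psi>2\<close> is constantly 1 and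
      \<open>g b\<close> is the component of \<open>Y\<close>, so the cutoff leaves no trace in the
      Leibniz rule at \<open>x\<close>.\<close>
    have 1: "differential A \<psi>2 x v = 0"
    proof (rule differential_chart[OF xc v, of _ "\<lambda>_. 0"])
      show "(\<psi>2 \<circ> chart_inv c has_derivative (\<lambda>_. 0)) (at (chart_map c x))"
        by (rule has_derivative_transform_within_open[OF has_derivative_const[of 1] N(1) x(2)])
          (use N(3,4) in \<open>auto simp: \<psi>2_def chart_map_inv chart_inv_in_dom subset_iff\<close>)
    qed
    have 2: "\<psi>2 x = 1" using x N(4) by (simp add: \<psi>2_def)
    have 3: "differential A (g b) x v = \<DD> (vf_coords c Y) (chart_map c x) (v c) \<bullet> b" for b
    proof (rule differential_chart[OF xc v])
      show "(g b \<circ> chart_inv c has_derivative (\<lambda>a. \<DD> (vf_coords c Y) (chart_map c x) a \<bullet> b)) (at (chart_map c x))"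
        by (rule has_derivative_transform_within_open[OF has_derivative_inner_left[OF vector_field_has_derivative[OF Y xc]] N(1) x(2)])
          (use N(3,4) in \<open>auto simp: g_def chart_map_inv chart_inv_in_dom subset_iff\<close>)
    qed
    have 4: "g b x = Y x c \<bullet> b" for b
      using x N(4) by (simp add: g_def chart_inv_map[OF cA])
    have "nab x v (\<lambda>z. \<psi>2 z *\<^sub>R Y z) = differential A \<psi>2 x v *\<^sub>R Y x + \<psi>2 x *\<^sub>R nab x v Y"
      using conn xp v Y s2 unfolding affine_connection_def by blast
    with eq have "nab x v Y = (\<Sum>b\<in>Basis. differential A (g b) x v *\<^sub>R E b x + g b x *\<^sub>R nab x v (E b))"
      by (simp add: 1 2)
    then have "nab x v Y c = (\<Sum>b\<in>Basis. differential A (g b) x v *\<^sub>R E b x c + g b x *\<^sub>R nab x v (E b) c)"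
      by (simp add: sum_fun_apply scaleR_fun_def)
    moreover have "E b x c = b" for b
      using EN[OF x(2)] x(1) by (simp add: chart_inv_map[OF cA])
    ultimately show ?thesis
      by (simp add: 3 4 sum.distrib euclidean_representation)
  qed
  show ?thesis
  proof (rule that[OF N(2)])
    show "local_frame c N E"
      unfolding local_frame_def
    proof (intro conjI ballI allI)
      fix y v Y assume *: "y \<in> N" "v \<in> TM (chart_inv c y)" "Y \<in> VF"
      then have y: "y \<in> chart_image c" using N(3) by auto
      show "nab (chart_inv c y) v Y c = \<DD> (vf_coords c Y) y (v c)
        + (\<Sum>b\<in>Basis. (Y (chart_inv c y) c \<bullet> b) *\<^sub>R nab (chart_inv c y) v (E b) c)"
        using formula[of "chart_inv c y" v Y] * by (simp add: chart_inv_in_dom[OF y] chart_map_inv[OF y])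
    qed (use N(1,3) EV EN in auto)
  qed
qed

text \<open>The value does not depend on the field chosen by \<open>SOME\<close>, see \<open>christoffel_local_frame\<close>.\<close>

definition christoffel :: "('m, 'e) chart \<Rightarrow> 'e \<Rightarrow> 'e \<Rightarrow> 'e \<Rightarrow> 'e"
  where "christoffel c y u w = (let x = chart_inv c y;
      E = (SOME E. E \<in> VF \<and> E x = coord_vec A c x w) in
    nab x (coord_vec A c x u) E c - \<DD> (vf_coords c E) y u)"

text \<open>\<open>christoffel\<close> subtracts the derivative of the chosen field. By the frame
  formula the remainder involves only the value of that field at the point, whose coordinates are
  \<open>w\<close>.\<close>

lemma christoffel_local_frame:
  assumes cA: "c \<in> A" and NE: "local_frame c N E" and y: "y \<in> N"
  shows "christoffel c y u w =
    (\<Sum>b\<in>Basis. (w \<bullet> b) *\<^sub>R nab (chart_inv c y) (coord_vec A c (chart_inv c y) u) (E b) c)"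
proof -
  let ?x = "chart_inv c y"
  have xc: "c \<in> charts_at A ?x"
    using y local_frameD(2)[OF NE] cA by (auto simp: charts_at_iff chart_inv_in_dom)
  define F where "F = (SOME E. E \<in> VF \<and> E ?x = coord_vec A c ?x w)"
  have "\<exists>E. E \<in> VF \<and> E ?x = coord_vec A c ?x w"
    using vector_field_exists[of ?x "coord_vec A c ?x w"] xc coord_vec_tangent[OF xc] points_iff by metis
  then have F: "F \<in> VF \<and> F ?x = coord_vec A c ?x w"
    unfolding F_def by (rule someI_ex)
  then show ?thesis
    using local_frameD(5)[OF NE y coord_vec_tangent[OF xc, of u], of F]
    by (simp add: christoffel_def Let_def F_def[symmetric] coord_vec_self[OF xc])
qed

lemma christoffel_conn_coeffs:
  assumes cA: "c \<in> A"
  shows "conn_coeffs nab c (christoffel c)"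
proof -
  have local: "\<exists>N E. y \<in> N \<and> local_frame c N E" if y: "y \<in> chart_image c" for y
    using local_frame_exists[of c "chart_inv c y"] cA chart_inv_in_dom[OF y] chart_map_inv[OF y]
    by (metis charts_at_iff)
  show ?thesis
    unfolding conn_coeffs_def
  proof (intro conjI ballI allI)
    fix y u assume "y \<in> chart_image c"
    then obtain N E where "y \<in> N" "local_frame c N E" using local by blast
    note E = christoffel_local_frame[OF cA this(2,1)]
    show "linear (christoffel c y u)"
      by (rule linearI) (simp_all add: E inner_add_left scaleR_add_left sum.distrib scaleR_sum_right)
  next
    fix y w assume y: "y \<in> chart_image c"
    then obtain N E where NE: "y \<in> N" "local_frame c N E" using local by blast
    note E = christoffel_local_frame[OF cA NE(2,1)]
    have "c \<in> charts_at A (chart_inv c y)" using y cA by (auto simp: charts_at_iff chart_inv_in_dom)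
    note lin = linear_nab_coord[OF this local_frameD(3)[OF NE(2)]]
    show "linear (\<lambda>u. christoffel c y u w)"
      by (rule linearI)
        (simp_all add: E linear_add[OF lin] linear_cmul[OF lin] scaleR_add_right sum.distrib scaleR_sum_right mult.commute)
  next
    fix u w
    show "smooth_on (chart_image c) (\<lambda>y. christoffel c y u w)"
    proof (rule smooth_on_local)
      fix y0 assume "y0 \<in> chart_image c"
      then obtain N E where y0: "y0 \<in> N" and NE: "local_frame c N E" using local by blast
      note N = local_frameD(1)[OF NE] y0 local_frameD(2)[OF NE] and E = local_frameD(3,4)[OF NE]
        and ch = christoffel_local_frame[OF cA NE]
      \<comment> \<open>Smoothness is available for covariant derivatives along global fields, so
        the coordinate vector of \<open>u\<close> is replaced by \<open>E u\<close>, which agrees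
        with it over \<open>N\<close>.\<close>
      have "smooth_on N (\<lambda>y. \<Sum>b\<in>Basis. (w \<bullet> b) *\<^sub>R nab (chart_inv c y) (E u (chart_inv c y)) (E b) c)"
        using vector_field_smooth[OF nab_vector_field[OF E(1) E(1)] cA]
        by (intro smooth_on_sum smooth_on_scaleR smooth_on_const N(1) finite_Basis)
          (rule smooth_on_subset[OF _ N(3)])
      then have "smooth_on N (\<lambda>y. christoffel c y u w)"
      proof (rule smooth_on_cong[OF N(1), rotated])
        fix y assume y: "y \<in> N"
        then have xc: "c \<in> charts_at A (chart_inv c y)" using N(3) cA by (auto simp: charts_at_iff chart_inv_in_dom)
        have "coord_vec A c (chart_inv c y) u = E u (chart_inv c y)"
          using coord_vec_of_tangent[OF vector_field_tangent[OF E(1)] xc] E(2)[OF y] by metis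
        then show "(\<Sum>b\<in>Basis. (w \<bullet> b) *\<^sub>R nab (chart_inv c y) (E u (chart_inv c y)) (E b) c) = christoffel c y u w"
          by (simp add: ch[OF y])
      qed
      with N show "\<exists>T. open T \<and> y0 \<in> T \<and> smooth_on T (\<lambda>y. christoffel c y u w)" by blast
    qed
  next
    fix x v Y assume x: "x \<in> chart_dom c" and v: "v \<in> TM x" and Y: "Y \<in> VF"
    have xc: "c \<in> charts_at A x" using x cA by (simp add: charts_at_iff)
    then have "x \<in> points A" by (auto simp: points_iff)
    then show "nab x v Y \<in> TM x" using nab_tangent v Y by blast
    obtain N E where N: "chart_map c x \<in> N" and NE: "local_frame c N E"
      using local[OF chart_map_in_image[OF x]] by blast
    note f = local_frameD(5)[OF NE] and ch = christoffel_local_frame[OF cA NE]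
    show "nab x v Y c = \<DD> (vf_coords c Y) (chart_map c x) (v c)
        + christoffel c (chart_map c x) (v c) (Y x c)"
      using f[OF N, of v Y] v Y by (simp add: ch[OF N] chart_inv_map[OF cA x] coord_vec_of_tangent[OF v xc])
  qed
qed

end

section \<open>Torsion and adjoint connection in terms of coefficients\<close>

lemma conn_coeffsD:
  assumes "conn_coeffs nab c G"
  shows "y \<in> chart_image c \<Longrightarrow> linear (G y u)"
    and "y \<in> chart_image c \<Longrightarrow> linear (\<lambda>u. G y u w)"
    and "smooth_on (chart_image c) (\<lambda>y. G y u w)"
    and "x \<in> chart_dom c \<Longrightarrow> v \<in> TM x \<Longrightarrow> Y \<in> VF \<Longrightarrow> nab x v Y \<in> TM x"
    and "x \<in> chart_dom c \<Longrightarrow> v \<in> TM x \<Longrightarrow> Y \<in> VF \<Longrightarrow>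
      nab x v Y c = \<DD> (vf_coords c Y) (chart_map c x) (v c)
        + G (chart_map c x) (v c) (Y x c)"
  using assms unfolding conn_coeffs_def by blast+

text \<open>The derivatives of \<open>X\<close> and \<open>Y\<close> cancel against the Lie bracket,
  so every choice of extensions gives the same vector and the \<open>THE\<close> is
  justified.\<close>

lemma torsion_coords:
  assumes G: "conn_coeffs nab c G" and c: "c \<in> charts_at A x"
    and v: "v \<in> TM x" and w: "w \<in> TM x"
  shows "torsion A nab x v w \<in> TM x"
    and "torsion A nab x v w c = G (chart_map c x) (v c) (w c) - G (chart_map c x) (w c) (v c)"
proof -
  have x: "x \<in> chart_dom c" "x \<in> points A" using c by (auto simp: charts_at_iff points_iff)
  define t where "t X Y = nab x (X x) Y - nab x (Y x) X - lie_bracket A X Y x" for X Y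
  have t: "t X Y \<in> TM x \<and> t X Y c = G (chart_map c x) (v c) (w c) - G (chart_map c x) (w c) (v c)"
    if X: "X \<in> VF" "X x = v" and Y: "Y \<in> VF" "Y x = w" for X Y
    using X Y v w lie_bracket_tangent[OF X(1) Y(1), of x] conn_coeffsD(4,5)[OF G x(1)] c
    by (simp add: t_def tangent_space_diff lie_bracket_def)
  obtain X where X: "X \<in> VF" "X x = v" using vector_field_exists[OF x(2) v] .
  obtain Y where Y: "Y \<in> VF" "Y x = w" using vector_field_exists[OF x(2) w] .
  have "torsion A nab x v w = t X Y"
    unfolding torsion_def t_def[symmetric]
  proof (rule the_equality)
    show "\<forall>X'\<in>VF. \<forall>Y'\<in>VF. X' x = v \<longrightarrow> Y' x = w \<longrightarrow> t X Y = t X' Y'"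
      using t[OF X Y] t tangent_space_eqI[OF _ _ c] by metis
  qed (use X Y in blast)
  then show "torsion A nab x v w \<in> TM x"
    and "torsion A nab x v w c = G (chart_map c x) (v c) (w c) - G (chart_map c x) (w c) (v c)"
    using t[OF X Y] by simp_all
qed

lemma adjoint_conn_coeffs:
  assumes G: "conn_coeffs nab c G" and c: "c \<in> A"
  shows "conn_coeffs (adjoint_connection A nab) c (\<lambda>y u w. G y w u)"
  unfolding conn_coeffs_def adjoint_connection_def
proof (intro conjI ballI allI)
  fix x v Y assume x: "x \<in> chart_dom c" and v: "v \<in> TM x" and Y: "Y \<in> VF"
  have xc: "c \<in> charts_at A x" using x c by (simp add: charts_at_iff)
  note t = torsion_coords[OF G xc v vector_field_tangent[OF Y]]
  show "nab x v Y - torsion A nab x v (Y x) \<in> TM x"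
    using conn_coeffsD(4)[OF G x v Y] t by (simp add: tangent_space_diff)
  show "(nab x v Y - torsion A nab x v (Y x)) c =
       \<DD> (vf_coords c Y) (chart_map c x) (v c) + G (chart_map c x) (Y x c) (v c)"
    using conn_coeffsD(5)[OF G x v Y] t by simp
qed (use conn_coeffsD[OF G] in auto)

end

section \<open>Dual connection and dual curvature in coordinates\<close>

context hausdorff_atlas
begin

definition coeff_deriv :: "('e \<Rightarrow> 'e \<Rightarrow> 'e \<Rightarrow> 'e) \<Rightarrow> 'e \<Rightarrow> 'e \<Rightarrow> 'e \<Rightarrow> 'e \<Rightarrow> 'e"
  where "coeff_deriv G y a u w = \<DD> (\<lambda>y. G y u w) y a"

text \<open>The three arguments are released one after the other: \<open>D1\<close> moves the base
  point, \<open>D2\<close> also the first vector, \<open>D3\<close> both vectors. \<open>D2\<close>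
  and \<open>D3\<close> rest on linearity in the newly released argument.\<close>

lemma has_derivative_coeffs:
  fixes k f g :: "'z::real_normed_vector \<Rightarrow> 'e"
  assumes G: "conn_coeffs nab c G" and c: "c \<in> A" and z: "k z \<in> chart_image c"
    and k: "(k has_derivative k') (at z)" and f: "(f has_derivative f') (at z)" and g: "(g has_derivative g') (at z)"
  shows "((\<lambda>z. G (k z) (f z) (g z)) has_derivative
    (\<lambda>a. coeff_deriv G (k z) (k' a) (f z) (g z) + G (k z) (f' a) (g z) + G (k z) (f z) (g' a))) (at z)"
proof -
  let ?U = "chart_image c"
  have o: "open ?U" using c by (rule open_chart_image)
  note lin = conn_coeffsD(1,2)[OF G]
  have D: "((\<lambda>y. G y u w) has_derivative (\<lambda>a. coeff_deriv G y a u w)) (at y)" if "y \<in> ?U" for y u w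
    unfolding coeff_deriv_def using smooth_on_has_derivative[OF conn_coeffsD(3)[OF G] that] .
  have D1: "((\<lambda>q. G (fst q) u w) has_derivative (\<lambda>a. coeff_deriv G (fst q) (fst a) u w)) (at q)"
    if "fst q \<in> ?U" for q :: "'e \<times> 'e" and u w
    using has_derivative_compose[OF has_derivative_fst[OF has_derivative_ident] D[OF that]] .
  have D2: "((\<lambda>q. G (fst q) (snd q) w) has_derivative
      (\<lambda>a. coeff_deriv G (fst q) (fst a) (snd q) w + G (fst q) (snd a) w)) (at q)"
    if "fst q \<in> ?U" for q :: "'e \<times> 'e" and w
  proof -
    have "((\<lambda>q. G (fst q) (snd q) w) has_derivative
      (\<lambda>a. \<DD> (\<lambda>q'. G (fst q') (snd q) w) q a + G (fst q) (snd a) w)) (at q)"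
    proof (rule has_derivative_linear_family[where S = "?U \<times> UNIV" and L = "\<lambda>q u. G (fst q) u w" and g = snd])
      show "(\<lambda>q. G (fst q) u w) differentiable at q" for u
        using D1[OF that] differentiableI by blast
    qed (use that o lin in \<open>auto simp: mem_Times_iff intro!: open_Times has_derivative_snd has_derivative_ident\<close>)
    then show ?thesis
      by (rule has_derivative_eq_rhs) (simp add: frechet_derivative_at[OF D1[OF that], symmetric])
  qed
  have D3: "((\<lambda>q. G (fst q) (fst (snd q)) (snd (snd q))) has_derivative
      (\<lambda>a. coeff_deriv G (fst q) (fst a) (fst (snd q)) (snd (snd q)) + G (fst q) (fst (snd a)) (snd (snd q))
        + G (fst q) (fst (snd q)) (snd (snd a)))) (at q)"
    if "fst q \<in> ?U" for q :: "'e \<times> 'e \<times> 'e"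
  proof -
    have "((\<lambda>q. (fst q, fst (snd q))) has_derivative (\<lambda>a. (fst a, fst (snd a)))) (at q)"
      by (auto intro!: derivative_eq_intros)
    from has_derivative_compose[OF this D2[of "(fst q, fst (snd q))"]] that
    have D2': "((\<lambda>q. G (fst q) (fst (snd q)) w) has_derivative
        (\<lambda>a. coeff_deriv G (fst q) (fst a) (fst (snd q)) w + G (fst q) (fst (snd a)) w)) (at q)" for w
      by simp
    have "((\<lambda>q. G (fst q) (fst (snd q)) (snd (snd q))) has_derivative
      (\<lambda>a. \<DD> (\<lambda>q'. G (fst q') (fst (snd q')) (snd (snd q))) q a
        + G (fst q) (fst (snd q)) (snd (snd a)))) (at q)"
    proof (rule has_derivative_linear_family[where S = "?U \<times> UNIV" and L = "\<lambda>q w. G (fst q) (fst (snd q)) w"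
        and g = "\<lambda>q. snd (snd q)"])
      show "(\<lambda>q. G (fst q) (fst (snd q)) w) differentiable at q" for w
        using D2' differentiableI by blast
    qed (use that o lin in \<open>auto simp: mem_Times_iff intro!: open_Times has_derivative_snd has_derivative_ident\<close>)
    then show ?thesis
      by (rule has_derivative_eq_rhs) (simp add: frechet_derivative_at[OF D2', symmetric])
  qed
  have "((\<lambda>z. (k z, f z, g z)) has_derivative (\<lambda>a. (k' a, f' a, g' a))) (at z)"
    by (intro has_derivative_Pair k f g)
  from has_derivative_compose[OF this D3[of "(k z, f z, g z)"]] z show ?thesis
    by simp
qed

lemma smooth_on_coeffs:
  assumes G: "conn_coeffs nab c G" and S: "open S" "S \<subseteq> chart_image c"
    and f: "smooth_on S f" and g: "smooth_on S g"
  shows "smooth_on S (\<lambda>y. G y (f y) (g y))"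
proof -
  have 1: "smooth_on S (\<lambda>y. G y (f y) w)" for w
    by (rule smooth_on_linear_family[OF S(1) _ _ f, where L = "\<lambda>y u. G y u w"])
      (use S(2) conn_coeffsD(2)[OF G] in blast, rule smooth_on_subset[OF conn_coeffsD(3)[OF G] S(2)])
  show ?thesis
    by (rule smooth_on_linear_family[OF S(1) _ 1 g])
      (use S(2) conn_coeffsD(1)[OF G] in blast)
qed

text \<open>\<open>\<sigma>\<close> is a family of covectors over one chart, differentiable at
  \<open>x\<close>, rather than a global one-form: for second derivatives it is itself a covariant
  derivative. The derivative of the test field \<open>Y\<close> drops out of the product rule, so
  the result depends on \<open>Y x\<close> only and defines a covector.\<close>

lemma dual_connection_coords:
  assumes G: "conn_coeffs nab c G" and c: "c \<in> charts_at A x" and v: "v \<in> TM x"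
    and \<sigma>: "\<And>x. x \<in> chart_dom c \<Longrightarrow> \<sigma> x \<in> TsM x"
    and S: "((form_coords c \<sigma>) has_derivative S') (at (chart_map c x))"
  shows "dual_connection A nab x v \<sigma> \<in> TsM x"
    and "coords c x (dual_connection A nab x v \<sigma>) \<bullet> w =
      S' (v c) \<bullet> w - coords c x (\<sigma> x) \<bullet> G (chart_map c x) (v c) w"
proof -
  have cA: "c \<in> A" and x: "x \<in> chart_dom c" "x \<in> points A"
    using c by (auto simp: charts_at_iff points_iff)
  let ?l = "\<lambda>w. S' (v c) \<bullet> w - coords c x (\<sigma> x) \<bullet> G (chart_map c x) (v c) w"
  have lG: "linear (G (chart_map c x) (v c))"
    using conn_coeffsD(1)[OF G chart_map_in_image[OF x(1)]] .
  have lin: "linear ?l"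
    by (rule linearI) (simp_all add: linear_add[OF lG] linear_cmul[OF lG] inner_add_right algebra_simps)
  define q where "q = covec_of c x (riesz ?l)"
  have q: "q \<in> TsM x" "coords c x q = riesz ?l"
    unfolding q_def using covec_of_cotangent covec_coords_of[OF c] by blast+
  have qY: "q (Y x) = differential A (\<lambda>y. \<sigma> y (Y y)) x v - \<sigma> x (nab x v Y)"
    if Y: "Y \<in> VF" for Y
  proof -
    let ?Y = "vf_coords c Y"
    let ?s = "form_coords c \<sigma>"
    have "((\<lambda>y. ?s y \<bullet> ?Y y) has_derivative (\<lambda>a. ?s (chart_map c x) \<bullet> \<DD> ?Y (chart_map c x) a
        + S' a \<bullet> ?Y (chart_map c x))) (at (chart_map c x))"
      by (rule has_derivative_inner[OF S vector_field_has_derivative[OF Y c]])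
    then have "((\<lambda>y. \<sigma> y (Y y)) \<circ> chart_inv c has_derivative (\<lambda>a. ?s (chart_map c x) \<bullet> \<DD> ?Y (chart_map c x) a
        + S' a \<bullet> ?Y (chart_map c x))) (at (chart_map c x))"
    proof (rule has_derivative_transform_within_open[OF _ open_chart_image[OF cA] chart_map_in_image[OF x(1)]])
      fix y assume y: "y \<in> chart_image c"
      then show "?s y \<bullet> ?Y y = ((\<lambda>y. \<sigma> y (Y y)) \<circ> chart_inv c) y"
        using cotangent_apply[OF \<sigma> _ vector_field_tangent[OF Y], of "chart_inv c y" c] cA
        by (simp add: charts_at_iff chart_inv_in_dom)
    qed
    from differential_chart[OF c v this]
    have "differential A (\<lambda>y. \<sigma> y (Y y)) x v =
        coords c x (\<sigma> x) \<bullet> \<DD> ?Y (chart_map c x) (v c) + S' (v c) \<bullet> Y x c"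
      by (simp add: chart_inv_map[OF cA x(1)])
    moreover have "\<sigma> x (nab x v Y) = coords c x (\<sigma> x) \<bullet>
        (\<DD> ?Y (chart_map c x) (v c) + G (chart_map c x) (v c) (Y x c))"
      using cotangent_apply[OF \<sigma>[OF x(1)] c conn_coeffsD(4)[OF G x(1) v Y]] conn_coeffsD(5)[OF G x(1) v Y] by simp
    moreover have "q (Y x) = ?l (Y x c)"
      using cotangent_apply[OF q(1) c vector_field_tangent[OF Y]] q(2) riesz_inner[OF lin] by simp
    ultimately show ?thesis by (simp add: inner_add_right)
  qed
  have "dual_connection A nab x v \<sigma> = q"
    unfolding dual_connection_def
  proof (rule the_equality)
    fix q' assume q': "q' \<in> TsM x \<and> (\<forall>Y\<in>VF.
      q' (Y x) = differential A (\<lambda>y. \<sigma> y (Y y)) x v - \<sigma> x (nab x v Y))"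
    show "q' = q"
    proof
      fix w show "q' w = q w"
      proof (cases "w \<in> TM x")
        case True
        then obtain Y where "Y \<in> VF" "Y x = w" using vector_field_exists[OF x(2)] by blast
        with q' qY show ?thesis by metis
      next
        case False
        then show ?thesis using cotangent_outside q' q(1) by metis
      qed
    qed
  qed (use q qY in blast)
  then show "dual_connection A nab x v \<sigma> \<in> TsM x"
    and "coords c x (dual_connection A nab x v \<sigma>) \<bullet> w =
      S' (v c) \<bullet> w - coords c x (\<sigma> x) \<bullet> G (chart_map c x) (v c) w"
    using q riesz_inner[OF lin] by simp_all
qed

section \<open>Second covariant derivatives and curvature of one-forms\<close>

lemma one_form_cotangent: "\<beta> \<in> one_forms A \<Longrightarrow> \<beta> x \<in> TsM x"
  by (simp add: one_forms_def)

lemma one_form_smooth: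
  "\<beta> \<in> one_forms A \<Longrightarrow> c \<in> A \<Longrightarrow>
    smooth_on (chart_image c) (form_coords c \<beta>)"
  by (simp add: one_forms_def)

lemma dual_connection_one_form:
  assumes G: "conn_coeffs nab c G" and c: "c \<in> charts_at A x" and v: "v \<in> TM x"
    and \<beta>: "\<beta> \<in> one_forms A"
  shows "dual_connection A nab x v \<beta> \<in> TsM x"
    and "coords c x (dual_connection A nab x v \<beta>) \<bullet> w =
      \<DD> (form_coords c \<beta>) (chart_map c x) (v c) \<bullet> w
      - coords c x (\<beta> x) \<bullet> G (chart_map c x) (v c) w"
proof -
  have "chart_map c x \<in> chart_image c" "c \<in> A" using c by (auto simp: charts_at_iff chart_map_in_image)
  note d = dual_connection_coords[OF G c v one_form_cotangent[OF \<beta>] smooth_on_has_derivative[OF one_form_smooth[OF \<beta> this(2)] this(1)]]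
  show "dual_connection A nab x v \<beta> \<in> TsM x" by (rule d)
  show "coords c x (dual_connection A nab x v \<beta>) \<bullet> w =
      \<DD> (form_coords c \<beta>) (chart_map c x) (v c) \<bullet> w
      - coords c x (\<beta> x) \<bullet> G (chart_map c x) (v c) w" by (rule d)
qed

text \<open>The coordinates \<open>s\<close> of the inner covariant derivative are known through
  their inner products with fixed vectors. These products are differentiated explicitly in
  \<open>D1\<close> and through \<open>s\<close> in \<open>D2\<close>, and the two results are
  compared.\<close>

lemma dual_second_derivative_coords:
  assumes G: "conn_coeffs nab c G" and c: "c \<in> charts_at A x"
    and v: "v \<in> TM x" and Y: "Y \<in> VF" and \<beta>: "\<beta> \<in> one_forms A"
  defines "y0 \<equiv> chart_map c x"
    and "b \<equiv> \<lambda>y. coords c (chart_inv c y) (\<beta> (chart_inv c y))"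
    and "DY \<equiv> \<DD> (vf_coords c Y) (chart_map c x)"
    and "q \<equiv> dual_connection A nab x v (\<lambda>y. dual_connection A nab y (Y y) \<beta>)"
  shows "q \<in> TsM x"
    and "coords c x q \<bullet> e =
      \<DD> (\<lambda>y. \<DD> b y (Y x c)) y0 (v c) \<bullet> e
      + \<DD> b y0 (DY (v c)) \<bullet> e
      - (\<DD> b y0 (v c) \<bullet> G y0 (Y x c) e
        + b y0 \<bullet> (coeff_deriv G y0 (v c) (Y x c) e + G y0 (DY (v c)) e))
      - (\<DD> b y0 (Y x c) \<bullet> G y0 (v c) e - b y0 \<bullet> G y0 (Y x c) (G y0 (v c) e))"
      (is "_ = ?rhs")
proof -
  have cA: "c \<in> A" and x: "x \<in> chart_dom c" using c by (auto simp: charts_at_iff)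
  have y0: "y0 \<in> chart_image c" "chart_inv c y0 = x"
    using x cA by (simp_all add: y0_def chart_map_in_image chart_inv_map)
  let ?U = "chart_image c"
  let ?Y = "vf_coords c Y"
  have oU: "open ?U" using cA by (rule open_chart_image)
  have sb: "smooth_on ?U b" unfolding b_def using one_form_smooth[OF \<beta> cA] .
  have sY: "smooth_on ?U ?Y" using vector_field_smooth[OF Y cA] .
  let ?\<sigma> = "\<lambda>y. dual_connection A nab y (Y y) \<beta>"
  have \<sigma>: "?\<sigma> z \<in> TsM z" if "z \<in> chart_dom c" for z
    using dual_connection_one_form(1)[OF G _ vector_field_tangent[OF Y] \<beta>] that cA by (simp add: charts_at_iff)
  define s where "s y = coords c (chart_inv c y) (?\<sigma> (chart_inv c y))" for y
  have s: "s y \<bullet> e = \<DD> b y (?Y y) \<bullet> e - b y \<bullet> G y (?Y y) e" if y: "y \<in> ?U" for y e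
    using dual_connection_one_form(2)[OF G _ vector_field_tangent[OF Y] \<beta>, of "chart_inv c y" e] cA
      chart_inv_in_dom[OF y] chart_map_inv[OF y]
    by (simp add: charts_at_iff s_def b_def)
  have "smooth_on ?U (\<lambda>y. \<Sum>i\<in>Basis. (\<DD> b y (?Y y) \<bullet> i - b y \<bullet> G y (?Y y) i) *\<^sub>R i)"
    by (intro smooth_on_sum smooth_on_scaleR smooth_on_diff smooth_on_inner smooth_on_const oU finite_Basis
        smooth_on_derivative_field smooth_on_coeffs[OF G] sb sY order_refl)
  then have "smooth_on ?U s"
    by (rule smooth_on_cong[OF oU, rotated]) (simp add: s[symmetric] euclidean_representation)
  note Ds = smooth_on_has_derivative[OF this y0(1)]
  have Db: "(b has_derivative \<DD> b y0) (at y0)"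
    using smooth_on_has_derivative[OF sb y0(1)] .
  have DYd: "(?Y has_derivative DY) (at y0)"
    unfolding DY_def y0_def using vector_field_has_derivative[OF Y c] .
  have Ye: "?Y y0 = Y x c" using y0 by simp
  \<comment> \<open>The last argument \<open>e\<close> of \<open>G\<close> is constant below; its
    derivative contributes a term of this form.\<close>
  have lin0: "G y0 u 0 = 0" for u using linear_0[OF conn_coeffsD(1)[OF G y0(1)]] .
  have D1: "((\<lambda>y. \<DD> b y (?Y y) \<bullet> e - b y \<bullet> G y (?Y y) e) has_derivative
      (\<lambda>a. (\<DD> (\<lambda>y. \<DD> b y (?Y y0)) y0 a + \<DD> b y0 (DY a)) \<bullet> e
       - (b y0 \<bullet> (coeff_deriv G y0 a (?Y y0) e + G y0 (DY a) e + G y0 (?Y y0) 0)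
         + \<DD> b y0 a \<bullet> G y0 (?Y y0) e))) (at y0)" for e
    by (intro has_derivative_diff has_derivative_inner_left has_derivative_inner
        has_derivative_derivative_field[OF oU y0(1) sb DYd] Db
        has_derivative_coeffs[OF G cA y0(1) has_derivative_ident DYd has_derivative_const])
  have D2: "((\<lambda>y. \<DD> b y (?Y y) \<bullet> e - b y \<bullet> G y (?Y y) e) has_derivative
      (\<lambda>a. \<DD> s y0 a \<bullet> e)) (at y0)" for e
    by (rule has_derivative_transform_within_open[OF has_derivative_inner_left[OF Ds] oU y0(1)]) (rule s)
  have Ds': "\<DD> s y0 a \<bullet> e =
      (\<DD> (\<lambda>y. \<DD> b y (?Y y0)) y0 a + \<DD> b y0 (DY a)) \<bullet> e
       - (b y0 \<bullet> (coeff_deriv G y0 a (?Y y0) e + G y0 (DY a) e + G y0 (?Y y0) 0)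
         + \<DD> b y0 a \<bullet> G y0 (?Y y0) e)" for a e
    using fun_cong[OF has_derivative_unique[OF D2 D1]] .
  have "((form_coords c ?\<sigma>) has_derivative \<DD> s y0)
      (at (chart_map c x))"
    using Ds unfolding s_def[abs_def] y0_def .
  note d = dual_connection_coords[OF G c v \<sigma> this, folded y0_def]
  show "q \<in> TsM x" unfolding q_def by (rule d(1))
  show "coords c x q \<bullet> e =
      ?rhs"
    using d(2)[of e] Ds'[of "v c" e] s[OF y0(1), of "G y0 (v c) e"] lin0
    unfolding q_def by (simp add: s_def y0(2) inner_add_left inner_add_right)
qed

text \<open>In the commutator the second derivatives of \<open>\<beta>\<close> cancel by symmetry,
  and the derivatives of \<open>X\<close> and \<open>Y\<close> cancel against the bracket term. What
  remains depends on values at \<open>x\<close> only; it is the negative transpose of the curvature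
  on tangent vectors.\<close>

lemma dual_curvature_coords:
  assumes G: "conn_coeffs nab c G" and c: "c \<in> charts_at A x"
    and v: "v \<in> TM x" and w: "w \<in> TM x" and p: "p \<in> TsM x"
  defines "y0 \<equiv> chart_map c x"
  shows "dual_curvature A nab x v w p \<in> TsM x"
    and "coords c x (dual_curvature A nab x v w p) \<bullet> e = - coords c x p \<bullet>
      (coeff_deriv G y0 (v c) (w c) e - coeff_deriv G y0 (w c) (v c) e
        + G y0 (v c) (G y0 (w c) e) - G y0 (w c) (G y0 (v c) e))"
      (is "_ = ?R e")
proof -
  have cA: "c \<in> A" and x: "x \<in> chart_dom c" "x \<in> points A" using c by (auto simp: charts_at_iff points_iff)
  have y0: "y0 \<in> chart_image c" "chart_inv c y0 = x"
    using x cA by (simp_all add: y0_def chart_map_in_image chart_inv_map)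
  have oU: "open (chart_image c)" using cA by (rule open_chart_image)
  define r where "r X Y \<beta> = dual_connection A nab x (X x) (\<lambda>y. dual_connection A nab y (Y y) \<beta>)
        - dual_connection A nab x (Y x) (\<lambda>y. dual_connection A nab y (X y) \<beta>)
        - dual_connection A nab x (lie_bracket A X Y x) \<beta>" for X Y \<beta>
  have r: "r X Y \<beta> \<in> TsM x \<and> (\<forall>e. coords c x (r X Y \<beta>) \<bullet> e = ?R e)"
    if X: "X \<in> VF" "X x = v" and Y: "Y \<in> VF" "Y x = w"
      and \<beta>: "\<beta> \<in> one_forms A" "\<beta> x = p" for X Y \<beta>
  proof -
    define b where "b y = coords c (chart_inv c y) (\<beta> (chart_inv c y))" for y
    have sb: "smooth_on (chart_image c) b" unfolding b_def[abs_def] using one_form_smooth[OF \<beta>(1) cA] .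
    define Db where "Db = \<DD> b y0"
    have lDb: "linear Db" unfolding Db_def by (rule smooth_on_linear_derivative[OF sb y0(1)])
    have lG: "linear (\<lambda>u. G y0 u e)" for e by (rule conn_coeffsD(2)[OF G y0(1)])
    define DX where "DX = \<DD> (vf_coords c X) y0"
    define DY where "DY = \<DD> (vf_coords c Y) y0"
    have br: "lie_bracket A X Y x c = DY (v c) - DX (w c)"
      using c X Y by (simp add: lie_bracket_def DX_def DY_def y0_def)
    have bp: "b y0 = coords c x p" using y0 \<beta> by (simp add: b_def)
    note XY = dual_second_derivative_coords[OF G c vector_field_tangent[OF X(1)] Y(1) \<beta>(1), folded b_def y0_def Db_def DY_def,
        unfolded X(2) Y(2)]
    note YX = dual_second_derivative_coords[OF G c vector_field_tangent[OF Y(1)] X(1) \<beta>(1), folded b_def y0_def Db_def DX_def,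
        unfolded X(2) Y(2)]
    note L = dual_connection_one_form[OF G c lie_bracket_tangent[OF X(1) Y(1)] \<beta>(1), folded b_def y0_def Db_def]
    have sym: "\<DD> (\<lambda>y. \<DD> b y (w c)) y0 (v c) =
        \<DD> (\<lambda>y. \<DD> b y (v c)) y0 (w c)"
      by (rule smooth_on_derivative_commute[OF oU sb y0(1)])
    have "r X Y \<beta> \<in> TsM x"
      unfolding r_def X(2) Y(2) using XY(1) YX(1) L(1) by (intro cotangent_space_diff)
    moreover have "coords c x (r X Y \<beta>) \<bullet> e = ?R e" for e
      unfolding r_def X(2) Y(2) covec_coords_diff inner_diff_left XY(2) YX(2) L(2) br sym bp \<beta>(2)
      by (simp add: Db_def DX_def DY_def linear_diff[OF lDb[unfolded Db_def]] linear_diff[OF lG] inner_diff_left inner_diff_right inner_add_right)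
    ultimately show ?thesis by blast
  qed
  obtain X where X: "X \<in> VF" "X x = v" using vector_field_exists[OF x(2) v] .
  obtain Y where Y: "Y \<in> VF" "Y x = w" using vector_field_exists[OF x(2) w] .
  obtain \<beta> where \<beta>: "\<beta> \<in> one_forms A" "\<beta> x = p" using one_form_exists[OF x(2) p] .
  have "dual_curvature A nab x v w p = r X Y \<beta>"
    unfolding dual_curvature_def r_def[symmetric]
  proof (rule the_equality)
    show "\<forall>X'\<in>VF. \<forall>Y'\<in>VF. \<forall>\<beta>'\<in>one_forms A.
      X' x = v \<longrightarrow> Y' x = w \<longrightarrow> \<beta>' x = p \<longrightarrow> r X Y \<beta> = r X' Y' \<beta>'"
    proof (intro ballI impI)
      fix X' Y' \<beta>' assume "X' \<in> VF" "Y' \<in> VF" "\<beta>' \<in> one_forms A" "X' x = v" "Y' x = w" "\<beta>' x = p"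
      then have r': "r X' Y' \<beta>' \<in> TsM x \<and> (\<forall>e. coords c x (r X' Y' \<beta>') \<bullet> e = ?R e)"
        by (intro r)
      show "r X Y \<beta> = r X' Y' \<beta>'"
      proof (rule cotangent_space_eqI[OF _ _ c])
        show "coords c x (r X Y \<beta>) = coords c x (r X' Y' \<beta>')"
        proof (rule euclidean_eqI)
          fix i
          show "coords c x (r X Y \<beta>) \<bullet> i = coords c x (r X' Y' \<beta>') \<bullet> i"
            using conjunct2[OF r[OF X Y \<beta>], THEN spec, of i] conjunct2[OF r', THEN spec, of i] by (rule trans[OF _ sym])
        qed
      qed (use r[OF X Y \<beta>] r' in blast)+
    qed
  qed (use X Y \<beta> in blast)
  with r[OF X Y \<beta>] show "dual_curvature A nab x v w p \<in> TsM x"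
    and "coords c x (dual_curvature A nab x v w p) \<bullet> e = ?R e"
    by simp_all
qed

end

section \<open>The cotangent bundle\<close>

lemma linear_riesz_family:
  fixes L :: "'e::euclidean_space \<Rightarrow> 'e"
  shows "linear (\<lambda>e. riesz (\<lambda>b. e \<bullet> L b))"
  by (rule linearI) (simp_all add: riesz_def inner_add_left scaleR_add_left sum.distrib scaleR_sum_right)

lemma smooth_on_riesz:
  "open S \<Longrightarrow> (\<And>b. smooth_on S (\<lambda>z. f z b)) \<Longrightarrow> smooth_on S (\<lambda>z. riesz (f z))"
  unfolding riesz_def by (intro smooth_on_sum smooth_on_scaleR smooth_on_const finite_Basis)

lemma has_derivative_riesz:
  assumes "\<And>b. ((\<lambda>z. f z b) has_derivative f' b) F"
  shows "((\<lambda>z. riesz (f z)) has_derivative (\<lambda>a. riesz (\<lambda>b. f' b a))) F"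
  unfolding riesz_def by (intro has_derivative_sum has_derivative_scaleR_left assms)

lemma smooth_curve_cong:
  assumes "\<And>t. t \<in> I \<Longrightarrow> \<gamma> t = \<delta> t" "smooth_curve A I \<gamma>"
  shows "smooth_curve A I \<delta>"
  unfolding smooth_curve_def
proof (intro conjI ballI)
  show "\<delta> ` I \<subseteq> points A"
    using assms by (force simp: smooth_curve_def)
  fix c assume c: "c \<in> A"
  have eq: "{t \<in> I. \<delta> t \<in> chart_dom c} = {t \<in> I. \<gamma> t \<in> chart_dom c}"
    using assms(1) by auto
  show o: "open {t \<in> I. \<delta> t \<in> chart_dom c}"
    using assms(2) c by (simp add: eq smooth_curve_def)
  show "smooth_on {t \<in> I. \<delta> t \<in> chart_dom c} (chart_map c \<circ> \<delta>)"
    by (rule smooth_on_cong[OF o, of "chart_map c \<circ> \<gamma>"])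
      (use assms c in \<open>auto simp: eq smooth_curve_def\<close>)
qed

lemma (in atlas) pushforward_chart:
  assumes c: "c \<in> charts_at A x" and v: "v \<in> TM x"
    and F: "\<And>d. d \<in> charts_at B (F x) \<Longrightarrow> (chart_map d \<circ> F \<circ> chart_inv c has_derivative D d) (at (chart_map c x))"
    and d: "d \<in> charts_at B (F x)"
  shows "pushforward A B F x v d = D d (v c)"
proof -
  define c' where "c' = (SOME c. c \<in> charts_at A x)"
  have c': "c' \<in> charts_at A x"
    unfolding c'_def using c by (rule someI)
  have "\<DD> (chart_map d \<circ> F \<circ> chart_inv c') (chart_map c' x) = D d \<circ> transition_deriv c' c x"
    using frechet_derivative_at[OF has_derivative_change_chart[OF c' c F[OF d]]] by simp
  then show ?thesis
    using tangent_space_transition[OF v c' c] d by (simp add: pushforward_def c'_def[symmetric])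
qed

context atlas
begin

section \<open>The cotangent bundle as a manifold\<close>

abbreviation coatlas :: "('m \<times> ('m, 'e) covec, 'e \<times> 'e) chart set"
  where "coatlas \<equiv> cotangent_atlas A"

abbreviation cochart :: "('m, 'e) chart \<Rightarrow> ('m \<times> ('m, 'e) covec, 'e \<times> 'e) chart"
  where "cochart \<equiv> cotangent_chart A"

lemma cotangent_chart_dom: "(x, p) \<in> chart_dom (cochart c) \<longleftrightarrow> x \<in> chart_dom c \<and> p \<in> TsM x"
  by (simp add: cotangent_chart_def)

lemma cotangent_chart_map: "chart_map (cochart c) (x, p) = (chart_map c x, coords c x p)"
  by (simp add: cotangent_chart_def)

lemma cotangent_chart_inj:
  assumes "c \<in> A"
  shows "inj_on (chart_map (cochart c)) (chart_dom (cochart c))"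
proof (rule inj_onI)
  fix z z' assume z: "z \<in> chart_dom (cochart c)" "z' \<in> chart_dom (cochart c)" "chart_map (cochart c) z = chart_map (cochart c) z'"
  obtain x p x' p' where zz: "z = (x, p)" "z' = (x', p')" by fastforce
  have "x = x'"
    using z assms chart_inv_map by (metis Pair_inject cotangent_chart_dom cotangent_chart_map zz)
  moreover have "p = p'"
    using z assms cotangent_space_eqI[of p x p' c] \<open>x = x'\<close>
    by (simp add: zz cotangent_chart_dom cotangent_chart_map charts_at_iff)
  ultimately show "z = z'" by (simp add: zz)
qed

lemma cotangent_chart_image:
  assumes "c \<in> A"
  shows "chart_image (cochart c) = chart_image c \<times> UNIV"
proof
  show "chart_image (cochart c) \<subseteq> chart_image c \<times> UNIV"
    unfolding chart_image_def by (auto simp: cotangent_chart_dom cotangent_chart_map)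
  show "chart_image c \<times> UNIV \<subseteq> chart_image (cochart c)"
  proof clarify
    fix y e assume y: "y \<in> chart_image c"
    have "(chart_inv c y, covec_of c (chart_inv c y) e) \<in> chart_dom (cochart c)"
      using y by (simp add: cotangent_chart_dom chart_inv_in_dom covec_of_cotangent)
    from chart_map_in_image[OF this] show "(y, e) \<in> chart_image (cochart c)"
      using y assms by (simp add: cotangent_chart_map chart_map_inv covec_coords_of charts_at_iff chart_inv_in_dom)
  qed
qed

lemma cotangent_chart_inv:
  assumes "c \<in> A" "y \<in> chart_image c"
  shows "chart_inv (cochart c) (y, e) = (chart_inv c y, covec_of c (chart_inv c y) e)"
  unfolding chart_inv_def[of "cochart c"]
proof (rule inv_into_f_eq[OF cotangent_chart_inj[OF assms(1)]])
  show "(chart_inv c y, covec_of c (chart_inv c y) e) \<in> chart_dom (cochart c)"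
    using assms by (simp add: cotangent_chart_dom chart_inv_in_dom covec_of_cotangent)
  show "chart_map (cochart c) (chart_inv c y, covec_of c (chart_inv c y) e) = (y, e)"
    using assms by (simp add: cotangent_chart_map chart_map_inv covec_coords_of charts_at_iff chart_inv_in_dom)
qed

lemma charts_at_cotangent:
  "C \<in> charts_at coatlas (x, p) \<longleftrightarrow> p \<in> TsM x \<and> (\<exists>c\<in>charts_at A x. C = cochart c)"
  by (auto simp: charts_at_iff cotangent_atlas_def cotangent_chart_dom)

lemma cotangent_chart_overlap:
  assumes "c \<in> A" "d \<in> A"
  shows "overlap (cochart c) (cochart d) = overlap c d \<times> UNIV"
proof
  show "overlap (cochart c) (cochart d) \<subseteq> overlap c d \<times> UNIV"
    by (auto simp: overlap_def cotangent_chart_dom cotangent_chart_map)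
  show "overlap c d \<times> UNIV \<subseteq> overlap (cochart c) (cochart d)"
  proof clarify
    fix y e assume y: "y \<in> overlap c d"
    then have yc: "y \<in> chart_image c" "chart_inv c y \<in> chart_dom d" using assms by (auto simp: overlap_iff)
    have "(chart_inv c y, covec_of c (chart_inv c y) e) \<in> chart_dom (cochart c) \<inter> chart_dom (cochart d)"
      using yc by (simp add: cotangent_chart_dom chart_inv_in_dom covec_of_cotangent)
    from imageI[OF this, of "chart_map (cochart c)"] show "(y, e) \<in> overlap (cochart c) (cochart d)"
      using yc assms by (simp add: overlap_def cotangent_chart_map chart_map_inv covec_coords_of charts_at_iff chart_inv_in_dom)
  qed
qed

text \<open>In the fibre part the derivative of the opposite transition is taken at the image point,
  so smoothness follows by composition and without inverting a matrix.\<close>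

lemma smooth_cotangent_transition:
  assumes c: "c \<in> A" and d: "d \<in> A"
  shows "smooth_on (overlap c d \<times> UNIV) (transition (cochart c) (cochart d))"
proof -
  have oU: "open (overlap c d \<times> (UNIV::'e set))" by (intro open_Times open_overlap c d open_UNIV)
  have f: "smooth_on (overlap c d \<times> (UNIV::'e set)) (\<lambda>z. fst z)" by (intro smooth_on_fst smooth_on_ident oU)
  have "smooth_on (overlap c d \<times> UNIV) (\<lambda>z. (transition c d (fst z),
      riesz (\<lambda>b. snd z \<bullet> \<DD> (transition d c) (transition c d (fst z)) b)))"
  proof (intro smooth_on_Pair smooth_on_riesz smooth_on_inner smooth_on_snd smooth_on_ident oU)
    show s: "smooth_on (overlap c d \<times> (UNIV::'e set)) (\<lambda>z. transition c d (fst z))"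
      by (rule smooth_on_compose[OF oU open_overlap[OF c d] _ f smooth_transition[OF c d]]) auto
    show "smooth_on (overlap c d \<times> (UNIV::'e set)) (\<lambda>z. \<DD> (transition d c) (transition c d (fst z)) b)" for b
      by (rule smooth_on_compose[OF oU open_overlap[OF d c] _ s smooth_on_derivative[OF smooth_transition[OF d c]]])
        (use transition_in_overlap[OF c d] in auto)
  qed
  then show ?thesis
  proof (rule smooth_on_cong[OF oU, rotated])
    fix z :: "'e \<times> 'e" assume "z \<in> overlap c d \<times> UNIV"
    then obtain y e where z: "z = (y, e)" and y: "y \<in> chart_image c" "chart_inv c y \<in> chart_dom d"
      using c by (auto simp: overlap_iff)
    have cd: "c \<in> charts_at A (chart_inv c y)" "d \<in> charts_at A (chart_inv c y)"
      using c d y by (auto simp: charts_at_iff chart_inv_in_dom)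
    show "(transition c d (fst z),
      riesz (\<lambda>b. snd z \<bullet> \<DD> (transition d c) (transition c d (fst z)) b)) = transition (cochart c) (cochart d) z"
      using covec_coords_transition[OF covec_of_cotangent cd, of c e]
      by (simp add: z cotangent_chart_inv[OF c y(1)] cotangent_chart_map covec_coords_of[OF cd(1)])
  qed
qed

lemma smooth_atlas_cotangent: "smooth_atlas coatlas"
  unfolding smooth_atlas_def cotangent_atlas_def
proof (intro conjI ballI)
  fix C assume "C \<in> cochart ` A"
  then obtain c where c: "c \<in> A" "C = cochart c" by blast
  show "inj_on (chart_map C) (chart_dom C)" using c cotangent_chart_inj by simp
  show "open (chart_image C)" using c by (simp add: cotangent_chart_image open_Times open_chart_image)
  fix D assume "D \<in> cochart ` A"
  then obtain d where d: "d \<in> A" "D = cochart d" by blast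
  show "open (chart_map C ` (chart_dom C \<inter> chart_dom D))"
    using cotangent_chart_overlap[OF c(1) d(1)] c d by (simp add: overlap_def[symmetric] open_Times open_overlap)
  show "smooth_on (chart_map C ` (chart_dom C \<inter> chart_dom D)) (chart_map D \<circ> chart_inv C)"
    using smooth_cotangent_transition[OF c(1) d(1)] cotangent_chart_overlap[OF c(1) d(1)] c d
    by (simp add: overlap_def[symmetric])
qed

lemma atlas_cotangent: "atlas coatlas"
  by (rule atlas.intro[OF smooth_atlas_cotangent])

lemma cochart_charts_at: "c \<in> charts_at A x \<Longrightarrow> p \<in> TsM x \<Longrightarrow> cochart c \<in> charts_at coatlas (x, p)"
  by (auto simp: charts_at_cotangent)

section \<open>Vertical lifts and the bundle projection\<close>

lemma vertical_lift_coords: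
  assumes c: "c \<in> charts_at A x" and p: "p \<in> TsM x" and \<alpha>: "\<alpha> \<in> TsM x"
  shows "vertical_lift A x p \<alpha> \<in> tangent_space coatlas (x, p)"
    and "vertical_lift A x p \<alpha> (cochart c) = (0, coords c x \<alpha>)"
proof -
  interpret ct: atlas coatlas by (rule atlas_cotangent)
  have cA: "c \<in> A" and x: "x \<in> chart_dom c" using c by (auto simp: charts_at_iff)
  let ?u = "\<lambda>t::real. (chart_map c x, coords c x p + t *\<^sub>R coords c x \<alpha>)"
  have "smooth_curve coatlas UNIV (\<lambda>t. chart_inv (cochart c) (?u t))"
    using cA x by (intro ct.smooth_curveI_chart smooth_on_Pair smooth_on_add smooth_on_scaleR smooth_on_const smooth_on_ident)
      (auto simp: cotangent_atlas_def cotangent_chart_image chart_map_in_image)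
  moreover have "chart_inv (cochart c) (?u t) = (x, p + t *\<^sub>R \<alpha>)" for t
    using covec_of_coords[OF cotangent_space_add[OF p cotangent_space_scaleR[OF \<alpha>]] c, of t]
    by (simp add: cotangent_chart_inv[OF cA chart_map_in_image[OF x]] chart_inv_map[OF cA x] covec_coords_add covec_coords_scaleR)
  ultimately have sc: "smooth_curve coatlas UNIV (\<lambda>t. (x, p + t *\<^sub>R \<alpha>))" by simp
  show "vertical_lift A x p \<alpha> \<in> tangent_space coatlas (x, p)"
    using ct.velocity_tangent[OF sc, of 0] by (simp add: vertical_lift_def)
  have "(chart_map (cochart c) \<circ> (\<lambda>t. (x, p + t *\<^sub>R \<alpha>)) has_vector_derivative vertical_lift A x p \<alpha> (cochart c)) (at 0)"
    using ct.smooth_curve_has_vector_derivative[OF sc, of 0] cochart_charts_at[OF c p] by (simp add: vertical_lift_def)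
  moreover have "(chart_map (cochart c) \<circ> (\<lambda>t. (x, p + t *\<^sub>R \<alpha>)) has_vector_derivative (0, coords c x \<alpha>)) (at 0)"
    by (auto simp: o_def cotangent_chart_map covec_coords_add covec_coords_scaleR intro!: derivative_eq_intros)
  ultimately show "vertical_lift A x p \<alpha> (cochart c) = (0, coords c x \<alpha>)"
    using vector_derivative_unique_at by blast
qed

lemma pushforward_fst:
  assumes c: "c \<in> charts_at A x" and p: "p \<in> TsM x" and w: "w \<in> tangent_space coatlas (x, p)"
  shows "pushforward coatlas A fst (x, p) w = coord_vec A c x (fst (w (cochart c)))"
proof
  fix d
  interpret ct: atlas coatlas by (rule atlas_cotangent)
  have cA: "c \<in> A" and x: "x \<in> chart_dom c" using c by (auto simp: charts_at_iff)
  show "pushforward coatlas A fst (x, p) w d = coord_vec A c x (fst (w (cochart c))) d"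
  proof (cases "d \<in> charts_at A x")
    case True
    have "pushforward coatlas A fst (x, p) w d = transition_deriv c d x (fst (w (cochart c)))"
    proof (rule ct.pushforward_chart[OF cochart_charts_at[OF c p] w])
      fix d assume d: "d \<in> charts_at A (fst (x, p))"
      have 1: "(fst has_derivative fst) (at (chart_map c x, coords c x p))"
        by (intro has_derivative_fst has_derivative_ident)
      have "(transition c d has_derivative transition_deriv c d x) (at (fst (chart_map c x, coords c x p)))"
        using transition_has_derivative[OF c] d by simp
      from diff_chain_at[OF 1 this]
      have "(transition c d \<circ> fst has_derivative (\<lambda>a. transition_deriv c d x (fst a))) (at (chart_map (cochart c) (x, p)))"
        by (simp add: cotangent_chart_map o_def)
      then show "(chart_map d \<circ> fst \<circ> chart_inv (cochart c) has_derivative (\<lambda>a. transition_deriv c d x (fst a))) (at (chart_map (cochart c) (x, p)))"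
        by (rule has_derivative_transform_within_open[of _ _ _ _ "chart_image c \<times> UNIV"])
          (use cA x in \<open>auto simp: open_Times open_chart_image cotangent_chart_map chart_map_in_image cotangent_chart_inv\<close>)
    qed (use True in simp)
    with True show ?thesis by (simp add: coord_vec_def)
  qed (simp add: pushforward_def coord_vec_def Let_def)
qed

end

section \<open>The parallel transport equation in coordinates\<close>

context hausdorff_atlas
begin

text \<open>\<open>parallel_along\<close> is tested by global fields. A field with coordinates
  \<open>b\<close> at \<open>\<gamma> t\<close> yields the component of the equation along
  \<open>b\<close>; the derivative of that field cancels.\<close>

lemma parallel_along_coords:
  assumes G: "conn_coeffs nab c G" and par: "parallel_along A nab I \<gamma> q" and t: "t \<in> I" and c: "c \<in> charts_at A (\<gamma> t)"
  shows "(chart_map c \<circ> \<gamma> has_vector_derivative velocity A \<gamma> t c) (at t)"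
    and "((\<lambda>s. coords c (\<gamma> s) (q s)) has_vector_derivative
      riesz (\<lambda>b. coords c (\<gamma> t) (q t) \<bullet> G (chart_map c (\<gamma> t)) (velocity A \<gamma> t c) b)) (at t)"
proof -
  interpret ct: atlas coatlas by (rule atlas_cotangent)
  have cA: "c \<in> A" and x: "\<gamma> t \<in> chart_dom c" "\<gamma> t \<in> points A" using c by (auto simp: charts_at_iff points_iff)
  have sc: "smooth_curve A I \<gamma>" and q: "\<And>s. s \<in> I \<Longrightarrow> q s \<in> TsM (\<gamma> s)"
    and sq: "smooth_curve coatlas I (\<lambda>t. (\<gamma> t, q t))"
    and pY: "\<And>Y. Y \<in> VF \<Longrightarrow>
      ((\<lambda>s. q s (Y (\<gamma> s))) has_real_derivative q t (nab (\<gamma> t) (velocity A \<gamma> t) Y)) (at t)"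
    using par t by (auto simp: parallel_along_def)
  show g: "(chart_map c \<circ> \<gamma> has_vector_derivative velocity A \<gamma> t c) (at t)"
    by (rule smooth_curve_has_vector_derivative[OF sc t c])
  have v: "velocity A \<gamma> t \<in> TM (\<gamma> t)"
    by (rule velocity_tangent[OF sc t])
  let ?e = "\<lambda>s. coords c (\<gamma> s) (q s)"
  let ?w = "velocity coatlas (\<lambda>t. (\<gamma> t, q t)) t (cochart c)"
  have "((\<lambda>s. (chart_map c (\<gamma> s), ?e s)) has_vector_derivative ?w) (at t)"
    using ct.smooth_curve_has_vector_derivative[OF sq t cochart_charts_at[OF c q[OF t]]]
    by (simp add: o_def cotangent_chart_map)
  from bounded_linear.has_vector_derivative[OF bounded_linear_snd this]
  have e: "(?e has_vector_derivative snd ?w) (at t)" by simp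
  have wb: "snd ?w \<bullet> b = ?e t \<bullet> G (chart_map c (\<gamma> t)) (velocity A \<gamma> t c) b" for b
  proof -
    obtain Y where Y: "Y \<in> VF" "Y (\<gamma> t) = coord_vec A c (\<gamma> t) b"
      using vector_field_exists[OF x(2) coord_vec_tangent[OF c]] by blast
    let ?Y = "vf_coords c Y"
    let ?DY = "\<DD> ?Y (chart_map c (\<gamma> t))"
    have "((\<lambda>s. ?Y ((chart_map c \<circ> \<gamma>) s)) has_vector_derivative ?DY (velocity A \<gamma> t c)) (at t)"
      using vector_derivative_diff_chain_within[OF g, of ?Y ?DY]
        has_derivative_at_withinI[OF vector_field_has_derivative[OF Y(1) c]] by (simp add: o_def)
    from bounded_bilinear.has_vector_derivative[OF bounded_bilinear_inner e this]
    have 1: "((\<lambda>s. ?e s \<bullet> ?Y (chart_map c (\<gamma> s))) has_real_derivative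
        ?e t \<bullet> ?DY (velocity A \<gamma> t c) + snd ?w \<bullet> ?Y (chart_map c (\<gamma> t))) (at t)"
      by (simp add: has_real_derivative_iff_has_vector_derivative)
    have "((\<lambda>s. q s (Y (\<gamma> s))) has_real_derivative
        ?e t \<bullet> ?DY (velocity A \<gamma> t c) + snd ?w \<bullet> ?Y (chart_map c (\<gamma> t))) (at t)"
    proof (rule has_field_derivative_transform_within_open[OF 1])
      show "open {s \<in> I. \<gamma> s \<in> chart_dom c}" using sc cA by (simp add: smooth_curve_def)
      show "t \<in> {s \<in> I. \<gamma> s \<in> chart_dom c}" using t x by simp
      fix s assume s: "s \<in> {s \<in> I. \<gamma> s \<in> chart_dom c}"
      then show "?e s \<bullet> ?Y (chart_map c (\<gamma> s)) = q s (Y (\<gamma> s))"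
        using cotangent_apply[OF q _ vector_field_tangent[OF Y(1)], of s c] cA
        by (simp add: charts_at_iff chart_inv_map)
    qed
    from DERIV_unique[OF pY[OF Y(1)] this]
    have "q t (nab (\<gamma> t) (velocity A \<gamma> t) Y) = ?e t \<bullet> ?DY (velocity A \<gamma> t c) + snd ?w \<bullet> b"
      by (simp add: chart_inv_map[OF cA x(1)] Y(2) coord_vec_self[OF c])
    moreover have "q t (nab (\<gamma> t) (velocity A \<gamma> t) Y) = ?e t \<bullet> (?DY (velocity A \<gamma> t c) + G (chart_map c (\<gamma> t)) (velocity A \<gamma> t c) b)"
      using cotangent_apply[OF q[OF t] c conn_coeffsD(4)[OF G x(1) v Y(1)]] conn_coeffsD(5)[OF G x(1) v Y(1)]
      by (simp add: Y(2) coord_vec_self[OF c])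
    ultimately show ?thesis by (simp add: inner_add_right)
  qed
  have "snd ?w = riesz (\<lambda>b. snd ?w \<bullet> b)"
    by (rule riesz_inner_left[symmetric])
  also have "\<dots> = riesz (\<lambda>b. ?e t \<bullet> G (chart_map c (\<gamma> t)) (velocity A \<gamma> t c) b)"
    by (simp only: wb)
  finally have "snd ?w = riesz (\<lambda>b. ?e t \<bullet> G (chart_map c (\<gamma> t)) (velocity A \<gamma> t c) b)" .
  with e show "(?e has_vector_derivative riesz (\<lambda>b. ?e t \<bullet> G (chart_map c (\<gamma> t)) (velocity A \<gamma> t c) b)) (at t)"
    by simp
qed

text \<open>The converse of \<open>parallel_along_coords\<close> inside one chart: it turns
  solutions of the coordinate equation into parallel fields.\<close>

lemma parallel_alongI_coords:
  assumes G: "conn_coeffs nab c G" and c: "c \<in> A" and I: "open I"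
    and u: "smooth_on I u" "u ` I \<subseteq> chart_image c" and e: "smooth_on I e"
    and u': "\<And>t. t \<in> I \<Longrightarrow> (u has_vector_derivative u' t) (at t)"
    and e': "\<And>t. t \<in> I \<Longrightarrow> (e has_vector_derivative riesz (\<lambda>b. e t \<bullet> G (u t) (u' t) b)) (at t)"
  shows "parallel_along A nab I (\<lambda>t. chart_inv c (u t)) (\<lambda>t. covec_of c (chart_inv c (u t)) (e t))"
proof -
  interpret ct: atlas coatlas by (rule atlas_cotangent)
  let ?\<gamma> = "\<lambda>t. chart_inv c (u t)" and ?q = "\<lambda>t. covec_of c (chart_inv c (u t)) (e t)"
  have sc: "smooth_curve A I ?\<gamma>" by (rule smooth_curveI_chart[OF c I u])
  have "smooth_curve coatlas I (\<lambda>t. chart_inv (cochart c) (u t, e t))"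
    using c u by (intro ct.smooth_curveI_chart smooth_on_Pair u e I)
      (auto simp: cotangent_atlas_def cotangent_chart_image)
  then have sq: "smooth_curve coatlas I (\<lambda>t. (?\<gamma> t, ?q t))"
    by (rule smooth_curve_cong[rotated]) (use c u(2) in \<open>auto simp: cotangent_chart_inv\<close>)
  have "((\<lambda>s. ?q s (Y (?\<gamma> s))) has_real_derivative ?q t (nab (?\<gamma> t) (velocity A ?\<gamma> t) Y)) (at t)"
    if t: "t \<in> I" and Y: "Y \<in> VF" for t Y
  proof -
    have xt: "c \<in> charts_at A (?\<gamma> t)" "?\<gamma> t \<in> chart_dom c" "u t \<in> chart_image c"
      using t u(2) c by (auto simp: charts_at_iff chart_inv_in_dom)
    let ?Y = "vf_coords c Y"
    let ?DY = "\<DD> ?Y (u t)"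
    have "(chart_map c \<circ> ?\<gamma> has_vector_derivative u' t) (at t)"
      by (rule has_vector_derivative_transform_within_open[OF u'[OF t] I t])
        (use u(2) in \<open>auto simp: chart_map_inv\<close>)
    then have vc: "velocity A ?\<gamma> t c = u' t"
      using smooth_curve_has_vector_derivative[OF sc t xt(1)] vector_derivative_unique_at by blast
    have v: "velocity A ?\<gamma> t \<in> TM (?\<gamma> t)" by (rule velocity_tangent[OF sc t])
    have "(?Y has_derivative ?DY) (at (u t))"
      using vector_field_has_derivative[OF Y xt(1)] by (simp add: chart_map_inv[OF xt(3)])
    then have "((\<lambda>s. ?Y (u s)) has_vector_derivative ?DY (u' t)) (at t)"
      using vector_derivative_diff_chain_within[OF u'[OF t], of ?Y ?DY] has_derivative_at_withinI by (fastforce simp: o_def)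
    from bounded_bilinear.has_vector_derivative[OF bounded_bilinear_inner e'[OF t] this]
    have "((\<lambda>s. e s \<bullet> ?Y (u s)) has_real_derivative
        e t \<bullet> ?DY (u' t) + riesz (\<lambda>b. e t \<bullet> G (u t) (u' t) b) \<bullet> ?Y (u t)) (at t)"
      by (simp add: has_real_derivative_iff_has_vector_derivative)
    then have D: "((\<lambda>s. ?q s (Y (?\<gamma> s))) has_real_derivative
        e t \<bullet> ?DY (u' t) + riesz (\<lambda>b. e t \<bullet> G (u t) (u' t) b) \<bullet> ?Y (u t)) (at t)"
      by (rule has_field_derivative_transform_within_open[OF _ I t])
        (simp add: covec_of_def vector_field_tangent[OF Y])
    have lin: "linear (\<lambda>b. e t \<bullet> G (u t) (u' t) b)"
      using linear_compose[OF conn_coeffsD(1)[OF G xt(3)] bounded_linear.linear[OF bounded_linear_inner_right]] by (simp add: o_def)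
    have "?q t (nab (?\<gamma> t) (velocity A ?\<gamma> t) Y) = e t \<bullet> nab (?\<gamma> t) (velocity A ?\<gamma> t) Y c"
      using conn_coeffsD(4)[OF G xt(2) v Y] by (simp add: covec_of_def)
    also have "\<dots> = e t \<bullet> ?DY (u' t) + e t \<bullet> G (u t) (u' t) (?Y (u t))"
      using conn_coeffsD(5)[OF G xt(2) v Y] by (simp add: vc chart_map_inv[OF xt(3)] inner_add_right)
    finally show ?thesis
      using D riesz_inner[OF lin] by simp
  qed
  then show ?thesis
    using sc sq covec_of_cotangent by (simp add: parallel_along_def)
qed

end

section \<open>Horizontal lifts\<close>

text \<open>In contrast to \<open>riesz_inner\<close>, linearity of \<open>f\<close> is not assumed;
  the final bracket computations compare components on \<open>Basis\<close> by it.\<close>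

lemma riesz_Basis: "b \<in> Basis \<Longrightarrow> riesz f \<bullet> b = f b"
  by (simp add: riesz_def inner_sum_left inner_Basis if_distrib sum.delta cong: if_cong)

context hausdorff_atlas
begin

lemma linear_inner_coeffs:
  assumes "conn_coeffs nab c G" "y \<in> chart_image c"
  shows "linear (\<lambda>b. e \<bullet> G y v b)" "linear (\<lambda>b. e \<bullet> G y b v)"
  using linear_compose[OF conn_coeffsD(1)[OF assms] bounded_linear.linear[OF bounded_linear_inner_right]]
    linear_compose[OF conn_coeffsD(2)[OF assms] bounded_linear.linear[OF bounded_linear_inner_right]]
  by (simp_all add: o_def)

text \<open>Over the straight coordinate line with velocity \<open>v c\<close> the transport
  equation is linear in the covector, so \<open>linear_ode\<close> solves it. The resulting curve is
  the witness that \<open>horizontal_lift\<close> asks for.\<close>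

lemma parallel_curve_exists:
  assumes G: "conn_coeffs nab c G" and c: "c \<in> charts_at A x"
    and p: "p \<in> TsM x" and v: "v \<in> TM x"
  obtains a \<gamma> q where "a > 0" "parallel_along A nab {-a<..<a} \<gamma> q" "\<gamma> 0 = x" "q 0 = p" "velocity A \<gamma> 0 = v"
proof -
  have cA: "c \<in> A" and x: "x \<in> chart_dom c" using c by (auto simp: charts_at_iff)
  define u where "u t = chart_map c x + t *\<^sub>R v c" for t
  have u_smooth: "smooth_on I u" if "open I" for I
    unfolding u_def using that by (intro smooth_on_add smooth_on_scaleR smooth_on_const smooth_on_ident)
  have u': "(u has_vector_derivative v c) (at t)" for t
    unfolding u_def by (auto intro!: derivative_eq_intros)
  have "open (u -` chart_image c)"
    using smooth_on_continuous[OF u_smooth[OF open_UNIV]] open_chart_image[OF cA]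
    by (simp add: continuous_on_open_vimage)
  moreover have "0 \<in> u -` chart_image c" using x by (simp add: u_def chart_map_in_image)
  ultimately obtain a0 where a0: "a0 > 0" "ball 0 a0 \<subseteq> u -` chart_image c"
    using open_contains_ball_eq by blast
  have sub: "u t \<in> chart_image c" if "t \<in> {-a0<..<a0}" for t
    using a0(2) that by (auto simp: subset_iff dist_real_def)
  have "smooth_on {-a0<..<a0} (\<lambda>t. riesz (\<lambda>b. e \<bullet> G (u t) (v c) b))" for e
    using sub by (intro smooth_on_riesz smooth_on_inner smooth_on_const open_greaterThanLessThan
        smooth_on_compose[OF _ open_chart_image[OF cA] _ u_smooth conn_coeffsD(3)[OF G]]) auto
  from linear_ode[OF a0(1) linear_riesz_family this, of "coords c x p"]
  obtain a e where a: "0 < a" "a \<le> a0" and e: "smooth_on {-a<..<a} e" "e 0 = coords c x p"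
    "\<And>t. t \<in> {-a<..<a} \<Longrightarrow> (e has_vector_derivative riesz (\<lambda>b. e t \<bullet> G (u t) (v c) b)) (at t)" by blast
  have "u ` {-a<..<a} \<subseteq> chart_image c" using sub a by auto
  from parallel_alongI_coords[OF G cA open_greaterThanLessThan u_smooth[OF open_greaterThanLessThan] this e(1) u' e(3)]
  have par: "parallel_along A nab {-a<..<a} (\<lambda>t. chart_inv c (u t)) (\<lambda>t. covec_of c (chart_inv c (u t)) (e t))" .
  have x0: "chart_inv c (u 0) = x" by (simp add: u_def chart_inv_map[OF cA x])
  let ?v = "velocity A (\<lambda>t. chart_inv c (u t)) 0"
  have sc: "smooth_curve A {-a<..<a} (\<lambda>t. chart_inv c (u t))" using par by (simp add: parallel_along_def)
  have 0: "0 \<in> {-a<..<a}" using a by simp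
  have "(chart_map c \<circ> (\<lambda>t. chart_inv c (u t)) has_vector_derivative ?v c) (at 0)"
    using smooth_curve_has_vector_derivative[OF sc 0] c x0 by simp
  moreover have "(chart_map c \<circ> (\<lambda>t. chart_inv c (u t)) has_vector_derivative v c) (at 0)"
    by (rule has_vector_derivative_transform_within_open[OF u' open_greaterThanLessThan 0])
      (use sub a in \<open>auto simp: chart_map_inv\<close>)
  ultimately have "?v c = v c" using vector_derivative_unique_at by blast
  then have "?v = v"
    using tangent_space_eqI[OF _ v c] velocity_tangent[OF sc 0] x0 by simp
  with that[OF a(1) par x0 _] show ?thesis
    using covec_of_coords[OF p c] e(2) x0 by simp
qed

text \<open>The transport equation expresses the velocity of a parallel curve through
  \<open>(x, p)\<close> by its base velocity, so all curves with base velocity \<open>v\<close> give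
  the same vector; \<open>parallel_curve_exists\<close> supplies one.\<close>

lemma horizontal_lift_coords:
  assumes G: "conn_coeffs nab c G" and c: "c \<in> charts_at A x"
    and p: "p \<in> TsM x" and v: "v \<in> TM x"
  shows "horizontal_lift A nab x p v \<in> tangent_space coatlas (x, p)"
    and "horizontal_lift A nab x p v (cochart c) =
      (v c, riesz (\<lambda>b. coords c x p \<bullet> G (chart_map c x) (v c) b))"
proof -
  interpret ct: atlas coatlas by (rule atlas_cotangent)
  let ?P = "\<lambda>w. w \<in> tangent_space (cotangent_atlas A) (x, p) \<and>
    pushforward (cotangent_atlas A) A fst (x, p) w = v \<and>
    (\<exists>I \<gamma> q. open I \<and> is_interval I \<and> 0 \<in> I \<and> parallel_along A nab I \<gamma> q \<and>
      \<gamma> 0 = x \<and> q 0 = p \<and> velocity (cotangent_atlas A) (\<lambda>t. (\<gamma> t, q t)) 0 = w)"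
  let ?w = "(v c, riesz (\<lambda>b. coords c x p \<bullet> G (chart_map c x) (v c) b))"
  have vel: "velocity coatlas (\<lambda>t. (\<gamma> t, q t)) 0 \<in> tangent_space coatlas (x, p) \<and>
      velocity coatlas (\<lambda>t. (\<gamma> t, q t)) 0 (cochart c) =
        (velocity A \<gamma> 0 c, riesz (\<lambda>b. coords c x p \<bullet> G (chart_map c x) (velocity A \<gamma> 0 c) b))"
    if "0 \<in> I" "parallel_along A nab I \<gamma> q" "\<gamma> 0 = x" "q 0 = p" for I \<gamma> q
  proof -
    have sq: "smooth_curve coatlas I (\<lambda>t. (\<gamma> t, q t))" using that by (simp add: parallel_along_def)
    have "(chart_map (cochart c) \<circ> (\<lambda>t. (\<gamma> t, q t)) has_vector_derivative velocity coatlas (\<lambda>t. (\<gamma> t, q t)) 0 (cochart c)) (at 0)"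
      using ct.smooth_curve_has_vector_derivative[OF sq that(1)] cochart_charts_at[OF c p] that by simp
    moreover have "(chart_map (cochart c) \<circ> (\<lambda>t. (\<gamma> t, q t)) has_vector_derivative
        (velocity A \<gamma> 0 c, riesz (\<lambda>b. coords c x p \<bullet> G (chart_map c x) (velocity A \<gamma> 0 c) b))) (at 0)"
      using has_vector_derivative_Pair[OF parallel_along_coords[OF G that(2,1)]] c that
      by (simp add: o_def cotangent_chart_map)
    ultimately show ?thesis
      using vector_derivative_unique_at ct.velocity_tangent[OF sq that(1)] that by fastforce
  qed
  obtain a \<gamma> q where a: "a > 0" and par: "parallel_along A nab {-a<..<a} \<gamma> q" and 0: "\<gamma> 0 = x" "q 0 = p"
    and vv: "velocity A \<gamma> 0 = v"
    using parallel_curve_exists[OF assms] .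
  have a0: "0 \<in> {-a<..<a}" using a by simp
  define w where "w = velocity coatlas (\<lambda>t. (\<gamma> t, q t)) 0"
  have w: "w \<in> tangent_space coatlas (x, p)" "w (cochart c) = ?w"
    using vel[OF a0 par 0] by (simp_all add: w_def vv)
  have "?P w"
  proof (intro conjI exI)
    show "pushforward (cotangent_atlas A) A fst (x, p) w = v"
      using pushforward_fst[OF c p w(1)] coord_vec_of_tangent[OF v c] w(2) by simp
    show "velocity (cotangent_atlas A) (\<lambda>t. (\<gamma> t, q t)) 0 = w" by (simp add: w_def)
    show "is_interval {-a<..<a}" by (simp add: is_interval_oo)
  qed (use w par 0 a0 in auto)
  moreover have "w' = w" if P: "?P w'" for w'
  proof -
    obtain I \<gamma>' q' where *: "0 \<in> I" "parallel_along A nab I \<gamma>' q'" "\<gamma>' 0 = x" "q' 0 = p"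
      and w': "velocity coatlas (\<lambda>t. (\<gamma>' t, q' t)) 0 = w'" using P by blast
    note v' = vel[OF *, unfolded w']
    have "velocity A \<gamma>' 0 c = v c"
      using pushforward_fst[OF c p conjunct1[OF P]] P v' coord_vec_self[OF c] by (metis fst_conv)
    then have "w' (cochart c) = ?w" using v' by simp
    then show "w' = w"
      using ct.tangent_space_eqI[OF _ w(1) cochart_charts_at[OF c p]] v' w(2) by simp
  qed
  ultimately have "horizontal_lift A nab x p v = w"
    unfolding horizontal_lift_def by (rule the_equality)
  with w show "horizontal_lift A nab x p v \<in> tangent_space coatlas (x, p)"
    and "horizontal_lift A nab x p v (cochart c) = ?w" by simp_all
qed

lemma torsion_form_coords:
  assumes G: "conn_coeffs nab c G" and c: "c \<in> charts_at A x"
    and p: "p \<in> TsM x" and v: "v \<in> TM x"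
  shows "torsion_form A nab x v p \<in> TsM x"
    and "coords c x (torsion_form A nab x v p) =
      riesz (\<lambda>b. coords c x p \<bullet> G (chart_map c x) (v c) b)
      - riesz (\<lambda>b. coords c x p \<bullet> G (chart_map c x) b (v c))"
proof -
  let ?e = "riesz (\<lambda>b. coords c x p \<bullet> G (chart_map c x) (v c) b)
      - riesz (\<lambda>b. coords c x p \<bullet> G (chart_map c x) b (v c))"
  have y: "chart_map c x \<in> chart_image c" using c by (simp add: charts_at_iff chart_map_in_image)
  have "torsion_form A nab x v p = covec_of c x ?e"
  proof
    fix w
    show "torsion_form A nab x v p w = covec_of c x ?e w"
      using cotangent_apply[OF p c torsion_coords(1)[OF G c v]] torsion_coords(2)[OF G c v]
        riesz_inner[OF linear_inner_coeffs(1)[OF G y]] riesz_inner[OF linear_inner_coeffs(2)[OF G y]]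
      by (simp add: torsion_form_def covec_of_def inner_diff_left inner_diff_right)
  qed
  then show "torsion_form A nab x v p \<in> TsM x" "coords c x (torsion_form A nab x v p) = ?e"
    using covec_of_cotangent covec_coords_of[OF c] by simp_all
qed

end

section \<open>Hamiltonians in canonical coordinates\<close>

text \<open>The momentum gradient, which is \<open>H'\<close> in canonical coordinates.\<close>

definition fibre_grad :: "('e::euclidean_space \<times> 'e \<Rightarrow> real) \<Rightarrow> 'e \<times> 'e \<Rightarrow> 'e"
  where "fibre_grad h z = riesz (\<lambda>b. \<DD> h z (0, b))"

context
  fixes h :: "'e::euclidean_space \<times> 'e \<Rightarrow> real" and S
  assumes S: "open S" and h: "smooth_on S h"
begin

lemma fibre_grad_inner: "z \<in> S \<Longrightarrow> fibre_grad h z \<bullet> a = \<DD> h z (0, a)"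
  using riesz_inner[OF linear_compose[OF _ smooth_on_linear_derivative[OF h]], of "\<lambda>b. (0, b)"]
  by (simp add: fibre_grad_def o_def linear_iff)

lemma smooth_fibre_grad: "smooth_on S (fibre_grad h)"
  unfolding fibre_grad_def[abs_def] by (intro smooth_on_riesz smooth_on_derivative S h)

lemma fibre_grad_derivative_inner:
  assumes z: "z \<in> S"
  shows "\<DD> (fibre_grad h) z \<zeta> \<bullet> a =
    \<DD> (\<lambda>z. \<DD> h z (0, a)) z \<zeta>"
proof -
  have "((\<lambda>z. \<DD> h z (0, a)) has_derivative
      (\<lambda>\<zeta>. \<DD> (fibre_grad h) z \<zeta> \<bullet> a)) (at z)"
    by (rule has_derivative_transform_within_open[OF has_derivative_inner_left[OF
          smooth_on_has_derivative[OF smooth_fibre_grad z]] S z]) (rule fibre_grad_inner)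
  from frechet_derivative_at[OF this] show ?thesis by metis
qed

text \<open>Symmetry of the fibre Hessian. It mediates between \<open>fibre_hessian_coords\<close>,
  which differentiates the gradient along the first covector, and \<open>hessian_sharp\<close>,
  which takes the second as its argument.\<close>

lemma fibre_grad_derivative_commute:
  assumes z: "z \<in> S"
  shows "\<DD> (fibre_grad h) z (0, a) \<bullet> b = \<DD> (fibre_grad h) z (0, b) \<bullet> a"
  unfolding fibre_grad_derivative_inner[OF z] by (rule smooth_on_derivative_commute[OF S h z])

end

section \<open>Consequences of parallelity in one chart\<close>

context hausdorff_atlas
begin

context
  fixes h :: "'e \<times> 'e \<Rightarrow> real" and c G nab
  assumes G: "conn_coeffs nab c G" and c: "c \<in> A"
    and h: "smooth_on (chart_image c \<times> UNIV) h"
    and par: "\<And>y e v. y \<in> chart_image c \<Longrightarrow>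
      \<DD> h (y, e) (v, riesz (\<lambda>b. e \<bullet> G y v b)) = 0"
begin

lemma open_h_domain: "open (chart_image c \<times> (UNIV :: 'e set))"
  by (intro open_Times open_chart_image c open_UNIV)

text \<open>The horizontal vector is split into base and fibre part; on the fibre part the
  derivative of \<open>h\<close> is the pairing with \<open>fibre_grad h\<close>.\<close>

lemma base_derivative:
  assumes y: "y \<in> chart_image c"
  shows "\<DD> h (y, e) (v, 0) = - (e \<bullet> G y v (fibre_grad h (y, e)))"
proof -
  have z: "(y, e) \<in> chart_image c \<times> UNIV" using y by simp
  have "\<DD> h (y, e) ((v, 0) + (0, riesz (\<lambda>b. e \<bullet> G y v b))) = 0"
    using par[OF y] by simp
  then have "\<DD> h (y, e) (v, 0) + fibre_grad h (y, e) \<bullet> riesz (\<lambda>b. e \<bullet> G y v b) = 0"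
    unfolding linear_add[OF smooth_on_linear_derivative[OF h z]]
    by (simp add: fibre_grad_inner[OF open_h_domain h z])
  then show ?thesis
    using riesz_inner[OF linear_inner_coeffs(1)[OF G y]] by (simp add: inner_commute)
qed

text \<open>This is \<open>base_derivative\<close> differentiated in fibre directions.\<close>

lemma fibre_grad_base_derivative:
  assumes y: "y \<in> chart_image c"
  shows "\<DD> (fibre_grad h) (y, e) (v, 0) =
    - G y v (fibre_grad h (y, e)) - \<DD> (fibre_grad h) (y, e) (0, riesz (\<lambda>b. e \<bullet> G y v b))"
proof (rule euclidean_eqI)
  fix a :: 'e
  note S = open_h_domain
  have z: "(y, e) \<in> chart_image c \<times> UNIV" using y by simp
  let ?D = "\<DD> (fibre_grad h) (y, e)"
  have Df: "(fibre_grad h has_derivative ?D) (at (y, e))"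
    by (rule smooth_on_has_derivative[OF smooth_fibre_grad[OF S h] z])
  have lG: "(G y v has_derivative G y v) (at u)" for u
    by (rule bounded_linear_imp_has_derivative) (use conn_coeffsD(1)[OF G y] in \<open>simp add: linear_conv_bounded_linear\<close>)
  \<comment> \<open>A line in the fibre direction \<open>a\<close>, along which both sides of
    \<open>base_derivative\<close> are differentiated.\<close>
  define k where "k s = (y, e + s *\<^sub>R a)" for s :: real
  have k: "(k has_derivative (\<lambda>s. (0, s *\<^sub>R a))) (at 0)"
    unfolding k_def by (auto intro!: derivative_eq_intros)
  have k0: "k 0 = (y, e)" by (simp add: k_def)
  have fk: "((\<lambda>s. fibre_grad h (k s)) has_derivative (\<lambda>s. ?D (0, s *\<^sub>R a))) (at 0)"
    using has_derivative_compose[OF k, of "fibre_grad h" ?D] Df by (simp add: k0)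
  have "((\<lambda>s. - ((e + s *\<^sub>R a) \<bullet> G y v (fibre_grad h (k s)))) has_derivative
      (\<lambda>s. - ((e + 0 *\<^sub>R a) \<bullet> G y v (?D (0, s *\<^sub>R a)) + s *\<^sub>R a \<bullet> G y v (fibre_grad h (k 0))))) (at 0)"
    by (intro has_derivative_minus has_derivative_inner has_derivative_compose[OF fk lG])
      (auto intro!: derivative_eq_intros)
  then have 1: "((\<lambda>s. \<DD> h (k s) (v, 0)) has_derivative
      (\<lambda>s. - (e \<bullet> G y v (?D (0, s *\<^sub>R a)) + s *\<^sub>R a \<bullet> G y v (fibre_grad h (y, e))))) (at 0)"
    by (simp add: k0) (simp add: k_def base_derivative[OF y])
  have 2: "((\<lambda>s. \<DD> h (k s) (v, 0)) has_derivative
      (\<lambda>s. \<DD> (\<lambda>z. \<DD> h z (v, 0)) (y, e) (0, s *\<^sub>R a))) (at 0)"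
    using has_derivative_compose[OF k, of "\<lambda>z. \<DD> h z (v, 0)"]
      smooth_on_has_derivative[OF smooth_on_derivative[OF h] z] by (simp add: k0)
  \<comment> \<open>Symmetry of second derivatives turns the base derivative of the fibre gradient
    into a fibre derivative of the base derivative.\<close>
  have "?D (v, 0) \<bullet> a = \<DD> (\<lambda>z. \<DD> h z (v, 0)) (y, e) (0, a)"
    unfolding fibre_grad_derivative_inner[OF S h z] by (rule smooth_on_derivative_commute[OF S h z])
  also have "\<dots> = - (e \<bullet> G y v (?D (0, a)) + a \<bullet> G y v (fibre_grad h (y, e)))"
    using fun_cong[OF has_derivative_unique[OF 2 1], of 1] by simp
  \<comment> \<open>The functional is written through its representing vector, and symmetry of the
    fibre Hessian exchanges this vector with \<open>a\<close>.\<close>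
  also have "e \<bullet> G y v (?D (0, a)) = ?D (0, riesz (\<lambda>b. e \<bullet> G y v b)) \<bullet> a"
    using riesz_inner[OF linear_inner_coeffs(1)[OF G y]] fibre_grad_derivative_commute[OF S h z]
    by (metis inner_commute)
  finally show "?D (v, 0) \<bullet> a = (- G y v (fibre_grad h (y, e)) - ?D (0, riesz (\<lambda>b. e \<bullet> G y v b))) \<bullet> a"
    by (simp add: inner_diff_left inner_diff_right inner_commute)
qed

end

text \<open>Fields of this shape are adjoint horizontal lifts of \<open>g\<close>. For
  \<open>g\<close> the fibre gradient it is the Hamiltonian field, for \<open>g\<close> a vector
  field on the base its lift; one formula serves both entries of the bracket.\<close>

lemma has_derivative_horizontal_field:
  fixes g :: "'e \<times> 'e \<Rightarrow> 'e"
  assumes G: "conn_coeffs nab c G" and c: "c \<in> A" and y: "y \<in> chart_image c"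
    and g: "(g has_derivative g') (at (y, e))"
  shows "((\<lambda>z. (g z, riesz (\<lambda>b. snd z \<bullet> G (fst z) b (g z)))) has_derivative
    (\<lambda>\<zeta>. (g' \<zeta>, riesz (\<lambda>b. e \<bullet> (coeff_deriv G y (fst \<zeta>) b (g (y, e)) + G y b (g' \<zeta>))
      + snd \<zeta> \<bullet> G y b (g (y, e)))))) (at (y, e))"
proof -
  have 0: "G y 0 u = 0" for u using linear_0[OF conn_coeffsD(2)[OF G y]] .
  have "((\<lambda>z. G (fst z) b (g z)) has_derivative
      (\<lambda>\<zeta>. coeff_deriv G y (fst \<zeta>) b (g (y, e)) + G y b (g' \<zeta>))) (at (y, e))" for b
    using has_derivative_coeffs[OF G c _ has_derivative_fst[OF has_derivative_ident] has_derivative_const g, of b] y 0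
    by simp
  from has_derivative_inner[OF has_derivative_snd[OF has_derivative_ident] this]
  show ?thesis by (intro has_derivative_Pair has_derivative_riesz g) simp
qed

end

section \<open>Fibre derivative and fibre Hessian in canonical coordinates\<close>

locale hamiltonian = hausdorff_atlas A for A :: "('m, 'e::euclidean_space) chart set" +
  fixes H :: "'m \<times> ('m, 'e) covec \<Rightarrow> real"
  assumes smooth_H: "smooth_fun coatlas H"
begin

definition ham :: "('m, 'e) chart \<Rightarrow> 'e \<times> 'e \<Rightarrow> real"
  where "ham c = H \<circ> chart_inv (cochart c)"

lemma smooth_ham: "c \<in> A \<Longrightarrow> smooth_on (chart_image c \<times> UNIV) (ham c)"
  using smooth_H cotangent_chart_image by (fastforce simp: smooth_fun_def ham_def cotangent_atlas_def)

abbreviation coord_pt :: "('m, 'e) chart \<Rightarrow> 'm \<Rightarrow> ('m, 'e) covec \<Rightarrow> 'e \<times> 'e"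
  where "coord_pt c x p \<equiv> (chart_map c x, coords c x p)"

lemma coord_pt_in: "c \<in> charts_at A x \<Longrightarrow> coord_pt c x p \<in> chart_image c \<times> UNIV"
  by (simp add: charts_at_iff chart_map_in_image)

lemma H_eq_ham:
  assumes "c \<in> charts_at A x" "p \<in> TsM x"
  shows "H (x, p) = ham c (coord_pt c x p)"
  using assms covec_of_coords[OF assms(2,1)]
  by (simp add: ham_def charts_at_iff cotangent_chart_inv chart_map_in_image chart_inv_map)

lemma ham_has_derivative:
  assumes "c \<in> charts_at A x"
  shows "(ham c has_derivative \<DD> (ham c) (coord_pt c x p)) (at (coord_pt c x p))"
  using smooth_on_has_derivative[OF smooth_ham coord_pt_in[OF assms]] assms by (simp add: charts_at_iff)

lemma differential_H:
  assumes c: "c \<in> charts_at A x" and p: "p \<in> TsM x" and w: "w \<in> tangent_space coatlas (x, p)"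
  shows "differential coatlas H (x, p) w = \<DD> (ham c) (coord_pt c x p) (w (cochart c))"
proof -
  interpret ct: atlas coatlas by (rule atlas_cotangent)
  show ?thesis
    using ct.differential_chart[OF cochart_charts_at[OF c p] w] ham_has_derivative[OF c, of p]
    by (simp add: ham_def cotangent_chart_map)
qed

abbreviation grad :: "('m, 'e) chart \<Rightarrow> 'm \<Rightarrow> ('m, 'e) covec \<Rightarrow> 'e"
  where "grad c x p \<equiv> fibre_grad (ham c) (coord_pt c x p)"

abbreviation Dgrad :: "('m, 'e) chart \<Rightarrow> 'm \<Rightarrow> ('m, 'e) covec \<Rightarrow> 'e \<times> 'e \<Rightarrow> 'e"
  where "Dgrad c x p \<equiv> \<DD> (fibre_grad (ham c)) (coord_pt c x p)"

lemma open_ham_domain: "c \<in> A \<Longrightarrow> open (chart_image c \<times> (UNIV :: 'e set))"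
  by (intro open_Times open_chart_image open_UNIV)

lemma grad_inner:
  assumes "c \<in> charts_at A x"
  shows "grad c x p \<bullet> a = \<DD> (ham c) (coord_pt c x p) (0, a)"
  using assms fibre_grad_inner[OF open_ham_domain smooth_ham coord_pt_in[OF assms]] by (simp add: charts_at_iff)

lemma grad_has_derivative:
  assumes "c \<in> charts_at A x"
  shows "(fibre_grad (ham c) has_derivative Dgrad c x p) (at (coord_pt c x p))"
  using assms smooth_on_has_derivative[OF smooth_fibre_grad[OF open_ham_domain smooth_ham] coord_pt_in[OF assms]]
  by (simp add: charts_at_iff)

lemma fibre_deriv_coords:
  assumes c: "c \<in> charts_at A x" and p: "p \<in> TsM x"
  shows "fibre_deriv A H x p \<in> TM x"
    and "fibre_deriv A H x p c = grad c x p"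
proof -
  have "differential coatlas H (x, p) (vertical_lift A x p \<alpha>) = coords c x \<alpha> \<bullet> grad c x p"
    if "\<alpha> \<in> TsM x" for \<alpha>
    using differential_H[OF c p vertical_lift_coords(1)[OF c p that]] vertical_lift_coords(2)[OF c p that]
      grad_inner[OF c] by (simp add: inner_commute)
  from the_tangent_vector[OF c this]
  show "fibre_deriv A H x p \<in> TM x" "fibre_deriv A H x p c = grad c x p"
    unfolding fibre_deriv_def using coord_vec_tangent[OF c] coord_vec_self[OF c] by simp_all
qed

lemma H_line_has_derivative:
  assumes c: "c \<in> charts_at A x" and p: "p \<in> TsM x" and \<alpha>: "\<alpha> \<in> TsM x"
  shows "((\<lambda>s. H (x, p + s *\<^sub>R \<alpha>)) has_real_derivative grad c x p \<bullet> coords c x \<alpha>) (at 0)"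
proof -
  let ?k = "\<lambda>s. (chart_map c x, coords c x p + s *\<^sub>R coords c x \<alpha>)"
  have "(?k has_derivative (\<lambda>s. (0, s *\<^sub>R coords c x \<alpha>))) (at 0)"
    by (auto intro!: derivative_eq_intros)
  from has_derivative_compose[OF this, of "ham c"] ham_has_derivative[OF c, of p]
  have "((\<lambda>s. ham c (?k s)) has_derivative (\<lambda>s. \<DD> (ham c) (coord_pt c x p) (0, s *\<^sub>R coords c x \<alpha>))) (at 0)"
    by simp
  then have "((\<lambda>s. ham c (?k s)) has_derivative (\<lambda>s. grad c x p \<bullet> (s *\<^sub>R coords c x \<alpha>))) (at 0)"
    unfolding grad_inner[OF c, symmetric] .
  moreover have "H (x, p + s *\<^sub>R \<alpha>) = ham c (?k s)" for s
    using H_eq_ham[OF c cotangent_space_add[OF p cotangent_space_scaleR[OF \<alpha>]]]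
    by (simp add: covec_coords_add covec_coords_scaleR)
  ultimately show ?thesis
    by (simp add: has_field_derivative_def mult_commute_abs)
qed

text \<open>Expresses \<open>H'\<close> by the values of \<open>H\<close> on a line in the fibre,
  the form to which constancy of \<open>H\<close> along parallel fields applies.\<close>

lemma fibre_deriv_apply:
  assumes x: "x \<in> points A" and p: "p \<in> TsM x" and \<alpha>: "\<alpha> \<in> TsM x"
  shows "\<alpha> (fibre_deriv A H x p) = deriv (\<lambda>s. H (x, p + s *\<^sub>R \<alpha>)) 0"
proof -
  obtain c where c: "c \<in> charts_at A x" using x by (auto simp: points_iff)
  show ?thesis
    using DERIV_imp_deriv[OF H_line_has_derivative[OF c p \<alpha>]] cotangent_apply[OF \<alpha> c fibre_deriv_coords(1)[OF c p]]
      fibre_deriv_coords(2)[OF c p] by (simp add: inner_commute)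
qed

lemma fibre_hessian_coords:
  assumes c: "c \<in> charts_at A x" and p: "p \<in> TsM x"
    and l1: "l1 \<in> TsM x" and l2: "l2 \<in> TsM x"
  shows "fibre_hessian H x p l1 l2 = Dgrad c x p (0, coords c x l1) \<bullet> coords c x l2"
proof -
  let ?k = "\<lambda>s. (chart_map c x, coords c x p + s *\<^sub>R coords c x l1)"
  have inner_deriv: "deriv (\<lambda>s2. H (x, p + s1 *\<^sub>R l1 + s2 *\<^sub>R l2)) 0 = fibre_grad (ham c) (?k s1) \<bullet> coords c x l2" for s1
    using DERIV_imp_deriv[OF H_line_has_derivative[OF c cotangent_space_add[OF p cotangent_space_scaleR[OF l1]] l2]]
    by (simp add: covec_coords_add covec_coords_scaleR)
  have "(?k has_derivative (\<lambda>s. (0, s *\<^sub>R coords c x l1))) (at 0)"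
    by (auto intro!: derivative_eq_intros)
  from has_derivative_compose[OF this, of "fibre_grad (ham c)"] grad_has_derivative[OF c, of p]
  have "((\<lambda>s. fibre_grad (ham c) (?k s)) has_derivative (\<lambda>s. Dgrad c x p (0, s *\<^sub>R coords c x l1))) (at 0)"
    by simp
  from has_derivative_inner_left[OF this]
  have "((\<lambda>s. fibre_grad (ham c) (?k s) \<bullet> coords c x l2) has_derivative
      (\<lambda>s. Dgrad c x p (0, s *\<^sub>R coords c x l1) \<bullet> coords c x l2)) (at 0)" .
  moreover have "Dgrad c x p (0, s *\<^sub>R coords c x l1) = s *\<^sub>R Dgrad c x p (0, coords c x l1)" for s
    using linear_cmul[OF has_derivative_linear[OF grad_has_derivative[OF c, of p]], of s "(0, coords c x l1)"]
    by simp
  ultimately have "((\<lambda>s. fibre_grad (ham c) (?k s) \<bullet> coords c x l2) has_real_derivative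
      Dgrad c x p (0, coords c x l1) \<bullet> coords c x l2) (at 0)"
    by (simp add: has_field_derivative_def mult_commute_abs)
  then show ?thesis
    unfolding fibre_hessian_def inner_deriv by (rule DERIV_imp_deriv)
qed

lemma hessian_sharp_coords:
  assumes c: "c \<in> charts_at A x" and p: "p \<in> TsM x" and l: "l \<in> TsM x"
  shows "hessian_sharp A H x p l \<in> TM x"
    and "hessian_sharp A H x p l c = Dgrad c x p (0, coords c x l)"
proof -
  have cA: "c \<in> A" using c by (simp add: charts_at_iff)
  have "fibre_hessian H x p \<alpha> l = coords c x \<alpha> \<bullet> Dgrad c x p (0, coords c x l)"
    if "\<alpha> \<in> TsM x" for \<alpha>
    using fibre_hessian_coords[OF c p that l]
      fibre_grad_derivative_commute[OF open_ham_domain[OF cA] smooth_ham[OF cA] coord_pt_in[OF c]]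
    by (simp add: inner_commute)
  from the_tangent_vector[OF c this]
  show "hessian_sharp A H x p l \<in> TM x"
    "hessian_sharp A H x p l c = Dgrad c x p (0, coords c x l)"
    unfolding hessian_sharp_def eq_commute[of "fibre_hessian H x p _ l"]
    using coord_vec_tangent[OF c] coord_vec_self[OF c] by simp_all
qed

end

section \<open>Parallel Hamiltonians\<close>

text \<open>The connection enters through its coefficients, for which \<open>christoffel nab\<close>
  is substituted in the theorem.\<close>

locale parallel_hamiltonian_conn = hamiltonian A H
  for A :: "('m, 'e::euclidean_space) chart set" and H +
  fixes nab :: "('m, 'e) conn" and G :: "('m, 'e) chart \<Rightarrow> 'e \<Rightarrow> 'e \<Rightarrow> 'e \<Rightarrow> 'e"
  assumes G: "c \<in> A \<Longrightarrow> conn_coeffs nab c (G c)"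
    and par: "parallel_hamiltonian A nab H"
begin

lemma parallel_ham:
  assumes cA: "c \<in> A" and y: "y \<in> chart_image c"
  shows "\<DD> (ham c) (y, e) (v, riesz (\<lambda>b. e \<bullet> G c y v b)) = 0"
proof -
  let ?x = "chart_inv c y" and ?p = "covec_of c (chart_inv c y) e"
  have c: "c \<in> charts_at A ?x" using cA y by (simp add: charts_at_iff chart_inv_in_dom)
  have p: "?p \<in> TsM ?x" by (rule covec_of_cotangent)
  have v: "coord_vec A c ?x v \<in> TM ?x" by (rule coord_vec_tangent[OF c])
  have "?x \<in> points A" using c by (auto simp: points_iff)
  then have "differential coatlas H (?x, ?p) (horizontal_lift A nab ?x ?p (coord_vec A c ?x v)) = 0"
    using par p v by (simp add: parallel_hamiltonian_def)
  then show ?thesis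
    using differential_H[OF c p horizontal_lift_coords(1)[OF G[OF cA] c p v]] horizontal_lift_coords(2)[OF G[OF cA] c p v]
    by (simp add: covec_coords_of[OF c] chart_map_inv[OF y] coord_vec_self[OF c])
qed

section \<open>Invariants along parallel fields\<close>

lemma H_constant_along_parallel:
  assumes I: "open I" "is_interval I"
    and par: "parallel_along A nab I \<gamma> p" "parallel_along A nab I \<gamma> l1" "parallel_along A nab I \<gamma> l2"
    and t: "t \<in> I" "t' \<in> I"
  shows "H (\<gamma> t, p t + s1 *\<^sub>R l1 t + s2 *\<^sub>R l2 t) = H (\<gamma> t', p t' + s1 *\<^sub>R l1 t' + s2 *\<^sub>R l2 t')"
proof -
  have cot: "q t \<in> TsM (\<gamma> t)" if "parallel_along A nab I \<gamma> q" "t \<in> I" for q t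
    using that by (simp add: parallel_along_def)
  have sc: "smooth_curve A I \<gamma>" using par(1) by (simp add: parallel_along_def)
  define q where "q t = p t + s1 *\<^sub>R l1 t + s2 *\<^sub>R l2 t" for t
  have q: "q t \<in> TsM (\<gamma> t)" if "t \<in> I" for t
    unfolding q_def using cot par that by (intro cotangent_space_add cotangent_space_scaleR) auto
  have "((\<lambda>t. H (\<gamma> t, q t)) has_real_derivative 0) (at t)" if t: "t \<in> I" for t
  proof -
    have "\<gamma> t \<in> points A" using sc t by (auto simp: smooth_curve_def)
    then obtain c where c: "c \<in> charts_at A (\<gamma> t)" by (auto simp: points_iff)
    have cA: "c \<in> A" and x: "\<gamma> t \<in> chart_dom c" using c by (simp_all add: charts_at_iff)
    let ?v = "velocity A \<gamma> t c"
    let ?r = "\<lambda>e. riesz (\<lambda>b. e \<bullet> G c (chart_map c (\<gamma> t)) ?v b)"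
    let ?e = "\<lambda>q s. coords c (\<gamma> s) (q s)"
    note pc = parallel_along_coords(2)[OF G[OF cA] par(1) t c] parallel_along_coords(2)[OF G[OF cA] par(2) t c]
      parallel_along_coords(2)[OF G[OF cA] par(3) t c]
    have eq: "?e q s = ?e p s + s1 *\<^sub>R ?e l1 s + s2 *\<^sub>R ?e l2 s" for s
      by (simp add: q_def covec_coords_add covec_coords_scaleR)
    \<comment> \<open>The transport equation is linear in the covector, so the combination
      \<open>q\<close> satisfies it as well.\<close>
    have "((\<lambda>s. ?e p s + s1 *\<^sub>R ?e l1 s + s2 *\<^sub>R ?e l2 s) has_vector_derivative
        ?r (?e p t) + s1 *\<^sub>R ?r (?e l1 t) + s2 *\<^sub>R ?r (?e l2 t)) (at t)"
      by (intro has_vector_derivative_add pc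
          bounded_linear.has_vector_derivative[OF bounded_linear_scaleR_right])
    moreover have "?r (?e p t) + s1 *\<^sub>R ?r (?e l1 t) + s2 *\<^sub>R ?r (?e l2 t) = ?r (?e q t)"
      unfolding eq linear_add[OF linear_riesz_family] linear_cmul[OF linear_riesz_family] ..
    ultimately have e': "(?e q has_vector_derivative ?r (?e q t)) (at t)"
      by (simp add: eq[abs_def])
    have g': "((\<lambda>s. chart_map c (\<gamma> s)) has_vector_derivative ?v) (at t)"
      using parallel_along_coords(1)[OF G[OF cA] par(1) t c] by (simp add: o_def)
    have "((\<lambda>s. ham c (coord_pt c (\<gamma> s) (q s))) has_vector_derivative
        \<DD> (ham c) (coord_pt c (\<gamma> t) (q t)) (?v, ?r (?e q t))) (at t)"
      using vector_derivative_diff_chain_within[OF has_vector_derivative_Pair[OF g' e'], of "ham c"]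
        has_derivative_at_withinI[OF ham_has_derivative[OF c]] by (simp add: o_def)
    then have "((\<lambda>s. ham c (coord_pt c (\<gamma> s) (q s))) has_real_derivative 0) (at t)"
      using parallel_ham[OF cA chart_map_in_image[OF x]] by (simp add: has_real_derivative_iff_has_vector_derivative)
    then show ?thesis
    proof (rule has_field_derivative_transform_within_open)
      show "open {s \<in> I. \<gamma> s \<in> chart_dom c}" using sc cA by (simp add: smooth_curve_def)
      show "t \<in> {s \<in> I. \<gamma> s \<in> chart_dom c}" using t x by simp
      fix s assume "s \<in> {s \<in> I. \<gamma> s \<in> chart_dom c}"
      then show "ham c (coord_pt c (\<gamma> s) (q s)) = H (\<gamma> s, q s)"
        using H_eq_ham[OF _ q, of c s] cA by (simp add: charts_at_iff)
    qed
  qed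
  then have "\<exists>k. \<forall>t\<in>I. H (\<gamma> t, q t) = k"
    using I(2) by (intro has_field_derivative_zero_constant)
      (auto simp: is_interval_convex_1 intro: has_field_derivative_at_within)
  then show ?thesis using t unfolding q_def by metis
qed

lemma parallel_invariants:
  assumes I: "open I" "is_interval I"
    and par: "parallel_along A nab I \<gamma> p" "parallel_along A nab I \<gamma> l1" "parallel_along A nab I \<gamma> l2"
    and t: "t \<in> I"
  shows "((\<lambda>t. l1 t (fibre_deriv A H (\<gamma> t) (p t))) has_real_derivative 0) (at t)"
    and "((\<lambda>t. fibre_hessian H (\<gamma> t) (p t) (l1 t) (l2 t)) has_real_derivative 0) (at t)"
proof -
  have q: "q s \<in> TsM (\<gamma> s)" "\<gamma> s \<in> points A" if "parallel_along A nab I \<gamma> q" "s \<in> I" for q s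
    using that by (auto simp: parallel_along_def smooth_curve_def)
  have H: "H (\<gamma> s, p s + s1 *\<^sub>R l1 s + s2 *\<^sub>R l2 s) = H (\<gamma> t, p t + s1 *\<^sub>R l1 t + s2 *\<^sub>R l2 t)" if "s \<in> I" for s s1 s2
    by (rule H_constant_along_parallel[OF I par that t])
  have const: "(f has_real_derivative 0) (at t)" if "\<And>s. s \<in> I \<Longrightarrow> f s = f t" for f :: "real \<Rightarrow> real"
    by (rule has_field_derivative_transform_within_open[OF _ I(1) t, of "\<lambda>_. f t"]) (use that in auto)
  show "((\<lambda>t. l1 t (fibre_deriv A H (\<gamma> t) (p t))) has_real_derivative 0) (at t)"
  proof (rule const)
    fix s assume s: "s \<in> I"
    have "(\<lambda>r. H (\<gamma> s, p s + r *\<^sub>R l1 s)) = (\<lambda>r. H (\<gamma> t, p t + r *\<^sub>R l1 t))"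
      using H[OF s, of _ 0] by simp
    then show "l1 s (fibre_deriv A H (\<gamma> s) (p s)) = l1 t (fibre_deriv A H (\<gamma> t) (p t))"
      using fibre_deriv_apply[OF q(2)[OF par(1) s] q(1)[OF par(1) s] q(1)[OF par(2) s]]
        fibre_deriv_apply[OF q(2)[OF par(1) t] q(1)[OF par(1) t] q(1)[OF par(2) t]] by simp
  qed
  show "((\<lambda>t. fibre_hessian H (\<gamma> t) (p t) (l1 t) (l2 t)) has_real_derivative 0) (at t)"
    by (rule const) (simp add: fibre_hessian_def H)
qed

section \<open>Brackets with the Hamiltonian field\<close>

lemma hamiltonian_field_coords:
  assumes cA: "c \<in> A" and y: "y \<in> chart_image c"
  shows "hamiltonian_field A H (chart_inv (cochart c) (y, e)) (cochart c) =
    (fibre_grad (ham c) (y, e), riesz (\<lambda>b. e \<bullet> G c y b (fibre_grad (ham c) (y, e))))"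
proof -
  have c: "c \<in> charts_at A (chart_inv c y)" using cA y by (simp add: charts_at_iff chart_inv_in_dom)
  have C: "cochart c \<in> charts_at coatlas (chart_inv (cochart c) (y, e))"
    using cochart_charts_at[OF c covec_of_cotangent] by (simp add: cotangent_chart_inv[OF cA y])
  have m: "chart_map (cochart c) (chart_inv (cochart c) (y, e)) = (y, e)"
    using chart_map_inv[of "(y, e)" "cochart c"] cA y by (simp add: cotangent_chart_image)
  \<comment> \<open>The sign in \<open>base_derivative\<close> cancels that in the Hamiltonian
    field. The index \<open>b\<close> lands in the first vector slot of \<open>G\<close>, as in a
    lift for the adjoint connection.\<close>
  have "- (\<Sum>b\<in>Basis. \<DD> (ham c) (y, e) (b, 0) *\<^sub>R b) =
      riesz (\<lambda>b. e \<bullet> G c y b (fibre_grad (ham c) (y, e)))"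
    using base_derivative[OF G[OF cA] cA smooth_ham[OF cA] parallel_ham[OF cA] y, of e]
    by (simp add: riesz_def sum_negf)
  then show ?thesis
    using C m by (simp add: hamiltonian_field_def Let_def ham_def[symmetric] fibre_grad_def[of "ham c"] riesz_def[of "\<lambda>b. \<DD> (ham c) (y, e) (0, b)"])
qed

lemma hamiltonian_field_has_derivative:
  assumes c: "c \<in> charts_at A x"
  shows "((\<lambda>z. hamiltonian_field A H (chart_inv (cochart c) z) (cochart c)) has_derivative
    (\<lambda>\<zeta>. (Dgrad c x p \<zeta>, riesz (\<lambda>b. coords c x p \<bullet> (coeff_deriv (G c) (chart_map c x) (fst \<zeta>) b (grad c x p)
        + G c (chart_map c x) b (Dgrad c x p \<zeta>)) + snd \<zeta> \<bullet> G c (chart_map c x) b (grad c x p))))) (at (coord_pt c x p))"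
proof -
  have cA: "c \<in> A" and y: "chart_map c x \<in> chart_image c" using c by (auto simp: charts_at_iff chart_map_in_image)
  show ?thesis
    by (rule has_derivative_transform_within_open[OF has_derivative_horizontal_field[OF G[OF cA] cA y grad_has_derivative[OF c]]
          open_ham_domain[OF cA] coord_pt_in[OF c]])
      (auto simp: hamiltonian_field_coords[OF cA])
qed

lemma adjoint_coeffs: "c \<in> A \<Longrightarrow> conn_coeffs (adjoint_connection A nab) c (\<lambda>y u w. G c y w u)"
  by (rule adjoint_conn_coeffs[OF G])

text \<open>In coordinates the lift of \<open>\<beta>\<close> is 0 in the base and
  \<open>\<beta>\<close> in the fibre. The base part of the bracket is minus the fibre Hessian
  applied to \<open>\<beta>\<close>. In the fibre part, the change of the gradient inside
  \<open>G\<close> completes the horizontal lift, and the explicit momentum in the Hamiltonian field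
  yields the coefficient term of the covariant derivative.\<close>

lemma bracket_vertical:
  assumes \<beta>: "\<beta> \<in> one_forms A" and x: "x \<in> points A" and p: "p \<in> TsM x"
  defines "nabh \<equiv> adjoint_connection A nab"
  shows "lie_bracket coatlas (hamiltonian_field A H) (\<lambda>(y, q). vertical_lift A y q (\<beta> y)) (x, p) =
    - horizontal_lift A nabh x p (hessian_sharp A H x p (\<beta> x))
    + vertical_lift A x p (dual_connection A nabh x (fibre_deriv A H x p) \<beta>)"
    (is "?l = ?r")
proof
  interpret ct: atlas coatlas by (rule atlas_cotangent)
  fix C
  note \<beta>x = one_form_cotangent[OF \<beta>]
  show "?l C = ?r C"
  proof (cases "C \<in> charts_at coatlas (x, p)")
    \<comment> \<open>Off the charts at \<open>(x, p)\<close> all families of coordinates involved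
      are zero.\<close>
    case False
    obtain c where c: "c \<in> charts_at A x" using x by (auto simp: points_iff)
    then have cA: "c \<in> A" by (simp add: charts_at_iff)
    note Gh = adjoint_coeffs[OF cA, folded nabh_def]
    show ?thesis
      using False ct.tangent_space_outside[OF horizontal_lift_coords(1)[OF Gh c p hessian_sharp_coords(1)[OF c p \<beta>x]] False]
        ct.tangent_space_outside[OF vertical_lift_coords(1)[OF c p dual_connection_one_form(1)[OF Gh c fibre_deriv_coords(1)[OF c p] \<beta>]] False]
      by (simp add: lie_bracket_def)
  next
    case True
    then obtain c where c: "c \<in> charts_at A x" and C: "C = cochart c" by (auto simp: charts_at_cotangent)
    have cA: "c \<in> A" and y: "chart_map c x \<in> chart_image c" "chart_inv c (chart_map c x) = x"
      using c by (auto simp: charts_at_iff chart_map_in_image chart_inv_map)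
    note Gh = adjoint_coeffs[OF cA, folded nabh_def]
    let ?y = "chart_map c x" and ?e = "coords c x p"
    let ?b = "form_coords c \<beta>"
    let ?Db = "\<DD> ?b ?y"
    have inv: "chart_inv C (coord_pt c x p) = (x, p)"
      using cotangent_chart_inv[OF cA y(1)] y(2) covec_of_coords[OF p c] by (simp add: C)
    have "(?b has_derivative ?Db) (at ?y)"
      using smooth_on_has_derivative[OF one_form_smooth[OF \<beta> cA] y(1)] .
    then have "((\<lambda>z. (0, ?b (fst z))) has_derivative (\<lambda>\<zeta>. (0, ?Db (fst \<zeta>)))) (at (coord_pt c x p))"
      by (intro has_derivative_Pair has_derivative_const has_derivative_compose[OF has_derivative_fst[OF has_derivative_ident]]) simp
    then have DV: "((\<lambda>z. (\<lambda>(y, q). vertical_lift A y q (\<beta> y)) (chart_inv C z) C) has_derivative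
        (\<lambda>\<zeta>. (0, ?Db (fst \<zeta>)))) (at (coord_pt c x p))"
    proof (rule has_derivative_transform_within_open[OF _ open_ham_domain[OF cA] coord_pt_in[OF c]])
      fix z :: "'e \<times> 'e" assume "z \<in> chart_image c \<times> UNIV"
      then obtain y e where z: "z = (y, e)" "y \<in> chart_image c" by auto
      have "c \<in> charts_at A (chart_inv c y)" using z cA by (simp add: charts_at_iff chart_inv_in_dom)
      from vertical_lift_coords(2)[OF this covec_of_cotangent \<beta>x]
      show "(0, ?b (fst z)) = (\<lambda>(y, q). vertical_lift A y q (\<beta> y)) (chart_inv C z) C"
        by (simp add: z C cotangent_chart_inv[OF cA z(2)])
    qed
    have H0: "hamiltonian_field A H (x, p) C = (grad c x p, riesz (\<lambda>b. ?e \<bullet> G c ?y b (grad c x p)))"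
      using hamiltonian_field_coords[OF cA y(1), of ?e] inv by (simp add: C)
    have V0: "vertical_lift A x p (\<beta> x) C = (0, ?b ?y)"
      using vertical_lift_coords(2)[OF c p \<beta>x] by (simp add: C y(2))
    have "?l C =
        (0, ?Db (grad c x p)) - (Dgrad c x p (0, ?b ?y), riesz (\<lambda>b. ?e \<bullet> (coeff_deriv (G c) ?y 0 b (grad c x p)
        + G c ?y b (Dgrad c x p (0, ?b ?y))) + ?b ?y \<bullet> G c ?y b (grad c x p)))"
      using True frechet_derivative_at[OF DV, symmetric] frechet_derivative_at[OF hamiltonian_field_has_derivative[OF c, of p], symmetric]
      by (simp add: lie_bracket_def C cotangent_chart_map H0[unfolded C] V0[unfolded C])
    \<comment> \<open>The lift of \<open>\<beta>\<close> is vertical, so moving along it does not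
      change the coefficients.\<close>
    moreover have "coeff_deriv (G c) ?y 0 b w = 0" for b w
      unfolding coeff_deriv_def
      using linear_0[OF smooth_on_linear_derivative[OF conn_coeffsD(3)[OF G[OF cA]] y(1)]] .
    moreover have "horizontal_lift A nabh x p (hessian_sharp A H x p (\<beta> x)) C =
        (Dgrad c x p (0, ?b ?y), riesz (\<lambda>b. ?e \<bullet> G c ?y b (Dgrad c x p (0, ?b ?y))))"
      using horizontal_lift_coords(2)[OF Gh c p hessian_sharp_coords(1)[OF c p \<beta>x]] hessian_sharp_coords(2)[OF c p \<beta>x]
      by (simp add: C y(2))
    moreover have "vertical_lift A x p (dual_connection A nabh x (fibre_deriv A H x p) \<beta>) C =
        (0, coords c x (dual_connection A nabh x (fibre_deriv A H x p) \<beta>))"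
      using vertical_lift_coords(2)[OF c p dual_connection_one_form(1)[OF Gh c fibre_deriv_coords(1)[OF c p] \<beta>]] by (simp add: C)
    moreover have "coords c x (dual_connection A nabh x (fibre_deriv A H x p) \<beta>) \<bullet> b =
        ?Db (grad c x p) \<bullet> b - ?b ?y \<bullet> G c ?y b (grad c x p)" for b
      using dual_connection_one_form(2)[OF Gh c fibre_deriv_coords(1)[OF c p] \<beta>] fibre_deriv_coords(2)[OF c p] by (simp add: y(2))
    ultimately show ?thesis
      by (auto intro!: prod_eqI euclidean_eqI[where 'a = 'e]
          simp: riesz_Basis inner_diff_left inner_add_left inner_minus_left)
  qed
qed

text \<open>In the base part, \<open>fibre_grad_base_derivative\<close> turns the derivative of
  \<open>H'\<close> along the lift of \<open>X\<close> into the coefficient term of the adjoint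
  derivative of \<open>X\<close> and the fibre Hessian applied to the difference of the two lifts of
  \<open>X\<close>, which is the torsion form. In the fibre part the same terms recur inside
  \<open>G\<close> and complete the two horizontal lifts; the derivatives and products of
  \<open>G\<close> that remain are minus the curvature.\<close>

lemma bracket_horizontal:
  assumes X: "X \<in> VF" and x: "x \<in> points A" and p: "p \<in> TsM x"
  defines "nabh \<equiv> adjoint_connection A nab"
  shows "lie_bracket coatlas (hamiltonian_field A H) (\<lambda>(y, q). horizontal_lift A nabh y q (X y)) (x, p) =
    horizontal_lift A nabh x p (nabh x (fibre_deriv A H x p) X)
    + horizontal_lift A nabh x p (hessian_sharp A H x p (torsion_form A nab x (X x) p))
    - vertical_lift A x p (dual_curvature A nabh x (fibre_deriv A H x p) (X x) p)"
    (is "?l = ?r")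
proof
  interpret ct: atlas coatlas by (rule atlas_cotangent)
  fix C
  note Xx = vector_field_tangent[OF X]
  show "?l C = ?r C"
  proof (cases "C \<in> charts_at coatlas (x, p)")
    case False
    obtain c where c: "c \<in> charts_at A x" using x by (auto simp: points_iff)
    then have cA: "c \<in> A" and xc: "x \<in> chart_dom c" by (simp_all add: charts_at_iff)
    note Gh = adjoint_coeffs[OF cA, folded nabh_def]
    note out = ct.tangent_space_outside[OF _ False]
    note t = torsion_form_coords[OF G[OF cA] c p Xx]
    show ?thesis
      using False out[OF horizontal_lift_coords(1)[OF Gh c p conn_coeffsD(4)[OF Gh xc fibre_deriv_coords(1)[OF c p] X]]]
        out[OF horizontal_lift_coords(1)[OF Gh c p hessian_sharp_coords(1)[OF c p t(1)]]]
        out[OF vertical_lift_coords(1)[OF c p dual_curvature_coords(1)[OF Gh c fibre_deriv_coords(1)[OF c p] Xx p]]]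
      by (simp add: lie_bracket_def)
  next
    case True
    then obtain c where c: "c \<in> charts_at A x" and C: "C = cochart c" by (auto simp: charts_at_cotangent)
    have cA: "c \<in> A" and xc: "x \<in> chart_dom c" and y: "chart_map c x \<in> chart_image c" "chart_inv c (chart_map c x) = x"
      using c by (auto simp: charts_at_iff chart_map_in_image chart_inv_map)
    note Gh = adjoint_coeffs[OF cA, folded nabh_def]
    let ?y = "chart_map c x" and ?e = "coords c x p"
    let ?X = "vf_coords c X"
    let ?DX = "\<DD> ?X ?y"
    let ?g = "grad c x p" and ?D = "Dgrad c x p" and ?G = "G c ?y" and ?Xx = "X x c"
    let ?K = "coeff_deriv (G c) ?y"
    \<comment> \<open>\<open>rX\<close> and \<open>rg\<close> are the fibre parts of the adjoint
      lifts of \<open>X\<close> and \<open>H'\<close>; \<open>tf\<close> is the fibre part of the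
      lift of \<open>X\<close> for \<open>nab\<close>.\<close>
    define rX where "rX = riesz (\<lambda>b. ?e \<bullet> ?G b ?Xx)"
    define rg where "rg = riesz (\<lambda>b. ?e \<bullet> ?G b ?g)"
    define tf where "tf = riesz (\<lambda>b. ?e \<bullet> ?G ?Xx b)"
    have rX: "rX \<bullet> w = ?e \<bullet> ?G w ?Xx" and rg: "rg \<bullet> w = ?e \<bullet> ?G w ?g" for w
      unfolding rX_def rg_def by (rule riesz_inner[OF linear_inner_coeffs(2)[OF G[OF cA] y(1)]])+
    have lD: "linear ?D" by (rule has_derivative_linear[OF grad_has_derivative[OF c]])
    have lG: "linear (?G u)" for u by (rule conn_coeffsD(1)[OF G[OF cA] y(1)])
    have inv: "chart_inv C (coord_pt c x p) = (x, p)"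
      using cotangent_chart_inv[OF cA y(1)] y(2) covec_of_coords[OF p c] by (simp add: C)
    have "(?X has_derivative ?DX) (at (fst (coord_pt c x p)))"
      using vector_field_has_derivative[OF X c] by simp
    from has_derivative_compose[OF has_derivative_fst[OF has_derivative_ident] this]
    have "((\<lambda>z. ?X (fst z)) has_derivative (\<lambda>\<zeta>. ?DX (fst \<zeta>))) (at (coord_pt c x p))" .
    from has_derivative_horizontal_field[OF G[OF cA] cA y(1) this]
    have DW: "((\<lambda>z. (\<lambda>(y, q). horizontal_lift A nabh y q (X y)) (chart_inv C z) C) has_derivative
        (\<lambda>\<zeta>. (?DX (fst \<zeta>), riesz (\<lambda>b. ?e \<bullet> (?K (fst \<zeta>) b (?X (fst (coord_pt c x p))) + ?G b (?DX (fst \<zeta>)))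
          + snd \<zeta> \<bullet> ?G b (?X (fst (coord_pt c x p))))))) (at (coord_pt c x p))"
    proof (rule has_derivative_transform_within_open[OF _ open_ham_domain[OF cA] coord_pt_in[OF c]])
      fix z :: "'e \<times> 'e" assume "z \<in> chart_image c \<times> UNIV"
      then obtain y e where z: "z = (y, e)" "y \<in> chart_image c" by auto
      have "c \<in> charts_at A (chart_inv c y)" using z cA by (simp add: charts_at_iff chart_inv_in_dom)
      from horizontal_lift_coords(2)[OF Gh this covec_of_cotangent Xx] covec_coords_of[OF this]
      show "(?X (fst z), riesz (\<lambda>b. snd z \<bullet> G c (fst z) b (?X (fst z)))) =
          (\<lambda>(y, q). horizontal_lift A nabh y q (X y)) (chart_inv C z) C"
        by (simp add: z C cotangent_chart_inv[OF cA z(2)] chart_map_inv)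
    qed
    have H0: "hamiltonian_field A H (x, p) C = (?g, rg)"
      using hamiltonian_field_coords[OF cA y(1), of ?e] inv by (simp add: C rg_def)
    have W0: "horizontal_lift A nabh x p (X x) C = (?Xx, rX)"
      using horizontal_lift_coords(2)[OF Gh c p Xx] by (simp add: C rX_def)
    have L: "?l C =
        (?DX ?g, riesz (\<lambda>b. ?e \<bullet> (?K ?g b ?Xx + ?G b (?DX ?g)) + rg \<bullet> ?G b ?Xx)) -
        (?D (?Xx, rX), riesz (\<lambda>b. ?e \<bullet> (?K ?Xx b ?g + ?G b (?D (?Xx, rX))) + rX \<bullet> ?G b ?g))"
      using True frechet_derivative_at[OF DW, symmetric] frechet_derivative_at[OF hamiltonian_field_has_derivative[OF c, of p], symmetric]
      by (simp add: lie_bracket_def C cotangent_chart_map H0[unfolded C] W0[unfolded C] y(2))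
    \<comment> \<open>The base direction is split off, since parallelity of \<open>H\<close>
      determines the derivative of the gradient in that direction.\<close>
    have "?D (?Xx, rX) = ?D ((?Xx, 0) + (0, rX))" by simp
    also have "\<dots> = ?D (?Xx, 0) + ?D (0, rX)" by (rule linear_add[OF lD])
    also have "?D (?Xx, 0) = - ?G ?Xx ?g - ?D (0, tf)"
      unfolding tf_def by (rule fibre_grad_base_derivative[OF G[OF cA] cA smooth_ham[OF cA] parallel_ham[OF cA] y(1)])
    finally have DX0: "?D (?Xx, rX) = - ?G ?Xx ?g - ?D (0, tf) + ?D (0, rX)" .
    note t = torsion_form_coords[OF G[OF cA] c p Xx]
    have "coords c x (torsion_form A nab x (X x) p) = tf - rX"
      by (simp add: t(2) tf_def rX_def)
    moreover have "?D (0, tf - rX) = ?D (0, tf) - ?D (0, rX)"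
      using linear_diff[OF lD, of "(0, tf)" "(0, rX)"] by simp
    ultimately have sharp: "hessian_sharp A H x p (torsion_form A nab x (X x) p) c = ?D (0, tf) - ?D (0, rX)"
      using hessian_sharp_coords(2)[OF c p t(1)] by simp
    have h1: "horizontal_lift A nabh x p (nabh x (fibre_deriv A H x p) X) C =
        (?DX ?g + ?G ?Xx ?g, riesz (\<lambda>b. ?e \<bullet> ?G b (?DX ?g + ?G ?Xx ?g)))"
      using horizontal_lift_coords(2)[OF Gh c p conn_coeffsD(4)[OF Gh xc fibre_deriv_coords(1)[OF c p] X]]
        conn_coeffsD(5)[OF Gh xc fibre_deriv_coords(1)[OF c p] X] fibre_deriv_coords(2)[OF c p] by (simp add: C)
    have h2: "horizontal_lift A nabh x p (hessian_sharp A H x p (torsion_form A nab x (X x) p)) C =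
        (?D (0, tf) - ?D (0, rX), riesz (\<lambda>b. ?e \<bullet> ?G b (?D (0, tf) - ?D (0, rX))))"
      using horizontal_lift_coords(2)[OF Gh c p hessian_sharp_coords(1)[OF c p t(1)]] sharp by (simp add: C)
    note R = dual_curvature_coords[OF Gh c fibre_deriv_coords(1)[OF c p] Xx p]
    have v: "vertical_lift A x p (dual_curvature A nabh x (fibre_deriv A H x p) (X x) p) C =
        (0, coords c x (dual_curvature A nabh x (fibre_deriv A H x p) (X x) p))"
      using vertical_lift_coords(2)[OF c p R(1)] by (simp add: C)
    \<comment> \<open>The coefficients of \<open>nabh\<close> are transposed, so the free argument
      \<open>b\<close> moves to the first vector slot of \<open>G\<close>.\<close>
    have R2: "coords c x (dual_curvature A nabh x (fibre_deriv A H x p) (X x) p) \<bullet> b = - ?e \<bullet>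
      (?K ?g b ?Xx - ?K ?Xx b ?g + ?G (?G b ?Xx) ?g - ?G (?G b ?g) ?Xx)" for b
      using R(2)[of b] fibre_deriv_coords(2)[OF c p] by (simp add: coeff_deriv_def)
    show ?thesis
    proof (rule prod_eqI)
      show "fst (?l C) = fst (?r C)"
        by (simp add: L h1 h2 v DX0)
      show "snd (?l C) = snd (?r C)"
      proof (rule euclidean_eqI)
        fix b :: 'e assume b: "b \<in> Basis"
        show "snd (?l C) \<bullet> b = snd (?r C) \<bullet> b"
          by (simp add: L h1 h2 v R2 rX rg riesz_Basis[OF b] DX0 linear_add[OF lG] linear_diff[OF lG] linear_neg[OF lG]
              inner_diff_left inner_add_left inner_minus_left inner_diff_right inner_add_right)
      qed
    qed
  qed
qed

end

theorem lemma2p3: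
  fixes A :: "('m, 'e::euclidean_space) chart set"
    and nab nabh :: "('m, 'e) conn"
    and H :: "'m \<times> ('m, 'e) covec \<Rightarrow> real"
  assumes "smooth_manifold A"
    and "affine_connection A nab"
    and "smooth_fun (cotangent_atlas A) H"
    and "parallel_hamiltonian A nab H"
    and "nabh = adjoint_connection A nab"
  shows
    "(\<forall>I \<gamma> p l1 l2. open I \<longrightarrow> is_interval I \<longrightarrow> smooth_curve A I \<gamma> \<longrightarrow>
        parallel_along A nab I \<gamma> p \<longrightarrow>
        parallel_along A nab I \<gamma> l1 \<longrightarrow>
        parallel_along A nab I \<gamma> l2 \<longrightarrow>
        (\<forall>t\<in>I.
          ((\<lambda>t. l1 t (fibre_deriv A H (\<gamma> t) (p t))) has_real_derivative 0) (at t) \<and>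
          ((\<lambda>t. fibre_hessian H (\<gamma> t) (p t) (l1 t) (l2 t)) has_real_derivative 0) (at t)))
     \<and>
     (\<forall>X\<in>vector_fields A. \<forall>\<beta>\<in>one_forms A. \<forall>x\<in>points A. \<forall>p\<in>cotangent_space A x.
        lie_bracket (cotangent_atlas A) (hamiltonian_field A H)
            (\<lambda>(y, q). horizontal_lift A nabh y q (X y)) (x, p) =
          horizontal_lift A nabh x p (nabh x (fibre_deriv A H x p) X)
          + horizontal_lift A nabh x p (hessian_sharp A H x p (torsion_form A nab x (X x) p))
          - vertical_lift A x p (dual_curvature A nabh x (fibre_deriv A H x p) (X x) p)
        \<and>
        lie_bracket (cotangent_atlas A) (hamiltonian_field A H)
            (\<lambda>(y, q). vertical_lift A y q (\<beta> y)) (x, p) =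
          - horizontal_lift A nabh x p (hessian_sharp A H x p (\<beta> x))
          + vertical_lift A x p (dual_connection A nabh x (fibre_deriv A H x p) \<beta>))"
proof -
  interpret hausdorff_atlas A
    using assms(1) by unfold_locales (simp_all add: smooth_manifold_def)
  interpret parallel_hamiltonian_conn A H nab "christoffel nab"
    using assms(3,4) christoffel_conn_coeffs[OF assms(2)] by unfold_locales auto
  show ?thesis
    unfolding assms(5) using parallel_invariants bracket_horizontal bracket_vertical by simp
qed

end
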